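(* Every finite positive two-person SP interdiction game has a Nash equilibrium (in pure stationary strategies). Assuming that the independence system at each vertex is given by a polynomial-time independence oracle, such a Nash equilibrium can be computed in polynomial time.
   Context: An SP interdiction game $\Gamma=(G,s,t,\mathcal{I},r_1,r_2)$ consists of a finite digraph $G=(V,E)$, vertices $s,t\in V$, positive local cost functions $r_1,r_2:E\to\mathbb{R}_{>0}$, and for each $u\in V\setminus\{t\}$ an independence system $\mathcal{I}(u)\subseteq 2^{E(u)}$ (a family closed under taking subsets), where $E(u)=\{(u,v)\in E\}$ is the set of arcs leaving $u$, with $E(u)\notin\mathcal{I}(u)$. Let $\mathcal{D}(u)$ be the family of dependent sets, i.e. subsets of $E(u)$ not contained in any member of $\mathcal{I}(u)$ (nonempty since $E(u)\notin\mathcal{I}(u)$). A strategy of player 1 assigns to each $u\in V\setminus\{t\}$ a set $\sigma_1(u)\in\mathcal{I}(u)$; a strategy of player 2 assigns to each $u\in V\setminus\{t\}$ a set $\sigma_2(u)\in\mathcal{D}(u)$. For a situation $\sigma=(\sigma_1,\sigma_2)$, let $G(\sigma_1,\sigma_2)=\big(V,\bigcup_{u\in V\setminus\{t\}}\sigma_2(u)\setminus\sigma_1(u)\big)$, and for $i\in\{1,2\}$ let $P_i(\sigma)$ be the set of $r_i$-shortest directed $(s,t)$-paths in $G(\sigma_1,\sigma_2)$. The cost of player $i$ in situation $\sigma$ is $r_i(p)=\sum_{e\in p}r_i(e)$ if there is a path $p\in P_1(\sigma)\cap P_2(\sigma)$, and $+\infty$ otherwise. Both players minimize their costs. A Nash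 equilibrium is a situation in which no player can strictly decrease his cost by changing only his own strategy. An independence oracle for $\mathcal{I}(u)$ decides, for any given $X\subseteq E(u)$, whether $X\in\mathcal{I}(u)$. *)

theory Defs
  imports
    "Graph_Theory.Pair_Digraph"
    "HOL-Library.Extended_Real"
    "HOL-Library.FuncSet"
    "HOL-Library.Log_Nat"
    "HOL-Computational_Algebra.Polynomial"
begin

section \<open>SP interdiction games\<close>

record 'v sp_game =
  graph :: "'v pair_pre_digraph"
  source :: 'v
  target :: 'v
  indep :: "'v \<Rightarrow> ('v \<times> 'v) set set"
  cost1 :: "'v \<times> 'v \<Rightarrow> real"
  cost2 :: "'v \<times> 'v \<Rightarrow> real"

definition choice_verts :: "'v sp_game \<Rightarrow> 'v set" where
  "choice_verts \<Gamma> = pverts (graph \<Gamma>) - {target \<Gamma>}"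

text \<open>An independence system is nonempty (equivalently, it contains the empty set);
  otherwise player 1 would have no strategy at all.\<close>

definition independence_system :: "'a set \<Rightarrow> 'a set set \<Rightarrow> bool" where
  "independence_system A \<I> \<longleftrightarrow> \<I> \<noteq> {} \<and> \<I> \<subseteq> Pow A \<and> (\<forall>Y\<in>\<I>. \<forall>X. X \<subseteq> Y \<longrightarrow> X \<in> \<I>)"

text \<open>Directed graphs are finite, have no parallel arcs, and may have loops.
  The source and the target are allowed to coincide.\<close>

definition sp_interdiction_game :: "'v sp_game \<Rightarrow> bool" where
  "sp_interdiction_game \<Gamma> \<longleftrightarrow>
     pair_fin_digraph (graph \<Gamma>) \<and>
     source \<Gamma> \<in> pverts (graph \<Gamma>) \<and> target \<Gamma> \<in> pverts (graph \<Gamma>) \<and>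
     (\<forall>e\<in>parcs (graph \<Gamma>). 0 < cost1 \<Gamma> e \<and> 0 < cost2 \<Gamma> e) \<and>
     (\<forall>u\<in>choice_verts \<Gamma>.
        independence_system (out_arcs (graph \<Gamma>) u) (indep \<Gamma> u) \<and>
        out_arcs (graph \<Gamma>) u \<notin> indep \<Gamma> u)"

definition dependent :: "'v sp_game \<Rightarrow> 'v \<Rightarrow> ('v \<times> 'v) set set" where
  "dependent \<Gamma> u = {X. X \<subseteq> out_arcs (graph \<Gamma>) u \<and> \<not> (\<exists>Y\<in>indep \<Gamma> u. X \<subseteq> Y)}"

text \<open>Strategies are total functions whose values outside \<open>choice_verts \<Gamma>\<close> are irrelevant.\<close>

type_synonym 'v strategy = "'v \<Rightarrow> ('v \<times> 'v) set"

definition strategies1 :: "'v sp_game \<Rightarrow> 'v strategy set" where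
  "strategies1 \<Gamma> = Pi (choice_verts \<Gamma>) (indep \<Gamma>)"

definition strategies2 :: "'v sp_game \<Rightarrow> 'v strategy set" where
  "strategies2 \<Gamma> = Pi (choice_verts \<Gamma>) (dependent \<Gamma>)"

definition play_graph :: "'v sp_game \<Rightarrow> 'v strategy \<Rightarrow> 'v strategy \<Rightarrow> 'v pair_pre_digraph" where
  "play_graph \<Gamma> \<sigma>1 \<sigma>2 =
     \<lparr> pverts = pverts (graph \<Gamma>), parcs = (\<Union>u\<in>choice_verts \<Gamma>. \<sigma>2 u - \<sigma>1 u) \<rparr>"

definition st_paths :: "'v sp_game \<Rightarrow> 'v strategy \<Rightarrow> 'v strategy \<Rightarrow> ('v \<times> 'v) list set" where
  "st_paths \<Gamma> \<sigma>1 \<sigma>2 =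
     {p. pre_digraph.apath (with_proj (play_graph \<Gamma> \<sigma>1 \<sigma>2)) (source \<Gamma>) p (target \<Gamma>)}"

definition path_cost :: "('e \<Rightarrow> real) \<Rightarrow> 'e list \<Rightarrow> real" where
  "path_cost r p = (\<Sum>e\<leftarrow>p. r e)"

definition shortest_st_paths ::
  "'v sp_game \<Rightarrow> ('v \<times> 'v \<Rightarrow> real) \<Rightarrow> 'v strategy \<Rightarrow> 'v strategy \<Rightarrow> ('v \<times> 'v) list set" where
  "shortest_st_paths \<Gamma> r \<sigma>1 \<sigma>2 =
     {p \<in> st_paths \<Gamma> \<sigma>1 \<sigma>2. \<forall>p'\<in>st_paths \<Gamma> \<sigma>1 \<sigma>2. path_cost r p \<le> path_cost r p'}"

definition common_shortest :: "'v sp_game \<Rightarrow> 'v strategy \<Rightarrow> 'v strategy \<Rightarrow> ('v \<times> 'v) list set" where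
  "common_shortest \<Gamma> \<sigma>1 \<sigma>2 =
     shortest_st_paths \<Gamma> (cost1 \<Gamma>) \<sigma>1 \<sigma>2 \<inter> shortest_st_paths \<Gamma> (cost2 \<Gamma>) \<sigma>1 \<sigma>2"

text \<open>The value does not depend on the choice of the common shortest path,
  as all of them have the same length for either cost function.\<close>

definition player_cost ::
  "'v sp_game \<Rightarrow> ('v \<times> 'v \<Rightarrow> real) \<Rightarrow> 'v strategy \<Rightarrow> 'v strategy \<Rightarrow> ereal" where
  "player_cost \<Gamma> r \<sigma>1 \<sigma>2 =
     (if common_shortest \<Gamma> \<sigma>1 \<sigma>2 = {} then \<infinity>
      else ereal (path_cost r (SOME p. p \<in> common_shortest \<Gamma> \<sigma>1 \<sigma>2)))"

definition nash_equilibrium :: "'v sp_game \<Rightarrow> 'v strategy \<Rightarrow> 'v strategy \<Rightarrow> bool" where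
  "nash_equilibrium \<Gamma> \<sigma>1 \<sigma>2 \<longleftrightarrow>
     \<sigma>1 \<in> strategies1 \<Gamma> \<and> \<sigma>2 \<in> strategies2 \<Gamma> \<and>
     (\<forall>\<sigma>1'\<in>strategies1 \<Gamma>.
        \<not> player_cost \<Gamma> (cost1 \<Gamma>) \<sigma>1' \<sigma>2 < player_cost \<Gamma> (cost1 \<Gamma>) \<sigma>1 \<sigma>2) \<and>
     (\<forall>\<sigma>2'\<in>strategies2 \<Gamma>.
        \<not> player_cost \<Gamma> (cost2 \<Gamma>) \<sigma>1 \<sigma>2' < player_cost \<Gamma> (cost2 \<Gamma>) \<sigma>1 \<sigma>2)"


section \<open>Oracle programs with logarithmic cost\<close>

text \<open>The machine model is a structured random access machine under the logarithmic cost
  criterion, which is polynomially equivalent to Turing machines. The memory consists of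
  arrays of natural numbers of arbitrary size; a scalar is an array of which only cell 0 is used.
  Every operation is charged for the bit lengths of its operands and of the addresses it
  uses; multiplication and division are charged for the product of these lengths.\<close>

type_synonym memory = "string \<Rightarrow> nat \<Rightarrow> nat"

definition bits :: "nat \<Rightarrow> nat" where
  "bits k = max 1 (floorlog 2 k)"

datatype expr =
    Lit nat
  | Cell string expr
  | Plus expr expr
  | Minus expr expr
  | Times expr expr
  | Div expr expr

text \<open>\<open>Minus\<close> is truncated subtraction, and division by zero yields zero.\<close>

fun val :: "expr \<Rightarrow> memory \<Rightarrow> nat" where
  "val (Lit k) m = k"
| "val (Cell a e) m = m a (val e m)"
| "val (Plus e f) m = val e m + val f m"
| "val (Minus e f) m = val e m - val f m"
| "val (Times e f) m = val e m * val f m"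
| "val (Div e f) m = val e m div val f m"

fun val_time :: "expr \<Rightarrow> memory \<Rightarrow> nat" where
  "val_time (Lit k) m = bits k"
| "val_time (Cell a e) m = val_time e m + bits (val e m) + bits (m a (val e m))"
| "val_time (Plus e f) m = val_time e m + val_time f m + bits (val e m) + bits (val f m)"
| "val_time (Minus e f) m = val_time e m + val_time f m + bits (val e m) + bits (val f m)"
| "val_time (Times e f) m = val_time e m + val_time f m + bits (val e m) * bits (val f m)"
| "val_time (Div e f) m = val_time e m + val_time f m + bits (val e m) * bits (val f m)"

text \<open>Conditions hold if they evaluate to a nonzero number. \<open>Query x a e\<close> asks the
  oracle about the list of the first \<open>val e\<close> cells of array \<open>a\<close> and
  stores the answer, as 0 or 1, in cell 0 of \<open>x\<close>.\<close>

datatype program =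
    Skip
  | Assign string expr expr
  | Seq program program
  | Cond expr program program
  | While expr program
  | Query string string expr

text \<open>\<open>exec ora tim c m k m'\<close>: started in memory \<open>m\<close>, program \<open>c\<close> terminates in time \<open>k\<close> with
  memory \<open>m'\<close>. The oracle answers a query \<open>q\<close> by \<open>ora q\<close>, and \<open>tim q\<close> is the time it takes
  to do so, which is charged to the program in addition to the length of the query.\<close>

inductive exec :: "(nat list \<Rightarrow> bool) \<Rightarrow> (nat list \<Rightarrow> nat) \<Rightarrow> program \<Rightarrow> memory \<Rightarrow> nat \<Rightarrow> memory \<Rightarrow> bool"
  for ora :: "nat list \<Rightarrow> bool" and tim :: "nat list \<Rightarrow> nat" where
  Skip: "exec ora tim Skip m 1 m"
| Assign: "exec ora tim (Assign a i e) m
     (val_time i m + val_time e m + bits (val i m) + bits (val e m))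
     (m(a := (m a)(val i m := val e m)))"
| Seq: "exec ora tim c m k m' \<Longrightarrow> exec ora tim d m' l m'' \<Longrightarrow> exec ora tim (Seq c d) m (k + l) m''"
| CondTrue: "val b m \<noteq> 0 \<Longrightarrow> exec ora tim c m k m' \<Longrightarrow>
     exec ora tim (Cond b c d) m (val_time b m + k) m'"
| CondFalse: "val b m = 0 \<Longrightarrow> exec ora tim d m k m' \<Longrightarrow>
     exec ora tim (Cond b c d) m (val_time b m + k) m'"
| WhileTrue: "val b m \<noteq> 0 \<Longrightarrow> exec ora tim c m k m' \<Longrightarrow> exec ora tim (While b c) m' l m'' \<Longrightarrow>
     exec ora tim (While b c) m (val_time b m + k + l) m''"
| WhileFalse: "val b m = 0 \<Longrightarrow> exec ora tim (While b c) m (val_time b m) m"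
| Query: "qs = map (m a) [0..<val e m] \<Longrightarrow>
     exec ora tim (Query x a e) m
       (1 + val_time e m + (\<Sum>j\<leftarrow>qs. bits j) + tim qs)
       (m(x := (m x)(0 := (if ora qs then 1 else 0))))"


section \<open>Encoding of games\<close>

text \<open>To be an input of a program, a game needs rational costs. It is presented by
  a listing of its vertices and, for each arc, numerators and denominators
  (not necessarily in lowest terms). The independence systems
  are not part of the input; they are accessible through the oracle only.\<close>

record 'v presentation =
  listing :: "'v list"
  num1 :: "'v \<times> 'v \<Rightarrow> nat"
  den1 :: "'v \<times> 'v \<Rightarrow> nat"
  num2 :: "'v \<times> 'v \<Rightarrow> nat"
  den2 :: "'v \<times> 'v \<Rightarrow> nat"

definition presents :: "'v presentation \<Rightarrow> 'v sp_game \<Rightarrow> bool" where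
  "presents P \<Gamma> \<longleftrightarrow>
     distinct (listing P) \<and> set (listing P) = pverts (graph \<Gamma>) \<and>
     (\<forall>e\<in>parcs (graph \<Gamma>).
        den1 P e > 0 \<and> cost1 \<Gamma> e = real (num1 P e) / real (den1 P e) \<and>
        den2 P e > 0 \<and> cost2 \<Gamma> e = real (num2 P e) / real (den2 P e))"

definition input_size :: "'v sp_game \<Rightarrow> 'v presentation \<Rightarrow> nat" where
  "input_size \<Gamma> P =
     length (listing P) +
     (\<Sum>e\<in>parcs (graph \<Gamma>). bits (num1 P e) + bits (den1 P e) + bits (num2 P e) + bits (den2 P e))"

definition index_of :: "'a list \<Rightarrow> 'a \<Rightarrow> nat" where
  "index_of xs x = (THE i. i < length xs \<and> xs ! i = x)"

definition scalar :: "nat \<Rightarrow> nat \<Rightarrow> nat" where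
  "scalar k = (\<lambda>_. 0)(0 := k)"

text \<open>Row-major matrix of the values of \<open>f\<close> on the arcs, with entry 0 for pairs that are not arcs.\<close>

definition arc_matrix :: "'v sp_game \<Rightarrow> 'v presentation \<Rightarrow> ('v \<times> 'v \<Rightarrow> nat) \<Rightarrow> nat \<Rightarrow> nat" where
  "arc_matrix \<Gamma> P f k =
     (let n = length (listing P); e = (listing P ! (k div n), listing P ! (k mod n))
      in if k < n * n \<and> e \<in> parcs (graph \<Gamma>) then f e else 0)"

definition input_memory :: "'v sp_game \<Rightarrow> 'v presentation \<Rightarrow> memory" where
  "input_memory \<Gamma> P = (\<lambda>_ _. 0)
     (''n'' := scalar (length (listing P)),
      ''s'' := scalar (index_of (listing P) (source \<Gamma>)),
      ''t'' := scalar (index_of (listing P) (target \<Gamma>)),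
      ''arc'' := arc_matrix \<Gamma> P (\<lambda>_. 1),
      ''num1'' := arc_matrix \<Gamma> P (num1 P),
      ''den1'' := arc_matrix \<Gamma> P (den1 P),
      ''num2'' := arc_matrix \<Gamma> P (num2 P),
      ''den2'' := arc_matrix \<Gamma> P (den2 P))"

text \<open>The strategy whose arcs are marked by nonzero entries of a row-major matrix.\<close>

definition strategy_of :: "'v presentation \<Rightarrow> (nat \<Rightarrow> nat) \<Rightarrow> 'v strategy" where
  "strategy_of P A = (\<lambda>u. let n = length (listing P) in
     {(listing P ! i, listing P ! j) | i j.
        i < n \<and> j < n \<and> listing P ! i = u \<and> A (i * n + j) \<noteq> 0})"

text \<open>A well-formed query \<open>i # js\<close> consists of (the index of) a vertex \<open>u\<close> other than the target
  and the heads of a set of arcs leaving \<open>u\<close>, without repetitions. The oracle has to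
  answer these correctly, each within time \<open>B\<close>; nothing is assumed about
  its answers and its time on other queries.\<close>

definition independence_oracle ::
  "'v sp_game \<Rightarrow> 'v presentation \<Rightarrow> nat \<Rightarrow> (nat list \<Rightarrow> bool) \<Rightarrow> (nat list \<Rightarrow> nat) \<Rightarrow> bool" where
  "independence_oracle \<Gamma> P B ora tim \<longleftrightarrow>
     (\<forall>i < length (listing P). \<forall>js.
        let u = listing P ! i in
        u \<in> choice_verts \<Gamma> \<and> distinct js \<and>
        (\<forall>j\<in>set js. j < length (listing P) \<and> (u, listing P ! j) \<in> parcs (graph \<Gamma>)) \<longrightarrow>
        (ora (i # js) \<longleftrightarrow> (\<lambda>j. (u, listing P ! j)) ` set js \<in> indep \<Gamma> u) \<and>
        tim (i # js) \<le> B)"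

end

theory Submission
  imports Defs
begin

text \<open>
Call a set of arcs leaving a vertex winning for player 2 if it is dependent, and winning for player 1 if
its complement is independent; the two notions are dual. Let \<open>v u\<close> be the value of the zero-sum game in
which player 2, paying \<open>r\<^sub>2\<close>, has to pick a winning set at every vertex and the opponent picks an arc of it.
Positivity allows to compute \<open>v\<close> by a Dijkstra-type procedure. Suppose that \<open>v\<close> is finite at \<open>s\<close>.
Player 2 plays the winning sets \<open>{(u, w). r\<^sub>2(u, w) + v w \<le> v u}\<close>, and \<open>p\<close> is an \<open>r\<^sub>1\<close>-shortest
path in the resulting acyclic graph. Player 1 blocks all arcs \<open>(u, w)\<close> with \<open>r\<^sub>2(u, w) + v w < v u\<close> except
those of \<open>p\<close>. With respect to the reduced cost \<open>r\<^sub>2(u, w) + v w - v u\<close> the arcs of \<open>p\<close> are nonpositive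
and all other unblocked arcs are nonnegative, so \<open>p\<close> is also an \<open>r\<^sub>2\<close>-shortest unblocked path.
If \<open>v\<close> is infinite at \<open>s\<close>, exchange the roles of the players; if the dual value is infinite, too,
each player can separate \<open>t\<close> from \<open>s\<close>.
\<close>

section \<open>Certificates by a Dijkstra-type procedure\<close>

text \<open>A finite cost requires one path that is shortest for both players, so a deviation could
  act through either cost function. The argument avoids this interaction: the path is
  \<open>r1\<close>-shortest already when player 1 blocks nothing, and \<open>r2\<close>-shortest
  already when player 2 plays every arc. Each deviation produces a subgraph of one of these two
  graphs. The path minimizes the opponent's cost, so its arcs may undercut \<open>v u\<close>. They
  must stay open, and leaving them open only shrinks the blocked set, which remains independent
  because independence is inherited by subsets. The roles can be exchanged since the procedure sees
  only an upward closed family of winning sets; for either player one independence query decides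
  membership. For the time bound, each player's costs are multiplied by the product of that player's
  denominators. With input size \<open>S\<close> the product is at most \<open>2 ^ S\<close>, and
  all values and sums of integer costs fit into \<open>3 * S + 1\<close> bits. The program is
  written with counted loops only, so that a polynomial step count can be read off its syntax, and
  its result on indices is carried back to vertices.\<close>

lemma arg_min_on_finite:
  fixes f :: "'a \<Rightarrow> real"
  assumes "finite S" "S \<noteq> {}"
  shows "\<exists>x\<in>S. \<forall>y\<in>S. f x \<le> f y"
  using assms arg_min_if_finite[of S f] by (meson not_less)

fun walk :: "'a \<Rightarrow> ('a \<times> 'a) list \<Rightarrow> 'a \<Rightarrow> bool" where
  "walk u [] w \<longleftrightarrow> u = w"
| "walk u (e # p) w \<longleftrightarrow> fst e = u \<and> walk (snd e) p w"

lemma walk_snoc: "walk u (p @ [e]) w \<longleftrightarrow> walk u p (fst e) \<and> snd e = w"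
  by (induction p arbitrary: u) auto

text \<open>The bound \<open>c\<close> is separate from \<open>v u\<close> because thresholds are
  tried at \<open>u\<close> before \<open>v u\<close> is known. Heads outside \<open>F\<close> never
  count: their values are still undetermined, or infinite in the end.\<close>

definition heads_le ::
  "('a \<Rightarrow> 'a set) \<Rightarrow> ('a \<Rightarrow> 'a \<Rightarrow> real) \<Rightarrow> 'a set \<Rightarrow> ('a \<Rightarrow> real) \<Rightarrow> 'a \<Rightarrow> real \<Rightarrow> 'a set" where
  "heads_le E R F v u c = {w \<in> E u. w \<in> F \<and> R u w + v w \<le> c}"

definition heads_less ::
  "('a \<Rightarrow> 'a set) \<Rightarrow> ('a \<Rightarrow> 'a \<Rightarrow> real) \<Rightarrow> 'a set \<Rightarrow> ('a \<Rightarrow> real) \<Rightarrow> 'a \<Rightarrow> real \<Rightarrow> 'a set" where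
  "heads_less E R F v u c = {w \<in> E u. w \<in> F \<and> R u w + v w < c}"

text \<open>The first two conditions at \<open>u\<close> make \<open>v u\<close> the least winning
  threshold. \<open>d\<close> is the \<open>R'\<close>-distance to \<open>t\<close> in the graph of
  the sets \<open>heads_le\<close>, with \<open>nx\<close> a minimizing successor; where
  \<open>R\<close> is positive, \<open>v\<close> falls along these arcs and the graph is
  acyclic.\<close>

definition settled ::
  "('a \<Rightarrow> 'a set) \<Rightarrow> ('a \<Rightarrow> 'a set \<Rightarrow> bool) \<Rightarrow> ('a \<Rightarrow> 'a \<Rightarrow> real) \<Rightarrow> ('a \<Rightarrow> 'a \<Rightarrow> real) \<Rightarrow> 'a \<Rightarrow>
   'a set \<Rightarrow> ('a \<Rightarrow> real) \<Rightarrow> ('a \<Rightarrow> real) \<Rightarrow> ('a \<Rightarrow> 'a) \<Rightarrow> bool" where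
  "settled E M R R' t F v d nx \<longleftrightarrow>
     t \<in> F \<and> v t = 0 \<and> d t = 0 \<and>
     (\<forall>u\<in>F - {t}.
        M u (heads_le E R F v u (v u)) \<and> \<not> M u (heads_less E R F v u (v u)) \<and>
        nx u \<in> heads_le E R F v u (v u) \<and> d u = R' u (nx u) + d (nx u) \<and>
        (\<forall>w\<in>heads_le E R F v u (v u). d u \<le> R' u w + d w))"

text \<open>The last condition is the monotone order of settling: with heads in \<open>F\<close>, no
  remaining vertex can attain a value below one that is already settled.\<close>

definition dijkstra_inv where
  "dijkstra_inv V E M R R' t F v d nx \<longleftrightarrow>
     settled E M R R' t F v d nx \<and> F \<subseteq> V \<and>
     (\<forall>u\<in>V - F. \<forall>x\<in>F. \<not> M u (heads_less E R F v u (v x)))"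

definition certificate where
  "certificate V E M R R' t F v d nx \<longleftrightarrow>
     settled E M R R' t F v d nx \<and> F \<subseteq> V \<and> (\<forall>u\<in>V - F. \<not> M u (E u \<inter> F))"

locale arena =
  fixes V :: "'a set" and E :: "'a \<Rightarrow> 'a set" and M :: "'a \<Rightarrow> 'a set \<Rightarrow> bool"
    and R R' :: "'a \<Rightarrow> 'a \<Rightarrow> real" and t :: 'a
  assumes finite_V: "finite V" and E_sub: "u \<in> V \<Longrightarrow> E u \<subseteq> V" and t_in: "t \<in> V"
    and M_mono: "u \<in> V - {t} \<Longrightarrow> M u X \<Longrightarrow> X \<subseteq> Y \<Longrightarrow> M u Y"
    and M_empty: "u \<in> V - {t} \<Longrightarrow> \<not> M u {}"
    and R_pos: "u \<in> V \<Longrightarrow> w \<in> E u \<Longrightarrow> 0 < R u w"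
begin

lemma finite_E: "u \<in> V \<Longrightarrow> finite (E u)"
  using finite_V E_sub finite_subset by blast

lemma dijkstra_init:
  assumes "v t = 0" "d t = 0"
  shows "dijkstra_inv V E M R R' t {t} v d nx"
proof -
  have "heads_less E R {t} v u (v t) = {}" if "u \<in> V" for u
    using R_pos[OF that] by (force simp: heads_less_def)
  then show ?thesis
    using M_empty t_in assms by (auto simp: dijkstra_inv_def settled_def)
qed

text \<open>By the order of settling, \<open>c\<close> is at least every value in \<open>F\<close>,
  and an arc into \<open>u\<close> has a total above \<open>c\<close> because \<open>R\<close> is
  positive. So \<open>u\<close> enters none of the sets \<open>heads_le\<close> or
  \<open>heads_less\<close> with bound at most \<open>c\<close>, and everything known about earlier
  vertices survives.\<close>

lemma dijkstra_step:
  assumes inv: "dijkstra_inv V E M R R' t F v d nx"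
    and u: "u \<in> V - F"
    and big: "M u (heads_le E R F v u c)"
    and least: "\<And>w. w \<in> V - F \<Longrightarrow> \<not> M w (heads_less E R F v w c)"
    and x: "x \<in> heads_le E R F v u c"
    and x_least: "\<And>w. w \<in> heads_le E R F v u c \<Longrightarrow> R' u x + d x \<le> R' u w + d w"
  shows "dijkstra_inv V E M R R' t (insert u F) (v(u := c)) (d(u := R' u x + d x)) (nx(u := x))"
proof -
  let ?F = "insert u F" and ?v = "v(u := c)"
  have tF: "t \<in> F" and FV: "F \<subseteq> V" and uV: "u \<in> V" and unF: "u \<notin> F" and ut: "u \<noteq> t"
    using inv u by (auto simp: dijkstra_inv_def settled_def)
  have v_le: "v y \<le> c" if "y \<in> F" for y
  proof (rule ccontr)
    assume "\<not> v y \<le> c"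
    then have "heads_le E R F v u c \<subseteq> heads_less E R F v u (v y)"
      by (auto simp: heads_le_def heads_less_def)
    with big have "M u (heads_less E R F v u (v y))"
      using M_mono uV ut by blast
    with inv that u show False
      by (auto simp: dijkstra_inv_def)
  qed
  have le_same: "heads_le E R ?F ?v w b = heads_le E R F v w b" if "w \<in> V" "b \<le> c" for w b
    using R_pos[OF that(1), of u] that(2) unF by (auto simp: heads_le_def)
  have less_same: "heads_less E R ?F ?v w b = heads_less E R F v w b" if "w \<in> V" "b \<le> c" for w b
    using R_pos[OF that(1), of u] that(2) unF by (auto simp: heads_less_def)
  have inF: "w \<in> F" if "w \<in> heads_le E R F v y b" for w y b
    using that by (simp add: heads_le_def)
  have "settled E M R R' t ?F ?v (d(u := R' u x + d x)) (nx(u := x))"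
    unfolding settled_def
  proof (intro conjI ballI)
    show "t \<in> ?F" "?v t = 0" "(d(u := R' u x + d x)) t = 0"
      using inv ut by (auto simp: dijkstra_inv_def settled_def)
  next
    fix y assume y: "y \<in> ?F - {t}"
    then have yV: "y \<in> V" using FV uV by auto
    have yle: "?v y \<le> c" using y v_le by auto
    note same = le_same[OF yV yle] less_same[OF yV yle]
    have F_case: "y \<in> F - {t}" "y \<noteq> u" if "y \<noteq> u" using y that by auto
    have S: "M y (heads_le E R F v y (v y))" "\<not> M y (heads_less E R F v y (v y))"
      "nx y \<in> heads_le E R F v y (v y)" "d y = R' y (nx y) + d (nx y)"
      "\<forall>w\<in>heads_le E R F v y (v y). d y \<le> R' y w + d w" if "y \<noteq> u"
      using inv F_case[OF that] unfolding dijkstra_inv_def settled_def by blast+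
    show "M y (heads_le E R ?F ?v y (?v y))"
      unfolding same using S(1) big by auto
    show "\<not> M y (heads_less E R ?F ?v y (?v y))"
      unfolding same using S(2) least[OF u] by auto
    show "(nx(u := x)) y \<in> heads_le E R ?F ?v y (?v y)"
      unfolding same using S(3) x by auto
    show "(d(u := R' u x + d x)) y = R' y ((nx(u := x)) y) + (d(u := R' u x + d x)) ((nx(u := x)) y)"
      using S(3,4) x inF unF by auto
    fix w assume "w \<in> heads_le E R ?F ?v y (?v y)"
    then have "w \<in> heads_le E R F v y (?v y)" unfolding same .
    moreover from this have "w \<noteq> u" using inF unF by auto
    ultimately show "(d(u := R' u x + d x)) y \<le> R' y w + (d(u := R' u x + d x)) w"
      using S(5) x_least by auto
  qed
  moreover have "?F \<subseteq> V" using FV uV by simp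
  moreover have "\<not> M w (heads_less E R ?F ?v w (?v y))" if "w \<in> V - ?F" "y \<in> ?F" for w y
  proof -
    have "heads_less E R ?F ?v w (?v y) = heads_less E R F v w (?v y)"
      using that v_le by (intro less_same) auto
    then show ?thesis
      using that inv least[of w] unfolding dijkstra_inv_def by auto
  qed
  ultimately show ?thesis by (simp add: dijkstra_inv_def)
qed

text \<open>It suffices to try the values of arcs as thresholds.\<close>

lemma threshold_le:
  assumes "u \<in> V - {t}" "M u (E u \<inter> F)"
  obtains w where "w \<in> E u" "w \<in> F" "M u (heads_le E R F v u (R u w + v w))"
proof -
  let ?f = "\<lambda>w. R u w + v w"
  have fin: "finite (?f ` (E u \<inter> F))" and ne: "?f ` (E u \<inter> F) \<noteq> {}"
    using assms finite_E M_empty by auto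
  obtain w where w: "w \<in> E u \<inter> F" "Max (?f ` (E u \<inter> F)) = ?f w"
    using Max_in[OF fin ne] by auto
  have "?f z \<le> ?f w" if "z \<in> E u \<inter> F" for z
    using Max_ge[OF fin, of "?f z"] that w(2) by simp
  then have "E u \<inter> F \<subseteq> heads_le E R F v u (?f w)"
    by (auto simp: heads_le_def)
  with that[of w] w M_mono[OF assms] show ?thesis by auto
qed

lemma threshold_less:
  assumes "u \<in> V - {t}" "M u (heads_less E R F v u c)"
  obtains w where "w \<in> E u" "w \<in> F" "R u w + v w < c" "M u (heads_le E R F v u (R u w + v w))"
proof -
  \<comment> \<open>Cutting \<open>F\<close> down to these heads turns the strict bound into
    membership, so that \<open>threshold_le\<close> applies and yields an arc below
    \<open>c\<close>.\<close>
  let ?G = "{w \<in> F. R u w + v w < c}"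
  have "heads_less E R F v u c = E u \<inter> ?G" by (auto simp: heads_less_def)
  with assms(2) have "M u (E u \<inter> ?G)" by simp
  then obtain w where w: "w \<in> E u" "w \<in> ?G" "M u (heads_le E R ?G v u (R u w + v w))"
    using threshold_le[OF assms(1), of ?G v] by blast
  moreover have "heads_le E R ?G v u (R u w + v w) \<subseteq> heads_le E R F v u (R u w + v w)"
    by (auto simp: heads_le_def)
  ultimately show ?thesis using that[of w] M_mono[OF assms(1) w(3)] by blast
qed

text \<open>Each round settles the tail of a cheapest arc from outside \<open>F\<close> into
  \<open>F\<close> whose total is a winning threshold. Such an arc exists as long as some remaining
  vertex wins with heads in \<open>F\<close>, and its minimality over all tails is the condition
  \<open>least\<close> of \<open>dijkstra_step\<close>.\<close>

lemma certificate_exists: "\<exists>F v d nx. certificate V E M R R' t F v d nx"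
proof -
  have "\<exists>F v d nx. certificate V E M R R' t F v d nx"
    if "dijkstra_inv V E M R R' t F v d nx" for F v d nx
    using that
  proof (induction "card (V - F)" arbitrary: F v d nx rule: less_induct)
    case less
    note inv = less.prems
    have FV: "F \<subseteq> V" and tF: "t \<in> F" using inv by (auto simp: dijkstra_inv_def settled_def)
    show ?case
    proof (cases "\<forall>u\<in>V - F. \<not> M u (E u \<inter> F)")
      case True
      then have "certificate V E M R R' t F v d nx"
        using inv by (simp add: certificate_def dijkstra_inv_def)
      then show ?thesis by blast
    next
      case False
      let ?f = "\<lambda>(u, w). R u w + v w"
      let ?C = "{(u, w). u \<in> V - F \<and> w \<in> E u \<inter> F \<and> M u (heads_le E R F v u (R u w + v w))}"
      have "?C \<subseteq> V \<times> V" using E_sub by auto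
      then have fin: "finite ?C" using finite_V finite_subset by blast
      from False obtain u0 where "u0 \<in> V - F" "M u0 (E u0 \<inter> F)" by auto
      then obtain w0 where "w0 \<in> E u0" "w0 \<in> F" "M u0 (heads_le E R F v u0 (R u0 w0 + v w0))"
        using threshold_le[of u0 F v] tF by blast
      with \<open>u0 \<in> V - F\<close> have "(u0, w0) \<in> ?C" by simp
      then obtain u w where uw: "(u, w) \<in> ?C" and min: "\<And>e. e \<in> ?C \<Longrightarrow> ?f (u, w) \<le> ?f e"
        using arg_min_on_finite[OF fin, of ?f] by blast
      let ?c = "R u w + v w"
      let ?A = "heads_le E R F v u ?c"
      have finA: "finite ?A"
        using uw finite_E finite_subset[of ?A "E u"] by (auto simp: heads_le_def)
      have "w \<in> ?A" using uw by (auto simp: heads_le_def)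
      with finA obtain x where x: "x \<in> ?A" and x_min: "\<And>z. z \<in> ?A \<Longrightarrow> R' u x + d x \<le> R' u z + d z"
        using arg_min_on_finite[of ?A "\<lambda>z. R' u z + d z"] by blast
      have least: "\<not> M y (heads_less E R F v y ?c)" if y: "y \<in> V - F" for y
      proof
        assume "M y (heads_less E R F v y ?c)"
        then obtain z where "z \<in> E y" "z \<in> F" "R y z + v z < ?c" "M y (heads_le E R F v y (R y z + v z))"
          using threshold_less[of y F v ?c] y tF by blast
        with min[of "(y, z)"] y show False by auto
      qed
      have "dijkstra_inv V E M R R' t (insert u F) (v(u := ?c)) (d(u := R' u x + d x)) (nx(u := x))"
        using uw x x_min least by (intro dijkstra_step[OF inv]) auto
      moreover have "card (V - insert u F) < card (V - F)"
        using uw finite_V by (intro psubset_card_mono) auto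
      ultimately show ?thesis using less.hyps by blast
    qed
  qed
  from this[OF dijkstra_init[of "\<lambda>_. 0" "\<lambda>_. 0"]] show ?thesis by simp
qed

end

section \<open>Paths along the chosen successors\<close>

definition follows where
  "follows F t nx p \<longleftrightarrow> set p \<subseteq> {(u, nx u) | u. u \<in> F - {t}}"

lemma settled_nx:
  assumes "settled E M R R' t F v d nx" "u \<in> F - {t}" and pos: "\<And>w. w \<in> E u \<Longrightarrow> 0 < R u w"
  shows "nx u \<in> F" "nx u \<in> E u" "v (nx u) < v u" "R u (nx u) + v (nx u) \<le> v u"
proof -
  have "nx u \<in> heads_le E R F v u (v u)" using assms(1,2) unfolding settled_def by blast
  then show "nx u \<in> F" "nx u \<in> E u" "R u (nx u) + v (nx u) \<le> v u" "v (nx u) < v u"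
    using pos[of "nx u"] by (auto simp: heads_le_def)
qed

text \<open>\<open>v\<close> decreases strictly along every arc \<open>(u, nx u)\<close>, so no
  vertex can recur.\<close>

lemma follows_distinct:
  assumes "settled E M R R' t F v d nx" and pos: "\<And>u w. u \<in> F \<Longrightarrow> w \<in> E u \<Longrightarrow> 0 < R u w"
    and "follows F t nx p" "walk s p x"
  shows "distinct (map fst p @ [x])"
  using assms(3,4)
proof (induction p arbitrary: s)
  case Nil
  then show ?case by simp
next
  case (Cons e p)
  have less: "v y < v (fst e)" if "follows F t nx (e # p)" "walk s (e # p) x" "y \<in> set (map fst p @ [x])"
    for e p s y
    using that
  proof (induction p arbitrary: e s)
    case Nil
    then have "fst e \<in> F - {t}" "snd e = nx (fst e)" by (auto simp: follows_def)
    with Nil show ?case using settled_nx(3)[OF assms(1) _ pos, of "fst e"] by auto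
  next
    case (Cons e' p)
    then have "fst e \<in> F - {t}" "snd e = nx (fst e)" by (auto simp: follows_def)
    then have "v (fst e') < v (fst e)"
      using Cons.prems(2) settled_nx(3)[OF assms(1) _ pos, of "fst e"] by auto
    moreover have "v y \<le> v (fst e')"
    proof (cases "y = fst e'")
      case False
      then show ?thesis
        using Cons.IH[of e' "fst e'"] Cons.prems by (auto simp: follows_def intro: less_imp_le)
    qed simp
    ultimately show ?case by simp
  qed
  show ?case
    using less[OF Cons.prems] Cons.IH[of "snd e"] Cons.prems by (auto simp: follows_def)
qed

lemma follows_length:
  assumes "settled E M R R' t F v d nx" "\<And>u w. u \<in> F \<Longrightarrow> w \<in> E u \<Longrightarrow> 0 < R u w"
    and "follows F t nx p" "walk s p x" "x \<in> F" "finite F"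
  shows "length p < card F"
proof -
  have "distinct (map fst p @ [x])" by (rule follows_distinct[OF assms(1-4)])
  moreover have "set (map fst p @ [x]) \<subseteq> F" using assms(3,5) by (auto simp: follows_def)
  ultimately have "length (map fst p @ [x]) \<le> card F"
    by (metis assms(6) card_mono distinct_card)
  then show ?thesis by simp
qed

lemma follows_extend:
  assumes "settled E M R R' t F v d nx" "\<And>u w. u \<in> F \<Longrightarrow> w \<in> E u \<Longrightarrow> 0 < R u w"
    and "follows F t nx p" "walk s p x" "x \<in> F" "x \<noteq> t"
  shows "follows F t nx (p @ [(x, nx x)])" "walk s (p @ [(x, nx x)]) (nx x)" "nx x \<in> F"
  using assms settled_nx(1)[OF assms(1), of x] by (auto simp: follows_def walk_snoc)

lemma follows_exists:
  assumes "settled E M R R' t F v d nx" "\<And>u w. u \<in> F \<Longrightarrow> w \<in> E u \<Longrightarrow> 0 < R u w"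
    and "s \<in> F" "finite F"
  shows "\<exists>p. follows F t nx p \<and> walk s p t"
proof -
  have "\<exists>p x. follows F t nx p \<and> walk s p x \<and> x \<in> F \<and> (x = t \<or> length p = k)" for k
  proof (induction k)
    case 0
    then show ?case using assms(3) by (intro exI[of _ "[]"] exI[of _ s]) (auto simp: follows_def)
  next
    case (Suc k)
    then obtain p x where p: "follows F t nx p" "walk s p x" "x \<in> F" "x = t \<or> length p = k" by blast
    show ?case
    proof (cases "x = t")
      case False
      then show ?thesis using follows_extend[OF assms(1,2) p(1-3)] p(4)
        by (intro exI[of _ "p @ [(x, nx x)]"] exI[of _ "nx x"]) auto
    qed (use p in blast)
  qed
  \<comment> \<open>Taken at \<open>k = card F\<close>: a path of that length would visit more than
    \<open>card F\<close> distinct vertices of \<open>F\<close>, so it must have reached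
    \<open>t\<close>.\<close>
  then obtain p x where p: "follows F t nx p" "walk s p x" "x \<in> F" "x = t \<or> length p = card F"
    by blast
  then have "x = t" using follows_length[OF assms(1,2) p(1-3) assms(4)] by auto
  with p show ?thesis by blast
qed

section \<open>Safe arcs, guarded arcs and reduced costs\<close>

definition safe_heads where
  "safe_heads E R F v u = {w \<in> E u. u \<in> F \<longrightarrow> w \<in> F \<and> R u w + v w \<le> v u}"

text \<open>These are the arcs that the opponent leaves open. Apart from the arcs of
  \<open>p\<close>, an arc entering \<open>F\<close> stays open only if it starts in
  \<open>F\<close> and does not undercut \<open>v u\<close>; so no open arc leads from outside into
  \<open>F\<close>, where \<open>t\<close> lies.\<close>

definition guard_heads where
  "guard_heads E R F v p u = {w \<in> E u. (w \<in> F \<longrightarrow> u \<in> F \<and> v u \<le> R u w + v w) \<or> (u, w) \<in> set p}"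

lemma settled_follows_cost:
  assumes "settled E M R R' t F v d nx" "follows F t nx p" "walk s p t"
  shows "(\<Sum>(u, w)\<leftarrow>p. R' u w) = d s"
  using assms(2,3)
proof (induction p arbitrary: s)
  case Nil
  then show ?case using assms(1) by (simp add: settled_def)
next
  case (Cons e p)
  obtain u where "e = (u, nx u)" "u \<in> F - {t}" "u = s"
    using Cons.prems by (auto simp: follows_def)
  moreover from this have "d u = R' u (nx u) + d (nx u)"
    using assms(1) by (auto simp: settled_def)
  ultimately show ?case using Cons by (auto simp: follows_def)
qed

text \<open>Bellman's inequality \<open>d u \<le> R' u w + d w\<close> summed along
  \<open>q\<close>; it is available on every arc because safe arcs never leave
  \<open>F\<close>.\<close>

lemma settled_safe_cost:
  assumes "settled E M R R' t F v d nx" "s \<in> F" "walk s q t"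
    and "\<And>u w. (u, w) \<in> set q \<Longrightarrow> u \<noteq> t \<and> w \<in> safe_heads E R F v u"
  shows "d s \<le> (\<Sum>(u, w)\<leftarrow>q. R' u w)"
  using assms(2-4)
proof (induction q arbitrary: s)
  case Nil
  then show ?case using assms(1) by (simp add: settled_def)
next
  case (Cons e q)
  obtain w where e: "e = (s, w)" and w: "walk w q t" using Cons.prems(2) by (cases e) auto
  have s: "s \<noteq> t" "w \<in> safe_heads E R F v s" using Cons.prems(3)[of s w] e by auto
  then have wle: "w \<in> heads_le E R F v s (v s)"
    using Cons.prems(1) by (auto simp: safe_heads_def heads_le_def)
  then have "d s \<le> R' s w + d w"
    using assms(1) s Cons.prems(1) unfolding settled_def by blast
  moreover have "d w \<le> (\<Sum>(u, w)\<leftarrow>q. R' u w)"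
    using wle w Cons.prems(3) by (intro Cons.IH) (auto simp: heads_le_def)
  ultimately show ?case by (simp add: e)
qed

text \<open>Membership in \<open>F\<close> propagates backwards from \<open>t\<close>: an open arc
  with head in \<open>F\<close> has its tail in \<open>F\<close>. Being inside \<open>F\<close>,
  each arc is then on \<open>p\<close> or has nonnegative reduced cost.\<close>

lemma guard_walk_in:
  assumes "t \<in> F" "walk s q t" "follows F t nx p"
    and "\<And>u w. (u, w) \<in> set q \<Longrightarrow> w \<in> guard_heads E R F v p u"
  shows "s \<in> F \<and> (\<forall>e\<in>set q. e \<in> set p \<or> v (fst e) \<le> R (fst e) (snd e) + v (snd e))"
  using assms(2,4)
proof (induction q arbitrary: s)
  case Nil
  then show ?case using assms(1) by simp
next
  case (Cons e q)
  have IH: "snd e \<in> F" "\<forall>e\<in>set q. e \<in> set p \<or> v (fst e) \<le> R (fst e) (snd e) + v (snd e)"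
    using Cons.IH[of "snd e"] Cons.prems by auto
  have "snd e \<in> guard_heads E R F v p (fst e)"
    using Cons.prems(2)[of "fst e" "snd e"] by simp
  then have "fst e \<in> F \<and> (e \<in> set p \<or> v (fst e) \<le> R (fst e) (snd e) + v (snd e))"
    using IH(1) subsetD[OF assms(3)[unfolded follows_def], of e] by (auto simp: guard_heads_def)
  then show ?case using IH Cons.prems(1) by auto
qed

lemma sum_telescope:
  fixes v :: "'a \<Rightarrow> real"
  assumes "walk s q x"
  shows "(\<Sum>(u, w)\<leftarrow>q. R u w) = (\<Sum>(u, w)\<leftarrow>q. R u w - v u + v w) + v s - v x"
  using assms by (induction q arbitrary: s) (auto simp: split_beta)

text \<open>In terms of the reduced costs \<open>R u w - v u + v w\<close>, arcs of \<open>p\<close> are nonpositive and all other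
  arcs available on the way to \<open>t\<close> are nonnegative. A path uses every arc at most once, so it cannot
  gain more than \<open>p\<close>.\<close>

lemma settled_guard_cost:
  assumes st: "settled E M R R' t F v d nx" and pos: "\<And>u w. u \<in> F \<Longrightarrow> w \<in> E u \<Longrightarrow> 0 < R u w"
    and p: "follows F t nx p" "walk s p t"
    and q: "walk s q t" "distinct q" "\<And>u w. (u, w) \<in> set q \<Longrightarrow> w \<in> guard_heads E R F v p u"
  shows "(\<Sum>(u, w)\<leftarrow>p. R u w) \<le> (\<Sum>(u, w)\<leftarrow>q. R u w)"
proof -
  let ?r = "\<lambda>(u, w). R u w - v u + v w"
  have tF: "t \<in> F" using st by (simp add: settled_def)
  have "distinct (map fst p @ [t])" by (rule follows_distinct[OF st pos p])
  then have dp: "distinct p" by (auto simp: distinct_map)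
  have neg: "?r e \<le> 0" if e: "e \<in> set p" for e
  proof -
    obtain u where "e = (u, nx u)" "u \<in> F - {t}" using subsetD[OF p(1)[unfolded follows_def] e] by auto
    then show ?thesis using settled_nx(4)[OF st _ pos, of u] by auto
  qed
  have nonneg: "0 \<le> ?r e" if "e \<in> set q - set p" for e
    using guard_walk_in[OF tF q(1) p(1) q(3)] that by (auto simp: split_beta)
  have "sum ?r (set p) \<le> sum ?r (set p \<inter> set q)"
    using neg by (subst sum.Int_Diff[of _ _ "set q"]) (auto intro!: sum_nonpos)
  also have "\<dots> \<le> sum ?r (set q)"
    using nonneg by (subst (2) sum.Int_Diff[of _ _ "set p"]) (auto intro!: sum_nonneg simp: Int_commute)
  finally have "(\<Sum>e\<leftarrow>p. ?r e) \<le> (\<Sum>e\<leftarrow>q. ?r e)"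
    using dp q(2) by (simp add: sum_list_distinct_conv_sum_set)
  then show ?thesis
    using sum_telescope[OF p(2), of R v] sum_telescope[OF q(1), of R v] by simp
qed

section \<open>Equilibria from certificates\<close>

lemma cas_with_proj: "pre_digraph.cas (with_proj G) u p w \<longleftrightarrow> walk u p w"
  by (induction p arbitrary: u) (auto simp: pre_digraph.cas.simps)

lemma awalk_verts_with_proj:
  "walk u p w \<Longrightarrow> pre_digraph.awalk_verts (with_proj G) u p = map fst p @ [w]"
  by (induction p arbitrary: u) (auto simp: pre_digraph.awalk_verts.simps)

definition play_arcs :: "'v sp_game \<Rightarrow> 'v strategy \<Rightarrow> 'v strategy \<Rightarrow> ('v \<times> 'v) set" where
  "play_arcs \<Gamma> \<sigma>1 \<sigma>2 = (\<Union>u\<in>choice_verts \<Gamma>. \<sigma>2 u - \<sigma>1 u)"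

lemma st_paths_iff:
  assumes "sp_interdiction_game \<Gamma>"
  shows "p \<in> st_paths \<Gamma> \<sigma>1 \<sigma>2 \<longleftrightarrow>
    walk (source \<Gamma>) p (target \<Gamma>) \<and> set p \<subseteq> play_arcs \<Gamma> \<sigma>1 \<sigma>2 \<and> distinct (map fst p @ [target \<Gamma>])"
proof (cases "walk (source \<Gamma>) p (target \<Gamma>)")
  case True
  have "source \<Gamma> \<in> pverts (graph \<Gamma>)" using assms by (simp add: sp_interdiction_game_def)
  then show ?thesis
    unfolding st_paths_def pre_digraph.apath_def pre_digraph.awalk_def cas_with_proj mem_Collect_eq
      awalk_verts_with_proj[OF True]
    by (auto simp: play_graph_def play_arcs_def True)
next
  case False
  then show ?thesis
    by (simp add: st_paths_def pre_digraph.apath_def pre_digraph.awalk_def cas_with_proj)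
qed

section \<open>Deviations and criteria for equilibrium\<close>

context
  fixes \<Gamma> :: "'v sp_game"
  assumes game: "sp_interdiction_game \<Gamma>"
begin

lemma player_cost_le:
  assumes "p \<in> common_shortest \<Gamma> \<sigma>1 \<sigma>2" "r = cost1 \<Gamma> \<or> r = cost2 \<Gamma>"
  shows "player_cost \<Gamma> r \<sigma>1 \<sigma>2 = ereal (path_cost r p)"
proof -
  let ?q = "SOME q. q \<in> common_shortest \<Gamma> \<sigma>1 \<sigma>2"
  have "?q \<in> common_shortest \<Gamma> \<sigma>1 \<sigma>2" using assms(1) by (rule someI)
  then have "path_cost r ?q = path_cost r p"
    using assms by (auto simp: common_shortest_def shortest_st_paths_def intro: antisym)
  then show ?thesis using assms(1) by (auto simp: player_cost_def)
qed

text \<open>A finite cost is the cost of some path of the graph, and an infinite cost exceeds every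
  bound; so it does not matter whether a common shortest path exists.\<close>

lemma player_cost_ge:
  assumes "\<And>q. q \<in> st_paths \<Gamma> \<sigma>1 \<sigma>2 \<Longrightarrow> c \<le> path_cost r q" "r = cost1 \<Gamma> \<or> r = cost2 \<Gamma>"
  shows "ereal c \<le> player_cost \<Gamma> r \<sigma>1 \<sigma>2"
proof (cases "common_shortest \<Gamma> \<sigma>1 \<sigma>2 = {}")
  case True
  then show ?thesis by (simp add: player_cost_def)
next
  case False
  then obtain q where q: "q \<in> common_shortest \<Gamma> \<sigma>1 \<sigma>2" by auto
  then have "c \<le> path_cost r q"
    by (intro assms(1)) (auto simp: common_shortest_def shortest_st_paths_def)
  then show ?thesis using player_cost_le[OF q assms(2)] by simp
qed

lemma strategy2_sub: "\<sigma>2 \<in> strategies2 \<Gamma> \<Longrightarrow> u \<in> choice_verts \<Gamma> \<Longrightarrow> \<sigma>2 u \<subseteq> out_arcs (graph \<Gamma>) u"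
  by (fastforce simp: strategies2_def dependent_def)

text \<open>Blocking nothing and offering every arc give the largest graphs that a deviation of
  player 1 or of player 2 can produce.\<close>

lemma st_paths_responses:
  assumes "\<sigma>2 \<in> strategies2 \<Gamma>"
  shows "st_paths \<Gamma> \<sigma>1 \<sigma>2 \<subseteq> st_paths \<Gamma> (\<lambda>_. {}) \<sigma>2" "st_paths \<Gamma> \<sigma>1 \<sigma>2 \<subseteq> st_paths \<Gamma> \<sigma>1 (out_arcs (graph \<Gamma>))"
  using strategy2_sub[OF assms] by (fastforce simp: st_paths_iff[OF game] play_arcs_def)+

text \<open>Each inequality involves a single cost function, so common shortest paths no longer have
  to be considered: the graph of the situation lies in both larger graphs, which makes
  \<open>p\<close> itself a common shortest path, and the graph of a deviation lies in one of
  them.\<close>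

lemma nash_equilibrium_path:
  assumes s1: "\<sigma>1 \<in> strategies1 \<Gamma>" and s2: "\<sigma>2 \<in> strategies2 \<Gamma>" and p: "p \<in> st_paths \<Gamma> \<sigma>1 \<sigma>2"
    and le1: "\<And>q. q \<in> st_paths \<Gamma> (\<lambda>_. {}) \<sigma>2 \<Longrightarrow> path_cost (cost1 \<Gamma>) p \<le> path_cost (cost1 \<Gamma>) q"
    and le2: "\<And>q. q \<in> st_paths \<Gamma> \<sigma>1 (out_arcs (graph \<Gamma>)) \<Longrightarrow> path_cost (cost2 \<Gamma>) p \<le> path_cost (cost2 \<Gamma>) q"
  shows "nash_equilibrium \<Gamma> \<sigma>1 \<sigma>2"
proof -
  have "p \<in> common_shortest \<Gamma> \<sigma>1 \<sigma>2"
    using p le1 le2 st_paths_responses[OF s2, of \<sigma>1]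
    by (auto simp: common_shortest_def shortest_st_paths_def)
  note cost = player_cost_le[OF this]
  show ?thesis
    unfolding nash_equilibrium_def cost[OF disjI1[OF refl]] cost[OF disjI2[OF refl]] not_less
  proof (intro conjI ballI)
    show "ereal (path_cost (cost1 \<Gamma>) p) \<le> player_cost \<Gamma> (cost1 \<Gamma>) \<tau> \<sigma>2" for \<tau>
      using le1 st_paths_responses(1)[OF s2] by (intro player_cost_ge) auto
    show "ereal (path_cost (cost2 \<Gamma>) p) \<le> player_cost \<Gamma> (cost2 \<Gamma>) \<sigma>1 \<tau>" if "\<tau> \<in> strategies2 \<Gamma>" for \<tau>
      using le2 st_paths_responses(2)[OF that] by (intro player_cost_ge) auto
  qed (rule s1 s2)+
qed

text \<open>Each player alone separates the target from the source, so a unilateral deviation leaves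
  the cost infinite.\<close>

lemma nash_equilibrium_no_path:
  assumes s1: "\<sigma>1 \<in> strategies1 \<Gamma>" and s2: "\<sigma>2 \<in> strategies2 \<Gamma>"
    and "st_paths \<Gamma> (\<lambda>_. {}) \<sigma>2 = {}" "st_paths \<Gamma> \<sigma>1 (out_arcs (graph \<Gamma>)) = {}"
  shows "nash_equilibrium \<Gamma> \<sigma>1 \<sigma>2"
proof -
  have inf: "player_cost \<Gamma> r \<tau>1 \<tau>2 = \<infinity>" if "st_paths \<Gamma> \<tau>1 \<tau>2 = {}" for r \<tau>1 \<tau>2
    using that by (auto simp: player_cost_def common_shortest_def shortest_st_paths_def)
  have "st_paths \<Gamma> \<tau>1 \<sigma>2 = {}" for \<tau>1
    using assms st_paths_responses(1)[OF s2] by blast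
  moreover have "st_paths \<Gamma> \<sigma>1 \<tau>2 = {}" if "\<tau>2 \<in> strategies2 \<Gamma>" for \<tau>2
    using assms st_paths_responses(2)[OF that] by blast
  ultimately show ?thesis
    using s1 s2 by (auto simp: nash_equilibrium_def inf)
qed

section \<open>The dual families of winning sets\<close>

definition succs :: "'v \<Rightarrow> 'v set" where
  "succs u = {w. (u, w) \<in> parcs (graph \<Gamma>)}"

text \<open>\<open>winning True u\<close> holds for the head sets of dependent sets, from which player 2 can ensure an arc,
  and \<open>winning False u\<close> for those of complements of independent sets, from which player 1 can.\<close>

definition winning :: "bool \<Rightarrow> 'v \<Rightarrow> 'v set \<Rightarrow> bool" where
  "winning b u X \<longleftrightarrow>
     (if b then Pair u ` (X \<inter> succs u) \<notin> indep \<Gamma> u else Pair u ` (succs u - X) \<in> indep \<Gamma> u)"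

lemma out_arcs_eq: "out_arcs (graph \<Gamma>) u = Pair u ` succs u"
  by (auto simp: out_arcs_def succs_def)

lemma indep_subset: "u \<in> choice_verts \<Gamma> \<Longrightarrow> Y \<in> indep \<Gamma> u \<Longrightarrow> X \<subseteq> Y \<Longrightarrow> X \<in> indep \<Gamma> u"
  using game by (auto simp: sp_interdiction_game_def independence_system_def)

lemma indep_empty:
  assumes "u \<in> choice_verts \<Gamma>"
  shows "{} \<in> indep \<Gamma> u"
proof -
  have "indep \<Gamma> u \<noteq> {}"
    using game assms by (simp add: sp_interdiction_game_def independence_system_def)
  then show ?thesis using indep_subset[OF assms] by blast
qed

text \<open>Closure under subsets makes being contained in a member the same as being a
  member.\<close>

lemma dependent_iff:
  assumes "u \<in> choice_verts \<Gamma>" "X \<subseteq> succs u"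
  shows "Pair u ` X \<in> dependent \<Gamma> u \<longleftrightarrow> winning True u X"
proof -
  have "(\<exists>Y\<in>indep \<Gamma> u. Pair u ` X \<subseteq> Y) \<longleftrightarrow> Pair u ` X \<in> indep \<Gamma> u"
    using indep_subset[OF assms(1)] by blast
  moreover have "Pair u ` X \<subseteq> out_arcs (graph \<Gamma>) u" "X \<inter> succs u = X"
    using assms(2) by (auto simp: out_arcs_eq)
  ultimately show ?thesis
    by (simp only: dependent_def winning_def mem_Collect_eq if_True simp_thms)
qed

lemma winning_mono: "u \<in> choice_verts \<Gamma> \<Longrightarrow> winning b u X \<Longrightarrow> X \<subseteq> Y \<Longrightarrow> winning b u Y"
proof -
  assume u: "u \<in> choice_verts \<Gamma>" and "winning b u X" "X \<subseteq> Y"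
  moreover from \<open>X \<subseteq> Y\<close> have "Pair u ` (X \<inter> succs u) \<subseteq> Pair u ` (Y \<inter> succs u)"
    "Pair u ` (succs u - Y) \<subseteq> Pair u ` (succs u - X)" by auto
  ultimately show "winning b u Y"
    unfolding winning_def using indep_subset[OF u] by (cases b) (simp_all, blast+)
qed

lemma winning_empty: "u \<in> choice_verts \<Gamma> \<Longrightarrow> \<not> winning b u {}"
  using game indep_empty by (simp add: winning_def sp_interdiction_game_def out_arcs_eq)

text \<open>The two families are blockers of each other. A bound that one player cannot enforce
  thereby becomes a set that the opponent can play.\<close>

lemma winning_dual: "X \<subseteq> succs u \<Longrightarrow> winning (\<not> b) u (succs u - X) \<longleftrightarrow> \<not> winning b u X"
  by (simp add: winning_def Int_absorb2 double_diff)

lemma succs_sub: "u \<in> pverts (graph \<Gamma>) \<Longrightarrow> succs u \<subseteq> pverts (graph \<Gamma>)"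
  using game pair_wf_digraph.in_arcsD2[of "graph \<Gamma>"]
  by (auto simp: succs_def sp_interdiction_game_def pair_fin_digraph_def dest: pair_wf_digraph.in_arcsD2)

definition own_cost :: "bool \<Rightarrow> 'v \<Rightarrow> 'v \<Rightarrow> real" where
  "own_cost b u w = (if b then cost2 \<Gamma> (u, w) else cost1 \<Gamma> (u, w))"

text \<open>Certificates are relative to rescaled costs, which in the algorithm are integers.\<close>

definition rescaled :: "(bool \<Rightarrow> 'v \<Rightarrow> 'v \<Rightarrow> real) \<Rightarrow> bool" where
  "rescaled R \<longleftrightarrow> (\<forall>b. \<exists>c>0. \<forall>u. \<forall>w\<in>succs u. R b u w = c * own_cost b u w)"

lemma arena:
  assumes "rescaled R"
  shows "arena (pverts (graph \<Gamma>)) succs (winning b) (R b) (target \<Gamma>)"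
proof
  have "pair_fin_digraph (graph \<Gamma>)" using game unfolding sp_interdiction_game_def by (rule conjunct1)
  then show "finite (pverts (graph \<Gamma>))" by (rule pair_fin_digraph.pair_finite_verts)
  show "target \<Gamma> \<in> pverts (graph \<Gamma>)" using game unfolding sp_interdiction_game_def by simp
  show "0 < R b u w" if "w \<in> succs u" for u w
  proof -
    obtain c where "0 < c" "\<forall>u. \<forall>w\<in>succs u. R b u w = c * own_cost b u w"
      using assms[unfolded rescaled_def, rule_format, of b] by blast
    then have "0 < c" "R b u w = c * own_cost b u w" using that by simp_all
    moreover have "0 < own_cost b u w"
      using that game by (simp add: own_cost_def succs_def sp_interdiction_game_def)
    ultimately show ?thesis by simp
  qed
  show "winning b u Y" if "u \<in> pverts (graph \<Gamma>) - {target \<Gamma>}" "winning b u X" "X \<subseteq> Y" for u X Y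
    using that winning_mono unfolding choice_verts_def by blast
qed (use succs_sub winning_empty in \<open>simp_all add: choice_verts_def\<close>)

text \<open>\<open>b\<close> tells whose value is computed, player 2's for \<open>True\<close> and
  player 1's for \<open>False\<close>; the path is selected by the other player's costs.
  \<open>A\<close> and \<open>B\<close> are constrained at choice vertices only, as strategies
  are.\<close>

definition certified where
  "certified R b F v p A B \<longleftrightarrow>
    (\<exists>d nx. certificate (pverts (graph \<Gamma>)) succs (winning b) (R b) (R (\<not> b)) (target \<Gamma>) F v d nx \<and>
       follows F (target \<Gamma>) nx p \<and>
       (if source \<Gamma> \<in> F then walk (source \<Gamma>) p (target \<Gamma>) else p = []) \<and>
       (\<forall>u\<in>choice_verts \<Gamma>. A u = safe_heads succs (R b) F v u \<and> B u = guard_heads succs (R b) F v p u))"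

lemma certified_exists:
  assumes "rescaled R"
  shows "\<exists>F v p A B. certified R b F v p A B"
proof -
  interpret arena "pverts (graph \<Gamma>)" succs "winning b" "R b" "R (\<not> b)" "target \<Gamma>"
    by (rule arena[OF assms])
  obtain F v d nx where c: "certificate (pverts (graph \<Gamma>)) succs (winning b) (R b) (R (\<not> b)) (target \<Gamma>) F v d nx"
    using certificate_exists by blast
  then have st: "settled succs (winning b) (R b) (R (\<not> b)) (target \<Gamma>) F v d nx"
    and F: "F \<subseteq> pverts (graph \<Gamma>)" by (auto simp: certificate_def)
  have "\<exists>p. follows F (target \<Gamma>) nx p \<and> (if source \<Gamma> \<in> F then walk (source \<Gamma>) p (target \<Gamma>) else p = [])"
  proof (cases "source \<Gamma> \<in> F")
    case True
    then show ?thesis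
      using follows_exists[OF st _ True] R_pos F finite_subset[OF F finite_V] by auto
  next
    case False
    then show ?thesis by (auto simp: follows_def)
  qed
  then show ?thesis using c unfolding certified_def by blast
qed

context
  fixes R b F v p A B
  assumes resc: "rescaled R" and cert: "certified R b F v p A B"
begin

text \<open>Inside \<open>F\<close>, \<open>A u\<close> wins because \<open>v u\<close> is a winning
  threshold. The complement of \<open>B u\<close> lies among the arcs undercutting
  \<open>v u\<close>, or among the arcs into \<open>F\<close> if \<open>u\<close> is outside
  \<open>F\<close>. Neither set is winning, so \<open>B u\<close> wins for the opponent by duality;
  leaving the arcs of \<open>p\<close> open makes the complement smaller still.\<close>

lemma certified_winning:
  assumes u: "u \<in> choice_verts \<Gamma>"
  shows "A u \<subseteq> succs u" "B u \<subseteq> succs u" "winning b u (A u)" "winning (\<not> b) u (B u)"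
proof -
  interpret arena "pverts (graph \<Gamma>)" succs "winning b" "R b" "R (\<not> b)" "target \<Gamma>"
    by (rule arena[OF resc])
  obtain d nx where c: "certificate (pverts (graph \<Gamma>)) succs (winning b) (R b) (R (\<not> b)) (target \<Gamma>) F v d nx"
    and AB: "A u = safe_heads succs (R b) F v u" "B u = guard_heads succs (R b) F v p u"
    using cert u unfolding certified_def by blast
  show sub: "A u \<subseteq> succs u" "B u \<subseteq> succs u"
    by (auto simp: AB safe_heads_def guard_heads_def)
  \<comment> \<open>The empty set does not win for the opponent, so by duality the set of all heads
    wins; it is what \<open>safe_heads\<close> offers outside \<open>F\<close>.\<close>
  have full: "winning b u (succs u)"
    using winning_empty[OF u, of "\<not> b"] winning_dual[of "{}" u b] winning_dual[of "succs u" u "b"]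
      winning_dual[of "{}" u "\<not> b"] by auto
  show "winning b u (A u)"
  proof (cases "u \<in> F")
    case True
    then have "winning b u (heads_le succs (R b) F v u (v u))"
      using c u by (auto simp: certificate_def settled_def choice_verts_def)
    moreover have "heads_le succs (R b) F v u (v u) = A u"
      using True by (auto simp: AB safe_heads_def heads_le_def)
    ultimately show ?thesis by simp
  next
    case False
    then show ?thesis using full by (simp add: AB safe_heads_def)
  qed
  have "\<not> winning b u (succs u - B u)"
  proof (cases "u \<in> F")
    case True
    then have "\<not> winning b u (heads_less succs (R b) F v u (v u))"
      using c u by (auto simp: certificate_def settled_def choice_verts_def)
    moreover have "succs u - B u \<subseteq> heads_less succs (R b) F v u (v u)"
      using True by (auto simp: AB guard_heads_def heads_less_def)
    ultimately show ?thesis using winning_mono[OF u] by blast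
  next
    case False
    then have "\<not> winning b u (succs u \<inter> F)"
      using c u by (auto simp: certificate_def choice_verts_def)
    moreover have "succs u - B u \<subseteq> succs u \<inter> F"
      by (auto simp: AB guard_heads_def)
    ultimately show ?thesis using winning_mono[OF u] by blast
  qed
  then show "winning (\<not> b) u (B u)"
    using winning_dual[of "succs u - B u" u b] sub by (simp add: double_diff)
qed

lemma certified_no_path:
  assumes "source \<Gamma> \<notin> F" "walk (source \<Gamma>) q (target \<Gamma>)"
    and "\<And>u w. (u, w) \<in> set q \<Longrightarrow> u \<in> choice_verts \<Gamma> \<and> w \<in> B u"
  shows False
proof -
  obtain d nx where c: "settled succs (winning b) (R b) (R (\<not> b)) (target \<Gamma>) F v d nx"
    and f: "follows F (target \<Gamma>) nx p"
    and B: "\<forall>u\<in>choice_verts \<Gamma>. B u = guard_heads succs (R b) F v p u"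
    using cert unfolding certified_def certificate_def by blast
  have "target \<Gamma> \<in> F" using c by (simp add: settled_def)
  from guard_walk_in[OF this assms(2) f, of succs "R b" v] show False
    using assms(1,3) B by blast
qed

text \<open>The factor is fixed before the walk is given, so rescaling changes no comparison between
  walks.\<close>

lemma rescaled_path_cost:
  obtains c where "0 < c"
    "\<And>q. (\<And>u w. (u, w) \<in> set q \<Longrightarrow> w \<in> succs u) \<Longrightarrow>
       (\<Sum>(u, w)\<leftarrow>q. R b' u w) = c * path_cost (if b' then cost2 \<Gamma> else cost1 \<Gamma>) q"
proof -
  obtain c where c: "0 < c" "\<forall>u. \<forall>w\<in>succs u. R b' u w = c * own_cost b' u w"
    using resc[unfolded rescaled_def, rule_format, of b'] by blast
  have "(\<Sum>(u, w)\<leftarrow>q. R b' u w) = c * path_cost (if b' then cost2 \<Gamma> else cost1 \<Gamma>) q"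
    if "\<And>u w. (u, w) \<in> set q \<Longrightarrow> w \<in> succs u" for q
    using that
  proof (induction q)
    case (Cons e q)
    have "R b' (fst e) (snd e) = c * own_cost b' (fst e) (snd e)"
      using c(2) Cons.prems[of "fst e" "snd e"] by simp
    with Cons show ?case by (simp add: path_cost_def own_cost_def split_beta algebra_simps)
  qed (simp add: path_cost_def)
  with c(1) that show ?thesis by blast
qed

text \<open>The two comparisons rest on two potentials: the distance \<open>d\<close> for walks
  through \<open>A\<close> and the value \<open>v\<close> for walks through \<open>B\<close>. In the
  latter the arcs of \<open>p\<close> may have negative reduced cost, and a walk must not collect it
  twice; hence \<open>q\<close> is distinct there.\<close>

lemma certified_path:
  assumes s: "source \<Gamma> \<in> F"
  shows "walk (source \<Gamma>) p (target \<Gamma>)" "distinct (map fst p @ [target \<Gamma>])"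
    "(u, w) \<in> set p \<Longrightarrow> u \<in> choice_verts \<Gamma> \<and> w \<in> A u \<inter> B u"
    "\<lbrakk>walk (source \<Gamma>) q (target \<Gamma>); \<And>u w. (u, w) \<in> set q \<Longrightarrow> u \<in> choice_verts \<Gamma> \<and> w \<in> A u\<rbrakk> \<Longrightarrow>
       path_cost (if b then cost1 \<Gamma> else cost2 \<Gamma>) p \<le> path_cost (if b then cost1 \<Gamma> else cost2 \<Gamma>) q"
    "\<lbrakk>walk (source \<Gamma>) q (target \<Gamma>); distinct q;
      \<And>u w. (u, w) \<in> set q \<Longrightarrow> u \<in> choice_verts \<Gamma> \<and> w \<in> B u\<rbrakk> \<Longrightarrow>
       path_cost (if b then cost2 \<Gamma> else cost1 \<Gamma>) p \<le> path_cost (if b then cost2 \<Gamma> else cost1 \<Gamma>) q"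
proof -
  interpret arena "pverts (graph \<Gamma>)" succs "winning b" "R b" "R (\<not> b)" "target \<Gamma>"
    by (rule arena[OF resc])
  obtain d nx where c: "settled succs (winning b) (R b) (R (\<not> b)) (target \<Gamma>) F v d nx"
    and FV: "F \<subseteq> pverts (graph \<Gamma>)"
    and f: "follows F (target \<Gamma>) nx p"
    and w: "walk (source \<Gamma>) p (target \<Gamma>)"
    and AB: "\<forall>u\<in>choice_verts \<Gamma>. A u = safe_heads succs (R b) F v u"
      "\<forall>u\<in>choice_verts \<Gamma>. B u = guard_heads succs (R b) F v p u"
    using cert s unfolding certified_def certificate_def by auto
  have pos: "0 < R b u w" if "u \<in> F" "w \<in> succs u" for u w using R_pos that FV by blast
  show "walk (source \<Gamma>) p (target \<Gamma>)" by (rule w)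
  show "distinct (map fst p @ [target \<Gamma>])" by (rule follows_distinct[OF c pos f w])
  show p_in: "u \<in> choice_verts \<Gamma> \<and> w \<in> A u \<inter> B u" if "(u, w) \<in> set p" for u w
  proof -
    have uF: "u \<in> F - {target \<Gamma>}" and w: "w = nx u" using that f by (auto simp: follows_def)
    then have cv: "u \<in> choice_verts \<Gamma>" using FV by (auto simp: choice_verts_def)
    with settled_nx[OF c uF] pos uF w that AB show ?thesis
      by (auto simp: safe_heads_def guard_heads_def)
  qed
  have p_succs: "w \<in> succs u" if "(u, w) \<in> set p" for u w
    using p_in[OF that] certified_winning(1)[of u] by auto
  show "path_cost (if b then cost1 \<Gamma> else cost2 \<Gamma>) p \<le> path_cost (if b then cost1 \<Gamma> else cost2 \<Gamma>) q"
    if q: "walk (source \<Gamma>) q (target \<Gamma>)" "\<And>u w. (u, w) \<in> set q \<Longrightarrow> u \<in> choice_verts \<Gamma> \<and> w \<in> A u"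
  proof -
    obtain k where k: "0 < k" "\<And>q. (\<And>u w. (u, w) \<in> set q \<Longrightarrow> w \<in> succs u) \<Longrightarrow>
       (\<Sum>(u, w)\<leftarrow>q. R (\<not> b) u w) = k * path_cost (if \<not> b then cost2 \<Gamma> else cost1 \<Gamma>) q"
      using rescaled_path_cost[where b' = "\<not> b"] by blast
    have "d (source \<Gamma>) \<le> (\<Sum>(u, w)\<leftarrow>q. R (\<not> b) u w)"
      using q AB(1) by (intro settled_safe_cost[OF c s q(1)]) (auto simp: choice_verts_def)
    then have "(\<Sum>(u, w)\<leftarrow>p. R (\<not> b) u w) \<le> (\<Sum>(u, w)\<leftarrow>q. R (\<not> b) u w)"
      using settled_follows_cost[OF c f w] by simp
    moreover have "\<And>u w. (u, w) \<in> set q \<Longrightarrow> w \<in> succs u" using q(2) certified_winning(1) by blast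
    ultimately show ?thesis using k p_succs by (simp split: if_splits)
  qed
  show "path_cost (if b then cost2 \<Gamma> else cost1 \<Gamma>) p \<le> path_cost (if b then cost2 \<Gamma> else cost1 \<Gamma>) q"
    if q: "walk (source \<Gamma>) q (target \<Gamma>)" "distinct q"
      "\<And>u w. (u, w) \<in> set q \<Longrightarrow> u \<in> choice_verts \<Gamma> \<and> w \<in> B u"
  proof -
    obtain k where k: "0 < k" "\<And>q. (\<And>u w. (u, w) \<in> set q \<Longrightarrow> w \<in> succs u) \<Longrightarrow>
       (\<Sum>(u, w)\<leftarrow>q. R b u w) = k * path_cost (if b then cost2 \<Gamma> else cost1 \<Gamma>) q"
      using rescaled_path_cost[where b' = b] by blast
    have "w \<in> guard_heads succs (R b) F v p u" if "(u, w) \<in> set q" for u w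
      using q(3)[OF that] bspec[OF AB(2), of u] by blast
    then have "(\<Sum>(u, w)\<leftarrow>p. R b u w) \<le> (\<Sum>(u, w)\<leftarrow>q. R b u w)"
      by (intro settled_guard_cost[OF c pos f w q(1,2)])
    moreover have "\<And>u w. (u, w) \<in> set q \<Longrightarrow> w \<in> succs u" using q(3) certified_winning(2) by blast
    ultimately show ?thesis using k p_succs by (simp split: if_splits)
  qed
qed

end

section \<open>Assembling an equilibrium from two certificates\<close>

lemma strategies1_winning:
  assumes "\<And>u. u \<in> choice_verts \<Gamma> \<Longrightarrow> winning False u (X u)"
    and "\<And>u. u \<in> choice_verts \<Gamma> \<Longrightarrow> \<sigma>1 u = Pair u ` (succs u - X u)"
  shows "\<sigma>1 \<in> strategies1 \<Gamma>"
  using assms by (simp add: strategies1_def winning_def)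

lemma strategies2_winning:
  assumes "\<And>u. u \<in> choice_verts \<Gamma> \<Longrightarrow> X u \<subseteq> succs u" "\<And>u. u \<in> choice_verts \<Gamma> \<Longrightarrow> winning True u (X u)"
    and "\<And>u. u \<in> choice_verts \<Gamma> \<Longrightarrow> \<sigma>2 u = Pair u ` X u"
  shows "\<sigma>2 \<in> strategies2 \<Gamma>"
  using assms dependent_iff by (simp add: strategies2_def)

lemma play_arcs_safe:
  assumes "\<And>u. u \<in> choice_verts \<Gamma> \<Longrightarrow> \<sigma>2 u = Pair u ` Y u"
  shows "(u, w) \<in> play_arcs \<Gamma> (\<lambda>_. {}) \<sigma>2 \<longleftrightarrow> u \<in> choice_verts \<Gamma> \<and> w \<in> Y u"
  using assms by (fastforce simp: play_arcs_def)

lemma play_arcs_guard: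
  assumes "\<And>u. u \<in> choice_verts \<Gamma> \<Longrightarrow> \<sigma>1 u = Pair u ` (succs u - X u)"
    and "\<And>u. u \<in> choice_verts \<Gamma> \<Longrightarrow> X u \<subseteq> succs u"
  shows "(u, w) \<in> play_arcs \<Gamma> \<sigma>1 (out_arcs (graph \<Gamma>)) \<longleftrightarrow> u \<in> choice_verts \<Gamma> \<and> w \<in> X u"
  using assms by (fastforce simp: play_arcs_def out_arcs_eq)

lemma play_arcs_both:
  assumes "\<And>u. u \<in> choice_verts \<Gamma> \<Longrightarrow> \<sigma>1 u = Pair u ` (succs u - X u)"
    and "\<And>u. u \<in> choice_verts \<Gamma> \<Longrightarrow> \<sigma>2 u = Pair u ` Y u"
    and "\<And>u. u \<in> choice_verts \<Gamma> \<Longrightarrow> Y u \<subseteq> succs u"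
  shows "(u, w) \<in> play_arcs \<Gamma> \<sigma>1 \<sigma>2 \<longleftrightarrow> u \<in> choice_verts \<Gamma> \<and> w \<in> X u \<inter> Y u"
  using assms by (fastforce simp: play_arcs_def)

text \<open>The second certificate is demanded only if the first one leaves out the source, so the
  algorithm can stop early. If both leave it out, each player takes the guards of the certificate
  that computes the other player's value.\<close>

lemma nash_equilibrium_certified:
  assumes R: "rescaled R"
    and t: "certified R True F v p A B"
    and f: "source \<Gamma> \<notin> F \<Longrightarrow> certified R False F' v' p' A' B'"
    and \<sigma>1: "\<And>u. u \<in> choice_verts \<Gamma> \<Longrightarrow>
      \<sigma>1 u = Pair u ` (succs u - (if source \<Gamma> \<in> F then B u else if source \<Gamma> \<in> F' then A' u else B u))"
    and \<sigma>2: "\<And>u. u \<in> choice_verts \<Gamma> \<Longrightarrow> \<sigma>2 u = Pair u ` (if source \<Gamma> \<in> F then A u else B' u)"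
  shows "nash_equilibrium \<Gamma> \<sigma>1 \<sigma>2"
proof -
  \<comment> \<open>These are the heads that player 1 leaves open; the blocked ones are their
    complement.\<close>
  let ?X1 = "\<lambda>u. if source \<Gamma> \<in> F then B u else if source \<Gamma> \<in> F' then A' u else B u"
  let ?X2 = "\<lambda>u. if source \<Gamma> \<in> F then A u else B' u"
  note wt = certified_winning[OF R t] and wf = certified_winning[OF R f]
  have X1: "?X1 u \<subseteq> succs u" "winning False u (?X1 u)" if "u \<in> choice_verts \<Gamma>" for u
    using wt[OF that] wf[OF _ that] by auto
  have X2: "?X2 u \<subseteq> succs u" "winning True u (?X2 u)" if "u \<in> choice_verts \<Gamma>" for u
    using wt[OF that] wf[OF _ that] by auto
  have s1: "\<sigma>1 \<in> strategies1 \<Gamma>" by (rule strategies1_winning[OF X1(2) \<sigma>1])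
  have s2: "\<sigma>2 \<in> strategies2 \<Gamma>" by (rule strategies2_winning[OF X2 \<sigma>2])
  note arcs1 = play_arcs_guard[OF \<sigma>1 X1(1)] and arcs2 = play_arcs_safe[OF \<sigma>2]
    and arcs = play_arcs_both[OF \<sigma>1 \<sigma>2 X2(1)]
  have dq: "distinct q" if "distinct (map fst q @ [x])" for q :: "('v \<times> 'v) list" and x
    using that by (simp add: distinct_map)
  consider "source \<Gamma> \<in> F" | "source \<Gamma> \<notin> F" "source \<Gamma> \<in> F'" | "source \<Gamma> \<notin> F" "source \<Gamma> \<notin> F'" by blast
  then show ?thesis
  proof cases
    case 1
    note P = certified_path[OF R t 1, simplified]
    show ?thesis
    proof (rule nash_equilibrium_path[OF s1 s2])
      have "set p \<subseteq> play_arcs \<Gamma> \<sigma>1 \<sigma>2"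
        using P(3) 1 arcs by (auto simp: subset_iff)
      then show "p \<in> st_paths \<Gamma> \<sigma>1 \<sigma>2"
        unfolding st_paths_iff[OF game] using P(1,2) by simp
      show "path_cost (cost1 \<Gamma>) p \<le> path_cost (cost1 \<Gamma>) q" if "q \<in> st_paths \<Gamma> (\<lambda>_. {}) \<sigma>2" for q
        using that 1 arcs2 unfolding st_paths_iff[OF game] by (intro P(4)) auto
      show "path_cost (cost2 \<Gamma>) p \<le> path_cost (cost2 \<Gamma>) q"
        if "q \<in> st_paths \<Gamma> \<sigma>1 (out_arcs (graph \<Gamma>))" for q
        using that 1 arcs1 dq unfolding st_paths_iff[OF game] by (intro P(5)) auto
    qed
  next
    case 2
    note P = certified_path[OF R f[OF 2(1)] 2(2), simplified]
    show ?thesis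
    proof (rule nash_equilibrium_path[OF s1 s2])
      have "set p' \<subseteq> play_arcs \<Gamma> \<sigma>1 \<sigma>2"
        using P(3) 2 arcs by (auto simp: subset_iff)
      then show "p' \<in> st_paths \<Gamma> \<sigma>1 \<sigma>2"
        unfolding st_paths_iff[OF game] using P(1,2) by simp
      show "path_cost (cost1 \<Gamma>) p' \<le> path_cost (cost1 \<Gamma>) q" if "q \<in> st_paths \<Gamma> (\<lambda>_. {}) \<sigma>2" for q
        using that 2 arcs2 dq unfolding st_paths_iff[OF game] by (intro P(5)) auto
      show "path_cost (cost2 \<Gamma>) p' \<le> path_cost (cost2 \<Gamma>) q"
        if "q \<in> st_paths \<Gamma> \<sigma>1 (out_arcs (graph \<Gamma>))" for q
        using that 2 arcs1 unfolding st_paths_iff[OF game] by (intro P(4)) auto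
    qed
  next
    case 3
    show ?thesis
    proof (rule nash_equilibrium_no_path[OF s1 s2])
      show "st_paths \<Gamma> (\<lambda>_. {}) \<sigma>2 = {}"
      proof (intro equals0I)
        fix q assume "q \<in> st_paths \<Gamma> (\<lambda>_. {}) \<sigma>2"
        then show False
          unfolding st_paths_iff[OF game] using 3 arcs2
          by (intro certified_no_path[OF R f[OF 3(1)] 3(2), of q]) auto
      qed
      show "st_paths \<Gamma> \<sigma>1 (out_arcs (graph \<Gamma>)) = {}"
      proof (intro equals0I)
        fix q assume "q \<in> st_paths \<Gamma> \<sigma>1 (out_arcs (graph \<Gamma>))"
        then show False
          unfolding st_paths_iff[OF game] using 3 arcs1
          by (intro certified_no_path[OF R t 3(1), of q]) auto
      qed
    qed
  qed
qed

lemma nash_equilibrium_exists: "\<exists>\<sigma>1 \<sigma>2. nash_equilibrium \<Gamma> \<sigma>1 \<sigma>2"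
proof -
  have R: "rescaled own_cost" unfolding rescaled_def by (metis mult_1 zero_less_one)
  obtain F v p A B where t: "certified own_cost True F v p A B" using certified_exists[OF R] by blast
  obtain F' v' p' A' B' where f: "certified own_cost False F' v' p' A' B'"
    using certified_exists[OF R] by blast
  show ?thesis by (intro exI) (rule nash_equilibrium_certified[OF R t f refl refl])
qed

end

section \<open>Structured programs of bounded running time\<close>

text \<open>All loops are counted, so that the running time is bounded by syntax; the procedure
  needs only nested loops over vertices and pairs of vertices.\<close>

datatype stm =
    Nop
  | Set string expr expr
  | Then stm stm
  | Branch expr stm stm
  | Ask string string expr
  | For string expr stm

abbreviation var :: "string \<Rightarrow> expr" where
  "var x \<equiv> Cell x (Lit 0)"

text \<open>The truncated difference in the loop test is nonzero exactly while the counter is below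
  the bound, and the bound is evaluated again in every round.\<close>

fun compile :: "stm \<Rightarrow> program" where
  "compile Nop = Skip"
| "compile (Set a i e) = Assign a i e"
| "compile (Then c d) = Seq (compile c) (compile d)"
| "compile (Branch e c d) = Cond e (compile c) (compile d)"
| "compile (Ask x a e) = Query x a e"
| "compile (For x e c) =
     Seq (Assign x (Lit 0) (Lit 0))
      (While (Minus e (var x)) (Seq (compile c) (Assign x (Lit 0) (Plus (var x) (Lit 1)))))"

fun writes :: "stm \<Rightarrow> string set" where
  "writes Nop = {}"
| "writes (Set a i e) = {a}"
| "writes (Then c d) = writes c \<union> writes d"
| "writes (Branch e c d) = writes c \<union> writes d"
| "writes (Ask x a e) = {x}"
| "writes (For x e c) = insert x (writes c)"

fun reads :: "expr \<Rightarrow> string set" where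
  "reads (Lit k) = {}"
| "reads (Cell a e) = insert a (reads e)"
| "reads (Plus e f) = reads e \<union> reads f"
| "reads (Minus e f) = reads e \<union> reads f"
| "reads (Times e f) = reads e \<union> reads f"
| "reads (Div e f) = reads e \<union> reads f"

text \<open>Scaled so that \<open>K * weight e\<close> bounds the bit length of the value of
  \<open>e\<close> when every cell is below \<open>2 ^ K\<close> and \<open>K\<close> is
  positive.\<close>

fun weight :: "expr \<Rightarrow> nat" where
  "weight (Lit k) = bits k"
| "weight (Cell a e) = weight e + 1"
| "weight (Plus e f) = weight e + weight f + 1"
| "weight (Minus e f) = weight e + weight f + 1"
| "weight (Times e f) = weight e + weight f + 1"
| "weight (Div e f) = weight e + weight f + 1"

text \<open>A loop body must change neither the counter nor anything read by the bound, which is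
  evaluated again in every round. The slack 5 covers the loop test, of weight
  \<open>weight e + 3\<close>, and the increment, of weight 4.\<close>

fun well_formed :: "nat \<Rightarrow> stm \<Rightarrow> bool" where
  "well_formed Z Nop = True"
| "well_formed Z (Set a i e) = (weight i \<le> Z \<and> weight e \<le> Z)"
| "well_formed Z (Then c d) = (well_formed Z c \<and> well_formed Z d)"
| "well_formed Z (Branch e c d) = (weight e \<le> Z \<and> well_formed Z c \<and> well_formed Z d)"
| "well_formed Z (Ask x a e) = (weight e \<le> Z)"
| "well_formed Z (For x e c) =
     (weight e + 5 \<le> Z \<and> well_formed Z c \<and> x \<notin> writes c \<and> x \<notin> reads e \<and> writes c \<inter> reads e = {})"

text \<open>A loop pays once for its initialization and once for the failing test, and besides the
  body for a test and an increment in each of at most \<open>N\<close> rounds.\<close>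

fun steps :: "nat \<Rightarrow> stm \<Rightarrow> nat" where
  "steps N Nop = 1"
| "steps N (Set a i e) = 1"
| "steps N (Then c d) = steps N c + steps N d"
| "steps N (Branch e c d) = 1 + steps N c + steps N d"
| "steps N (Ask x a e) = 1"
| "steps N (For x e c) = 2 + N * (steps N c + 2)"

definition agree :: "string set \<Rightarrow> memory \<Rightarrow> memory \<Rightarrow> bool" where
  "agree X m m' \<longleftrightarrow> (\<forall>a. a \<notin> X \<longrightarrow> m' a = m a)"

lemma agree_refl: "agree X m m"
  by (simp add: agree_def)

lemma agree_trans: "agree X m m' \<Longrightarrow> agree Y m' m'' \<Longrightarrow> X \<union> Y \<subseteq> Z \<Longrightarrow> agree Z m m''"
  unfolding agree_def by (metis UnCI subsetD)

lemma agree_mono: "agree X m m' \<Longrightarrow> X \<subseteq> Y \<Longrightarrow> agree Y m m'"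
  by (auto simp: agree_def)

lemma val_agree: "agree X m m' \<Longrightarrow> X \<inter> reads e = {} \<Longrightarrow> val e m' = val e m"
  by (induction e) (auto simp: agree_def Int_Un_distrib)

section \<open>Bit lengths and evaluation times\<close>

lemma bits_le_iff: "1 \<le> b \<Longrightarrow> bits k \<le> b \<longleftrightarrow> k < 2 ^ b"
proof -
  assume b: "1 \<le> b"
  have "floorlog 2 k \<le> b \<longleftrightarrow> k < 2 ^ b"
  proof (cases "k = 0")
    case True
    then show ?thesis by (simp add: floorlog_def)
  next
    case False
    then show ?thesis using floorlog_le_iff[of 2 k b] by simp
  qed
  then show ?thesis using b by (simp add: bits_def)
qed

lemma bits_pos: "1 \<le> bits k"
  by (simp add: bits_def)

lemma less_power_bits: "k < 2 ^ bits k"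
  using bits_le_iff[OF bits_pos, of k k] by simp

lemma weight_pos: "1 \<le> weight e"
  by (induction e) (simp_all add: bits_def)

definition bounded :: "nat \<Rightarrow> memory \<Rightarrow> bool" where
  "bounded K m \<longleftrightarrow> (\<forall>a i. m a i < 2 ^ K)"

text \<open>Lengths add under multiplication, and a sum takes at most one further bit; the unit of
  weight of each operation is worth \<open>K\<close> bits and covers it.\<close>

lemma val_bound:
  assumes "bounded K m" "1 \<le> K"
  shows "val e m < 2 ^ (K * weight e)"
proof (induction e)
  case (Lit k)
  have "k < 2 ^ bits k" by (rule less_power_bits)
  also have "\<dots> \<le> 2 ^ (K * bits k)" using assms(2) by (intro power_increasing) auto
  finally show ?case by simp
next
  case (Cell a e)
  have "m a (val e m) < 2 ^ K" using assms(1) by (simp add: bounded_def)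
  also have "\<dots> \<le> 2 ^ (K * (weight e + 1))" by (intro power_increasing) auto
  finally show ?case by simp
next
  case (Plus e f)
  let ?a = "K * weight e" and ?b = "K * weight f"
  have "2 ^ ?a \<le> (2::nat) ^ (?a + ?b)" "2 ^ ?b \<le> (2::nat) ^ (?a + ?b)"
    by (intro power_increasing; simp)+
  with Plus have "val e m + val f m < 2 * 2 ^ (?a + ?b)" by linarith
  also have "\<dots> = 2 ^ (?a + ?b + 1)" by simp
  also have "\<dots> \<le> 2 ^ (K * (weight e + weight f + 1))"
    using assms(2) by (intro power_increasing) (auto simp: algebra_simps)
  finally show ?case by simp
next
  case (Minus e f)
  have "val e m - val f m < 2 ^ (K * weight e)" using Minus(1) by simp
  also have "\<dots> \<le> 2 ^ (K * (weight e + weight f + 1))"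
    by (intro power_increasing) (auto simp: algebra_simps)
  finally show ?case by simp
next
  case (Times e f)
  have "val e m * val f m < 2 ^ (K * weight e) * 2 ^ (K * weight f)"
    using Times by (intro mult_strict_mono) auto
  also have "\<dots> \<le> 2 ^ (K * (weight e + weight f + 1))"
    by (simp add: power_add[symmetric] algebra_simps)
  finally show ?case by simp
next
  case (Div e f)
  have "val e m div val f m < 2 ^ (K * weight e)" using Div(1) by (meson div_le_dividend le_less_trans)
  also have "\<dots> \<le> 2 ^ (K * (weight e + weight f + 1))"
    by (intro power_increasing) (auto simp: algebra_simps)
  finally show ?case by simp
qed

lemma bits_val_bound:
  assumes "bounded K m" "1 \<le> K"
  shows "bits (val e m) \<le> K * weight e"
  using val_bound[OF assms, of e] assms(2) weight_pos[of e] by (subst bits_le_iff) auto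

text \<open>For the nodes of an expression in the next induction: squares are superadditive with
  enough room to absorb the charge for a single operation, be it a sum or a product of
  lengths.\<close>

lemma sum_squares_bound:
  fixes a b k :: nat
  assumes "1 \<le> k"
  shows "4 * a\<^sup>2 + 4 * b\<^sup>2 + a + b \<le> 4 * (a + b + k)\<^sup>2"
    and "4 * a\<^sup>2 + 4 * b\<^sup>2 + a * b \<le> 4 * (a + b + k)\<^sup>2"
    and "4 * a\<^sup>2 + a + k \<le> 4 * (a + k)\<^sup>2"
proof -
  obtain l where "k = l + 1" using assms by (metis add.commute le_Suc_ex)
  then show "4 * a\<^sup>2 + 4 * b\<^sup>2 + a + b \<le> 4 * (a + b + k)\<^sup>2"
    "4 * a\<^sup>2 + 4 * b\<^sup>2 + a * b \<le> 4 * (a + b + k)\<^sup>2"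
    "4 * a\<^sup>2 + a + k \<le> 4 * (a + k)\<^sup>2"
    by (simp_all add: power2_eq_square algebra_simps)
qed

lemma val_time_bound:
  assumes "bounded K m" "1 \<le> K"
  shows "val_time e m \<le> 4 * (K * weight e)\<^sup>2"
proof (induction e)
  case (Lit k)
  have "bits k \<le> K * bits k" using assms(2) by simp
  also have "\<dots> \<le> (K * bits k)\<^sup>2" by (simp add: power2_eq_square)
  finally show ?case by simp
next
  case (Cell a e)
  have "bits (m a (val e m)) \<le> K" using assms by (subst bits_le_iff) (auto simp: bounded_def)
  then show ?case
    using Cell bits_val_bound[OF assms, of e] sum_squares_bound(3)[OF assms(2), of "K * weight e"]
    by (simp add: algebra_simps)
next
  case (Times e f)
  let ?a = "K * weight e" and ?b = "K * weight f"
  have "bits (val e m) * bits (val f m) \<le> ?a * ?b"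
    using bits_val_bound[OF assms] by (intro mult_mono) auto
  then have "val_time (Times e f) m \<le> 4 * ?a\<^sup>2 + 4 * ?b\<^sup>2 + ?a * ?b"
    using Times by simp
  also have "\<dots> \<le> 4 * (?a + ?b + K)\<^sup>2" by (rule sum_squares_bound(2)[OF assms(2)])
  finally show ?case by (simp add: algebra_simps)
next
  case (Div e f)
  let ?a = "K * weight e" and ?b = "K * weight f"
  have "bits (val e m) * bits (val f m) \<le> ?a * ?b"
    using bits_val_bound[OF assms] by (intro mult_mono) auto
  then have "val_time (Div e f) m \<le> 4 * ?a\<^sup>2 + 4 * ?b\<^sup>2 + ?a * ?b"
    using Div by simp
  also have "\<dots> \<le> 4 * (?a + ?b + K)\<^sup>2" by (rule sum_squares_bound(2)[OF assms(2)])
  finally show ?case by (simp add: algebra_simps)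
next
  case (Plus e f)
  let ?a = "K * weight e" and ?b = "K * weight f"
  have "val_time (Plus e f) m \<le> 4 * ?a\<^sup>2 + 4 * ?b\<^sup>2 + ?a + ?b"
    using Plus bits_val_bound[OF assms, of e] bits_val_bound[OF assms, of f] by simp
  also have "\<dots> \<le> 4 * (?a + ?b + K)\<^sup>2" by (rule sum_squares_bound(1)[OF assms(2)])
  finally show ?case by (simp add: algebra_simps)
next
  case (Minus e f)
  let ?a = "K * weight e" and ?b = "K * weight f"
  have "val_time (Minus e f) m \<le> 4 * ?a\<^sup>2 + 4 * ?b\<^sup>2 + ?a + ?b"
    using Minus bits_val_bound[OF assms, of e] bits_val_bound[OF assms, of f] by simp
  also have "\<dots> \<le> 4 * (?a + ?b + K)\<^sup>2" by (rule sum_squares_bound(1)[OF assms(2)])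
  finally show ?case by (simp add: algebra_simps)
qed

text \<open>Bounds an elementary step. In an assignment, evaluating two expressions takes at most 8
  times the square of \<open>K * Z\<close>, and the lengths of the two values add at most 2 more; a
  query has at most \<open>N + 1\<close> cells of \<open>K\<close> bits and is answered in time
  \<open>B\<close>.\<close>

definition unit_time :: "nat \<Rightarrow> nat \<Rightarrow> nat \<Rightarrow> nat \<Rightarrow> nat" where
  "unit_time Z K N B = 10 * (K * Z)\<^sup>2 + (N + 1) * K + B + 1"

lemma val_time_unit:
  assumes "bounded K m" "1 \<le> K" "weight e \<le> Z"
  shows "val_time e m \<le> 4 * (K * Z)\<^sup>2"
proof -
  have "(K * weight e)\<^sup>2 \<le> (K * Z)\<^sup>2" using assms(3) by (intro power_mono) auto
  then show ?thesis using val_time_bound[OF assms(1,2), of e] by linarith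
qed

lemma assign_time_unit:
  assumes "bounded K m" "1 \<le> K" "weight i \<le> Z" "weight e \<le> Z"
  shows "val_time i m + val_time e m + bits (val i m) + bits (val e m) \<le> unit_time Z K N B"
proof -
  have "bits (val e' m) \<le> (K * Z)\<^sup>2" if "weight e' \<le> Z" for e'
  proof -
    have "bits (val e' m) \<le> K * weight e'" by (rule bits_val_bound[OF assms(1,2)])
    also have "\<dots> \<le> K * Z" using that by simp
    also have "\<dots> \<le> (K * Z)\<^sup>2" by (simp add: power2_eq_square)
    finally show ?thesis .
  qed
  from this[OF assms(3)] this[OF assms(4)] show ?thesis
    using val_time_unit[OF assms(1,2,3)] val_time_unit[OF assms(1,2,4)]
    unfolding unit_time_def by linarith
qed

section \<open>A total-correctness calculus with bounds on time and size\<close>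

locale oracle_machine =
  fixes ora :: "nat list \<Rightarrow> bool" and tim :: "nat list \<Rightarrow> nat" and K N B Z :: nat
  assumes K_pos: "1 \<le> K" and N_less: "N + 1 < 2 ^ K"
begin

text \<open>\<open>wp\<close> is a total-correctness precondition transformer. It also enforces that cells stay
  below \<open>2 ^ K\<close>, loops iterate at most \<open>N\<close> times, and queries are short and answered in
  time \<open>B\<close>, so that running time is bounded by the syntactic step count \<open>steps N\<close>.\<close>

primrec wp :: "stm \<Rightarrow> (memory \<Rightarrow> bool) \<Rightarrow> memory \<Rightarrow> bool" where
  "wp Nop Q m = Q m"
| "wp (Set a i e) Q m = (val e m < 2 ^ K \<and> Q (m(a := (m a)(val i m := val e m))))"
| "wp (Then c d) Q m = wp c (wp d Q) m"
| "wp (Branch e c d) Q m = (if val e m \<noteq> 0 then wp c Q m else wp d Q m)"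
| "wp (Ask x a e) Q m =
     (val e m \<le> N + 1 \<and> tim (map (m a) [0..<val e m]) \<le> B \<and>
      Q (m(x := (m x)(0 := (if ora (map (m a) [0..<val e m]) then 1 else 0)))))"
| "wp (For x e c) Q m =
     (val e m \<le> N \<and>
      (\<exists>J. J 0 (m(x := (m x)(0 := 0))) \<and>
         (\<forall>i<val e m. \<forall>m'. J i m' \<longrightarrow> m' x 0 = i \<longrightarrow> agree (insert x (writes c)) m m' \<longrightarrow>
            wp c (\<lambda>m''. J (Suc i) (m''(x := (m'' x)(0 := Suc i)))) m') \<and>
         (\<forall>m'. J (val e m) m' \<longrightarrow> agree (insert x (writes c)) m m' \<longrightarrow> Q m')))"

text \<open>Monotonicity combined with a frame rule: the new postcondition may use that only the
  arrays in \<open>writes s\<close> have changed. For loops the old invariant serves again, as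
  \<open>wp\<close> already supplies the frame at the exit.\<close>

lemma wp_conseq:
  assumes "wp s Q m" "\<And>m'. Q m' \<Longrightarrow> agree (writes s) m m' \<Longrightarrow> R m'"
  shows "wp s R m"
  using assms
proof (induction s arbitrary: Q R m)
  case Nop
  then show ?case by (simp add: agree_refl)
next
  case (Set a i e)
  have "agree (writes (Set a i e)) m (m(a := (m a)(val i m := val e m)))" by (simp add: agree_def)
  with Set.prems show ?case unfolding wp.simps by blast
next
  case (Then c d)
  have "wp c (wp d Q) m" using Then.prems(1) by simp
  then have "wp c (wp d R) m"
  proof (rule Then.IH(1))
    fix m' assume m': "wp d Q m'" "agree (writes c) m m'"
    show "wp d R m'"
    proof (rule Then.IH(2)[OF m'(1)])
      fix m'' assume "Q m''" "agree (writes d) m' m''"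
      then show "R m''"
        using agree_trans[OF m'(2), of "writes d" m'' "writes (Then c d)"]
        by (intro Then.prems(2)) simp_all
    qed
  qed
  then show ?case by simp
next
  case (Branch e c d)
  have *: "agree (writes (Branch e c d)) m m'" if "agree (writes c) m m' \<or> agree (writes d) m m'" for m'
    using that by (simp add: agree_def) blast
  show ?case
  proof (cases "val e m \<noteq> 0")
    case True
    with Branch.prems(1) have "wp c Q m" by simp
    then have "wp c R m" by (rule Branch.IH(1)) (rule Branch.prems(2), assumption, rule *, erule disjI1)
    then show ?thesis using True by simp
  next
    case False
    with Branch.prems(1) have "wp d Q m" by simp
    then have "wp d R m" by (rule Branch.IH(2)) (rule Branch.prems(2), assumption, rule *, erule disjI2)
    then show ?thesis using False by simp
  qed
next
  case (Ask x a e)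
  let ?m = "m(x := (m x)(0 := (if ora (map (m a) [0..<val e m]) then 1 else 0)))"
  have "agree (writes (Ask x a e)) m ?m" by (simp add: agree_def)
  with Ask.prems show ?case unfolding wp.simps by blast
next
  case (For x e c)
  from For.prems(1) obtain J where J: "val e m \<le> N" "J 0 (m(x := (m x)(0 := 0)))"
    "\<forall>i<val e m. \<forall>m'. J i m' \<longrightarrow> m' x 0 = i \<longrightarrow> agree (insert x (writes c)) m m' \<longrightarrow>
       wp c (\<lambda>m''. J (Suc i) (m''(x := (m'' x)(0 := Suc i)))) m'"
    "\<forall>m'. J (val e m) m' \<longrightarrow> agree (insert x (writes c)) m m' \<longrightarrow> Q m'"
    by auto
  have "\<forall>m'. J (val e m) m' \<longrightarrow> agree (insert x (writes c)) m m' \<longrightarrow> R m'"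
    using J(4) For.prems(2) by simp
  with J(1-3) show ?case unfolding wp.simps by (intro conjI exI[of _ J])
qed

text \<open>\<open>J i\<close> describes the memory at the loop head, when the counter already holds
  \<open>i\<close>. The frame is handed to every round, so invariants do not have to carry
  it.\<close>

lemma wp_For:
  assumes "val e m = b" "b \<le> N" "J 0 (m(x := (m x)(0 := 0)))"
    and "\<And>i m'. i < b \<Longrightarrow> J i m' \<Longrightarrow> m' x 0 = i \<Longrightarrow> agree (insert x (writes c)) m m' \<Longrightarrow>
      wp c (\<lambda>m''. J (Suc i) (m''(x := (m'' x)(0 := Suc i)))) m'"
    and "\<And>m'. J b m' \<Longrightarrow> agree (insert x (writes c)) m m' \<Longrightarrow> Q m'"
  shows "wp (For x e c) Q m"
  using assms by auto

definition runs :: "program \<Rightarrow> memory \<Rightarrow> nat \<Rightarrow> (memory \<Rightarrow> bool) \<Rightarrow> bool" where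
  "runs p m n Q \<longleftrightarrow>
     (\<exists>k m'. exec ora tim p m k m' \<and> k \<le> n * unit_time Z K N B \<and> bounded K m' \<and> Q m')"

lemma one_less: "Suc 0 < 2 ^ K"
  using one_less_power[of "2 :: nat" K] K_pos by simp

lemma runs_Assign:
  assumes "bounded K m" "weight i \<le> Z" "weight e \<le> Z" "val e m < 2 ^ K"
  shows "runs (Assign a i e) m 1 (\<lambda>m'. m' = m(a := (m a)(val i m := val e m)))"
proof -
  have "bounded K (m(a := (m a)(val i m := val e m)))"
    using assms(1,4) by (simp add: bounded_def)
  with exec.Assign[of ora tim a i e m] assign_time_unit[OF assms(1) K_pos assms(2,3)]
  show ?thesis unfolding runs_def by fastforce
qed

lemma runs_Seq:
  assumes "runs c m n Q" "\<And>m'. Q m' \<Longrightarrow> bounded K m' \<Longrightarrow> runs d m' n' R"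
  shows "runs (Seq c d) m (n + n') R"
proof -
  obtain k m' where c: "exec ora tim c m k m'" "k \<le> n * unit_time Z K N B" "bounded K m'" "Q m'"
    using assms(1) unfolding runs_def by blast
  obtain k' m'' where d: "exec ora tim d m' k' m''" "k' \<le> n' * unit_time Z K N B" "bounded K m''" "R m''"
    using assms(2)[OF c(4,3)] unfolding runs_def by blast
  have "k + k' \<le> (n + n') * unit_time Z K N B" using c(2) d(2) by (simp add: algebra_simps)
  then show ?thesis using exec.Seq[OF c(1) d(1)] d(3,4) unfolding runs_def by blast
qed

lemma runs_weaken: "runs c m n Q \<Longrightarrow> n \<le> n' \<Longrightarrow> (\<And>m'. Q m' \<Longrightarrow> Q' m') \<Longrightarrow> runs c m n' Q'"
  unfolding runs_def by (meson dual_order.trans mult_le_mono1)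

lemma val_time_le: "bounded K m \<Longrightarrow> weight e \<le> Z \<Longrightarrow> val_time e m \<le> unit_time Z K N B"
  using val_time_unit[OF _ K_pos] by (fastforce simp: unit_time_def)

lemma runs_While:
  assumes weight: "weight b \<le> Z"
    and body: "\<And>i m. i < n \<Longrightarrow> J i m \<Longrightarrow> bounded K m \<Longrightarrow> val b m \<noteq> 0 \<and> runs c m l (J (Suc i))"
    and exit: "\<And>m. J n m \<Longrightarrow> val b m = 0"
    and init: "J i m" "i \<le> n" "bounded K m"
  shows "runs (While b c) m (1 + (n - i) * (l + 1)) (J n)"
  using init
proof (induction "n - i" arbitrary: i m)
  case 0
  then have "J n m" by simp
  moreover from this have "exec ora tim (While b c) m (val_time b m) m"
    using exit by (intro exec.WhileFalse) auto
  ultimately show ?case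
    using val_time_le[OF 0(4) weight] 0 unfolding runs_def by fastforce
next
  case (Suc x)
  let ?u = "unit_time Z K N B"
  have i: "i < n" using Suc.hyps(2) by simp
  obtain k m' where c: "val b m \<noteq> 0" "exec ora tim c m k m'" "k \<le> l * ?u" "bounded K m'" "J (Suc i) m'"
    using body[OF i Suc.prems(1,3)] unfolding runs_def by blast
  have "runs (While b c) m' (1 + (n - Suc i) * (l + 1)) (J n)"
    using Suc.hyps(2) i c(4,5) by (intro Suc.hyps(1)) auto
  then obtain k' m'' where w: "exec ora tim (While b c) m' k' m''"
    "k' \<le> (1 + (n - Suc i) * (l + 1)) * ?u" "bounded K m''" "J n m''"
    unfolding runs_def by blast
  have "n - i = Suc (n - Suc i)" using i by simp
  then have "val_time b m + k + k' \<le> (1 + (n - i) * (l + 1)) * ?u"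
    using val_time_le[OF Suc.prems(3) weight] c(3) w(2) by (simp add: algebra_simps)
  then show ?case using exec.WhileTrue[OF c(1,2) w(1)] w(3,4) unfolding runs_def by blast
qed

text \<open>Each side condition built into \<open>wp\<close> pays for one case: assigned values fit
  into cells, loops make at most \<open>N\<close> rounds, queries are short and fast. So the clock
  advances by at most \<open>steps N s\<close> units.\<close>

lemma wp_sound:
  assumes "wp s Q m" "well_formed Z s" "bounded K m"
  shows "runs (compile s) m (steps N s) (\<lambda>m'. Q m' \<and> agree (writes s) m m')"
  using assms
proof (induction s arbitrary: Q m)
  case Nop
  have "1 \<le> 1 * unit_time Z K N B" by (simp add: unit_time_def)
  moreover have "Q m" using Nop.prems(1) by simp
  ultimately show ?case
    using exec.Skip[of ora tim m] Nop.prems(3) agree_refl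
    unfolding runs_def compile.simps steps.simps by blast
next
  case (Set a i e)
  show ?case
    unfolding compile.simps steps.simps
  proof (rule runs_weaken[OF runs_Assign])
    fix m' assume m': "m' = m(a := (m a)(val i m := val e m))"
    have "agree (writes (Set a i e)) m m'" unfolding m' by (simp add: agree_def)
    moreover have "Q m'" unfolding m' using Set.prems(1) unfolding wp.simps by (rule conjunct2)
    ultimately show "Q m' \<and> agree (writes (Set a i e)) m m'" by blast
  qed (use Set.prems in simp_all)
next
  case (Then c d)
  show ?case
    unfolding compile.simps steps.simps
  proof (rule runs_Seq)
    show "runs (compile c) m (steps N c) (\<lambda>m'. wp d Q m' \<and> agree (writes c) m m')"
      using Then.prems by (intro Then.IH(1)) auto
    fix m' assume m': "wp d Q m' \<and> agree (writes c) m m'" "bounded K m'"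
    have "runs (compile d) m' (steps N d) (\<lambda>m''. Q m'' \<and> agree (writes d) m' m'')"
      using Then.prems m' by (intro Then.IH(2)) auto
    then show "runs (compile d) m' (steps N d) (\<lambda>m''. Q m'' \<and> agree (writes (Then c d)) m m'')"
      by (rule runs_weaken) (use m' in \<open>auto intro: agree_trans\<close>)
  qed
next
  case (Branch e c d)
  let ?u = "unit_time Z K N B"
  have le: "val_time e m \<le> ?u" using val_time_le Branch.prems by auto
  show ?case
  proof (cases "val e m \<noteq> 0")
    case True
    have "runs (compile c) m (steps N c) (\<lambda>m'. Q m' \<and> agree (writes c) m m')"
      using Branch.prems True by (intro Branch.IH(1)) auto
    then obtain k m' where c: "exec ora tim (compile c) m k m'" "k \<le> steps N c * ?u"
      "bounded K m'" "Q m'" "agree (writes c) m m'" unfolding runs_def by blast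
    have "val_time e m + k \<le> steps N (Branch e c d) * ?u" using le c(2) by (simp add: algebra_simps)
    moreover have "agree (writes (Branch e c d)) m m'" using c(5) by (rule agree_mono) simp
    ultimately show ?thesis
      using exec.CondTrue[OF True c(1)] c(3,4) unfolding runs_def compile.simps by blast
  next
    case False
    have "runs (compile d) m (steps N d) (\<lambda>m'. Q m' \<and> agree (writes d) m m')"
      using Branch.prems False by (intro Branch.IH(2)) auto
    then obtain k m' where c: "exec ora tim (compile d) m k m'" "k \<le> steps N d * ?u"
      "bounded K m'" "Q m'" "agree (writes d) m m'" unfolding runs_def by blast
    have "val_time e m + k \<le> steps N (Branch e c d) * ?u" using le c(2) by (simp add: algebra_simps)
    moreover have "agree (writes (Branch e c d)) m m'" using c(5) by (rule agree_mono) simp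
    moreover have "val e m = 0" using False by simp
    ultimately show ?thesis
      using exec.CondFalse[OF _ c(1)] c(3,4) unfolding runs_def compile.simps by blast
  qed
next
  case (Ask x a e)
  let ?q = "map (m a) [0..<val e m]"
  let ?m = "m(x := (m x)(0 := (if ora ?q then 1 else 0)))"
  have "\<forall>j\<in>set ?q. bits j \<le> K"
    using Ask.prems(3) K_pos by (auto simp: bits_le_iff bounded_def)
  then have "(\<Sum>j\<leftarrow>?q. bits j) \<le> (\<Sum>j\<leftarrow>?q. K)" by (intro sum_list_mono) auto
  also have "\<dots> = val e m * K" by (simp only: sum_list_triv length_map length_upt) simp
  also have "\<dots> \<le> (N + 1) * K" using Ask.prems(1) by (intro mult_le_mono1) simp
  finally have "1 + val_time e m + (\<Sum>j\<leftarrow>?q. bits j) + tim ?q \<le> unit_time Z K N B"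
    using Ask.prems val_time_unit[OF Ask.prems(3) K_pos, of e Z] by (simp add: unit_time_def)
  moreover have "bounded K ?m" using Ask.prems(3) one_less by (simp add: bounded_def)
  moreover have "Q ?m" using Ask.prems(1) unfolding wp.simps by (elim conjE)
  moreover have "agree (writes (Ask x a e)) m ?m" by (simp add: agree_def)
  ultimately show ?case
    using exec.Query[of ?q m a e ora tim x] unfolding runs_def compile.simps steps.simps mult_1 by blast
next
  case (For x e c)
  let ?n = "val e m" and ?X = "insert x (writes c)"
  let ?inc = "Assign x (Lit 0) (Plus (var x) (Lit 1))"
  have wf: "weight e + 5 \<le> Z" "well_formed Z c" "x \<notin> writes c" "?X \<inter> reads e = {}"
    using For.prems(2) by auto
  note W = For.prems(1)[unfolded wp.simps]
  from conjunct2[OF W] obtain J where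
      "J 0 (m(x := (m x)(0 := 0))) \<and>
       (\<forall>i<?n. \<forall>m'. J i m' \<longrightarrow> m' x 0 = i \<longrightarrow> agree ?X m m' \<longrightarrow>
         wp c (\<lambda>m''. J (Suc i) (m''(x := (m'' x)(0 := Suc i)))) m') \<and>
       (\<forall>m'. J ?n m' \<longrightarrow> agree ?X m m' \<longrightarrow> Q m')"
    by (rule exE)
  with conjunct1[OF W] have J: "?n \<le> N" "J 0 (m(x := (m x)(0 := 0)))"
    "\<And>i m'. i < ?n \<Longrightarrow> J i m' \<Longrightarrow> m' x 0 = i \<Longrightarrow> agree ?X m m' \<Longrightarrow>
       wp c (\<lambda>m''. J (Suc i) (m''(x := (m'' x)(0 := Suc i)))) m'"
    "\<And>m'. J ?n m' \<Longrightarrow> agree ?X m m' \<Longrightarrow> Q m'"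
    by simp_all
  \<comment> \<open>The invariant on the machine level also records the counter and the frame; the
    frame keeps the re-evaluated bound \<open>e\<close> constant.\<close>
  define I where "I = (\<lambda>i m'. J i m' \<and> m' x 0 = i \<and> agree ?X m m')"
  have e_val: "val e m' = ?n" if "agree ?X m m'" for m'
    using val_agree[OF that wf(4)] .
  have Zge: "5 \<le> Z" using wf(1) by simp
  have "runs (Assign x (Lit 0) (Lit 0)) m 1 (\<lambda>m'. m' = m(x := (m x)(0 := 0)))"
    using runs_Assign[of m "Lit 0" "Lit 0" x] For.prems(3) Zge by (simp add: bits_def floorlog_def)
  then have init: "runs (Assign x (Lit 0) (Lit 0)) m 1 (I 0)"
    by (rule runs_weaken) (use J(2) in \<open>auto simp: I_def agree_def\<close>)
  have body: "val (Minus e (var x)) m' \<noteq> 0 \<and> runs (Seq (compile c) ?inc) m' (steps N c + 1) (I (Suc i))"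
    if i: "i < ?n" and I: "I i m'" and bnd: "bounded K m'" for i m'
  proof
    show "val (Minus e (var x)) m' \<noteq> 0" using I i e_val by (simp add: I_def)
    show "runs (Seq (compile c) ?inc) m' (steps N c + 1) (I (Suc i))"
    proof (rule runs_Seq)
      show "runs (compile c) m' (steps N c)
        (\<lambda>m''. J (Suc i) (m''(x := (m'' x)(0 := Suc i))) \<and> agree (writes c) m' m'')"
        by (rule For.IH[OF J(3)[OF i] wf(2) bnd]) (use I in \<open>simp_all add: I_def\<close>)
      fix m'' assume m'': "J (Suc i) (m''(x := (m'' x)(0 := Suc i))) \<and> agree (writes c) m' m''" "bounded K m''"
      have x: "m'' x 0 = i" using m''(1) wf(3) I by (auto simp: agree_def I_def)
      have "Suc i < 2 ^ K" using i J(1) N_less by linarith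
      then have "runs ?inc m'' 1 (\<lambda>m'. m' = m''(x := (m'' x)(0 := Suc i)))"
        using runs_Assign[of m'' "Lit 0" "Plus (var x) (Lit 1)" x] m''(2) Zge x
        by (simp add: bits_def floorlog_def)
      then show "runs ?inc m'' 1 (I (Suc i))"
        by (rule runs_weaken) (use m''(1) I in \<open>auto simp: I_def agree_def\<close>)
    qed
  qed
  have exit: "val (Minus e (var x)) m' = 0" if "I ?n m'" for m'
    using that e_val by (simp add: I_def)
  have "runs (compile (For x e c)) m (1 + (1 + ?n * (steps N c + 2))) (I ?n)"
    unfolding compile.simps
  proof (rule runs_Seq[OF init])
    fix m' assume "I 0 m'" "bounded K m'"
    moreover have "weight (Minus e (var x)) \<le> Z" using wf(1) by (simp add: bits_def floorlog_def)
    ultimately show "runs (While (Minus e (var x)) (Seq (compile c) ?inc)) m' (1 + ?n * (steps N c + 2)) (I ?n)"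
      using runs_While[of "Minus e (var x)" ?n I "Seq (compile c) ?inc" "steps N c + 1" 0 m', OF _ body exit]
      by simp
  qed
  then show ?case
  proof (rule runs_weaken)
    show "1 + (1 + ?n * (steps N c + 2)) \<le> steps N (For x e c)"
      using mult_le_mono1[OF J(1), of "steps N c + 2"] by simp
    show "Q m' \<and> agree (writes (For x e c)) m m'" if "I ?n m'" for m'
      using that J(4) by (simp add: I_def)
  qed
qed

end

text \<open>Every loop contributes one factor \<open>N\<close>, so nesting of loops becomes
  multiplication of polynomials.\<close>

lemma steps_poly: "\<exists>p :: nat poly. \<forall>N. steps N s = poly p N"
proof (induction s)
  case (Then c d)
  then obtain p q :: "nat poly" where "\<forall>N. steps N c = poly p N" "\<forall>N. steps N d = poly q N" by blast
  then show ?case by (intro exI[of _ "p + q"]) simp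
next
  case (Branch e c d)
  then obtain p q :: "nat poly" where "\<forall>N. steps N c = poly p N" "\<forall>N. steps N d = poly q N" by blast
  then show ?case by (intro exI[of _ "1 + p + q"]) simp
next
  case (For x e c)
  then obtain p :: "nat poly" where "\<forall>N. steps N c = poly p N" by blast
  then show ?case by (intro exI[of _ "[:2:] + [:0, 1:] * (p + [:2:])"]) simp
qed (auto intro: exI[of _ "1 :: nat poly"])

section \<open>The program and its correctness\<close>

abbreviation entry :: "string \<Rightarrow> expr \<Rightarrow> expr \<Rightarrow> expr" where
  "entry x u j \<equiv> Cell x (Plus (Times u (var ''n'')) j)"

text \<open>Conditions are arithmetic: \<open>Times\<close> is conjunction, \<open>Plus\<close>
  disjunction, \<open>Minus (Lit 1) x\<close> negation, and \<open>Minus x y\<close> is nonzero iff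
  \<open>x\<close> exceeds \<open>y\<close>. Multiplying by the entries of \<open>arc\<close> and
  \<open>fin\<close> masks meaningless entries of \<open>w\<close> and \<open>val\<close>.\<close>

definition near :: "string \<Rightarrow> expr \<Rightarrow> expr \<Rightarrow> expr \<Rightarrow> expr" where
  "near w u j c = Times (entry ''arc'' u j) (Times (Cell ''fin'' j)
     (Minus (Lit 1) (Minus (Plus (entry w u j) (Cell ''val'' j)) c)))"

text \<open>The oracle decides independence only. For player 2 the heads within the bound are
  submitted and the answer has to be negated; for player 1 the remaining heads are submitted. The
  length starts at 1 because cell 0 of the query holds \<open>u\<close>.\<close>

definition test :: "bool \<Rightarrow> string \<Rightarrow> stm" where
  "test b w =
     Then (Set ''q'' (Lit 0) (var ''u''))
    (Then (Set ''len'' (Lit 0) (Lit 1))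
    (Then (For ''i'' (var ''n'')
       (Branch (if b then near w (var ''u'') (var ''i'') (var ''th'')
                else Times (entry ''arc'' (var ''u'') (var ''i''))
                  (Minus (Lit 1) (near w (var ''u'') (var ''i'') (var ''th''))))
         (Then (Set ''q'' (var ''len'') (var ''i'')) (Set ''len'' (Lit 0) (Plus (var ''len'') (Lit 1))))
         Nop))
      (Ask ''ans'' ''q'' (var ''len''))))"

text \<open>Position \<open>k\<close> stands for the pair of \<open>k div n\<close> and
  \<open>k mod n\<close>. The oracle is consulted only for thresholds that improve on the best
  winning one so far; the flag \<open>best\<close> replaces an infinite initial value.\<close>

definition search :: "bool \<Rightarrow> string \<Rightarrow> stm" where
  "search b w =
     Then (Set ''best'' (Lit 0) (Lit 0))
     (For ''k'' (Times (var ''n'') (var ''n''))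
       (Then (Set ''u'' (Lit 0) (Div (var ''k'') (var ''n'')))
       (Then (Set ''j'' (Lit 0) (Minus (var ''k'') (Times (var ''u'') (var ''n''))))
       (Branch (Times (Cell ''arc'' (var ''k''))
            (Times (Minus (Lit 1) (Cell ''fin'' (var ''u''))) (Cell ''fin'' (var ''j''))))
         (Then (Set ''th'' (Lit 0) (Plus (Cell w (var ''k'')) (Cell ''val'' (var ''j''))))
         (Branch (Plus (Minus (Lit 1) (var ''best'')) (Minus (var ''bth'') (var ''th'')))
           (Then (test b w)
           (Branch (if b then Minus (Lit 1) (var ''ans'') else var ''ans'')
             (Then (Set ''best'' (Lit 0) (Lit 1))
             (Then (Set ''bu'' (Lit 0) (var ''u'')) (Set ''bth'' (Lit 0) (var ''th''))))
             Nop))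
           Nop))
         Nop))))"

text \<open>A running minimum of the other player's distance over the heads within the bound, with
  the flag \<open>g\<close> for infinity. The arrays of settled data change only after this
  scan.\<close>

definition update :: "string \<Rightarrow> string \<Rightarrow> stm" where
  "update w w' =
     Then (Set ''g'' (Lit 0) (Lit 0))
    (Then (For ''i'' (var ''n'')
       (Branch (Times (near w (var ''bu'') (var ''i'') (var ''bth''))
           (Plus (Minus (Lit 1) (var ''g''))
             (Minus (var ''gd'') (Plus (entry w' (var ''bu'') (var ''i'')) (Cell ''dist'' (var ''i''))))))
         (Then (Set ''gd'' (Lit 0) (Plus (entry w' (var ''bu'') (var ''i'')) (Cell ''dist'' (var ''i''))))
         (Then (Set ''gi'' (Lit 0) (var ''i'')) (Set ''g'' (Lit 0) (Lit 1))))
         Nop))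
    (Then (Set ''fin'' (var ''bu'') (Lit 1))
    (Then (Set ''val'' (var ''bu'') (var ''bth''))
    (Then (Set ''dist'' (var ''bu'') (var ''gd'')) (Set ''next'' (var ''bu'') (var ''gi''))))))"

text \<open>Clearing \<open>fin\<close> is enough before a second run: \<open>val\<close>,
  \<open>dist\<close> and \<open>next\<close> count at settled vertices only, so leftovers are
  masked.\<close>

definition dijkstra :: "bool \<Rightarrow> string \<Rightarrow> string \<Rightarrow> stm" where
  "dijkstra b w w' =
     Then (For ''i'' (var ''n'') (Set ''fin'' (var ''i'') (Lit 0)))
    (Then (Set ''fin'' (var ''t'') (Lit 1))
    (Then (Set ''val'' (var ''t'') (Lit 0))
    (Then (Set ''dist'' (var ''t'') (Lit 0))
      (For ''r'' (var ''n'') (Then (search b w) (Branch (var ''best'') (update w w') Nop))))))"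

lemma div_mod_index:
  fixes n u j :: nat
  assumes "u < n" "j < n"
  shows "(u * n + j) div n = u" "(u * n + j) mod n = j" "u * n + j < n * n"
proof -
  show "(u * n + j) div n = u" "(u * n + j) mod n = j" using assms by simp_all
  have "u * n + j < Suc u * n" using assms by simp
  also have "\<dots> \<le> n * n" using assms by (intro mult_le_mono1) simp
  finally show "u * n + j < n * n" .
qed

lemma agreeD: "agree X m m' \<Longrightarrow> a \<notin> X \<Longrightarrow> m' a = m a"
  by (simp add: agree_def)

text \<open>\<open>big\<close> abstracts from the game, and \<open>answers\<close> ties it to the
  oracle according to \<open>b\<close>, so that the program is verified once for both players.
  Values stay at most \<open>n * Wm\<close>; the bound on \<open>Wm\<close> leaves room for one more
  arc.\<close>

locale phase = oracle_machine ora tim K N B Z + arena "{..<n}" E big "\<lambda>u j. real (W u j)" "\<lambda>u j. real (W' u j)" t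
  for ora tim K N B Z n E big W W' t +
  fixes s :: nat and b :: bool and w w' :: string and Wm :: nat
  assumes s_less: "s < n" and n_sq: "n * n \<le> N"
    and W_le: "u < n \<Longrightarrow> j \<in> E u \<Longrightarrow> W u j \<le> Wm" and W'_le: "u < n \<Longrightarrow> j \<in> E u \<Longrightarrow> W' u j \<le> Wm"
    and Wm: "(n + 1) * Wm < 2 ^ K"
    and w: "w \<in> {''w1'', ''w2''}" and w': "w' \<in> {''w1'', ''w2''}"
    and answers: "\<lbrakk>u < n; u \<noteq> t; distinct js; set js \<subseteq> E u\<rbrakk> \<Longrightarrow> tim (u # js) \<le> B \<and>
      (ora (u # js) \<longleftrightarrow> (if b then \<not> big u (set js) else big u (E u - set js)))"
begin

declare wp.simps(5,6) [simp del]

abbreviation "R \<equiv> \<lambda>u j. real (W u j)"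
abbreviation "R' \<equiv> \<lambda>u j. real (W' u j)"

definition env :: "memory \<Rightarrow> bool" where
  "env m \<longleftrightarrow> m ''n'' 0 = n \<and> m ''s'' 0 = s \<and> m ''t'' 0 = t \<and>
     (\<forall>u<n. \<forall>j<n. m ''arc'' (u * n + j) = (if j \<in> E u then 1 else 0)) \<and>
     (\<forall>u<n. \<forall>j\<in>E u. m w (u * n + j) = W u j \<and> m w' (u * n + j) = W' u j)"

definition finals :: "memory \<Rightarrow> nat set" where
  "finals m = {i. i < n \<and> m ''fin'' i \<noteq> 0}"

abbreviation "vals m \<equiv> \<lambda>i. real (m ''val'' i)"
abbreviation "dists m \<equiv> \<lambda>i. real (m ''dist'' i)"

definition below :: "memory \<Rightarrow> nat \<Rightarrow> nat \<Rightarrow> nat set" where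
  "below m u c = heads_le E R (finals m) (vals m) u (real c)"

lemma w_cases: "w = ''w1'' \<or> w = ''w2''" "w' = ''w1'' \<or> w' = ''w2''"
  using w w' by auto

lemma w_neq [simp]:
  "x \<noteq> ''w1'' \<Longrightarrow> x \<noteq> ''w2'' \<Longrightarrow> w \<noteq> x" "x \<noteq> ''w1'' \<Longrightarrow> x \<noteq> ''w2'' \<Longrightarrow> w' \<noteq> x"
  "x \<noteq> ''w1'' \<Longrightarrow> x \<noteq> ''w2'' \<Longrightarrow> x \<noteq> w" "x \<noteq> ''w1'' \<Longrightarrow> x \<noteq> ''w2'' \<Longrightarrow> x \<noteq> w'"
  using w_cases by auto

lemma n_pos: "0 < n" and n_le: "n \<le> N"
proof -
  show "0 < n" using s_less by simp
  show "n \<le> N" using le_square[of n] n_sq by linarith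
qed

lemma less_K: "i \<le> n + 1 \<Longrightarrow> i < 2 ^ K"
  using n_le N_less by linarith

lemma E_less: "u < n \<Longrightarrow> j \<in> E u \<Longrightarrow> j < n"
  using E_sub by auto

lemma env_agree: "env m \<Longrightarrow> agree X m m' \<Longrightarrow> X \<inter> {''n'', ''s'', ''t'', ''arc'', ''w1'', ''w2''} = {} \<Longrightarrow> env m'"
proof -
  assume e: "env m" and a: "agree X m m'" and X: "X \<inter> {''n'', ''s'', ''t'', ''arc'', ''w1'', ''w2''} = {}"
  have "w \<notin> X" "w' \<notin> X" using w_cases X by auto
  with a X have "m' ''n'' = m ''n''" "m' ''s'' = m ''s''" "m' ''t'' = m ''t''"
    "m' ''arc'' = m ''arc''" "m' w = m w" "m' w' = m w'"
    by (auto intro!: agreeD)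
  with e show ?thesis by (simp add: env_def)
qed

lemma env_simps:
  assumes "env m"
  shows "m ''n'' 0 = n" "m ''s'' 0 = s" "m ''t'' 0 = t"
    "u < n \<Longrightarrow> j < n \<Longrightarrow> m ''arc'' (u * n + j) = (if j \<in> E u then 1 else 0)"
    "u < n \<Longrightarrow> j \<in> E u \<Longrightarrow> m w (u * n + j) = W u j" "u < n \<Longrightarrow> j \<in> E u \<Longrightarrow> m w' (u * n + j) = W' u j"
  using assms by (simp_all add: env_def)

lemma below_iff:
  "i \<in> below m u c \<longleftrightarrow> i \<in> E u \<and> i < n \<and> m ''fin'' i \<noteq> 0 \<and> W u i + m ''val'' i \<le> c"
  by (auto simp: below_def heads_le_def finals_def simp flip: of_nat_add)

lemma val_near:
  assumes "env m" "val u m < n" "val i m < n"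
  shows "val (near w u i c) m = 0 \<longleftrightarrow> val i m \<notin> below m (val u m) (val c m)"
  using env_simps[OF assms(1)] assms(2,3) by (auto simp: near_def below_iff)

lemma below_cong:
  "m' ''fin'' = m ''fin'' \<Longrightarrow> m' ''val'' = m ''val'' \<Longrightarrow> below m' u c = below m u c"
  by (auto simp: below_iff)

text \<open>The filter lists the submitted heads in increasing order, so the query is free of
  repetitions and has at most \<open>n + 1\<close> entries. Negation is left to the caller:
  \<open>ans\<close> agrees with \<open>big\<close> for player 1 and is its opposite for player
  2.\<close>

lemma wp_test:
  assumes env: "env m" and u: "m ''u'' 0 = u" "u < n" "u \<noteq> t"
  shows "wp (test b w) (\<lambda>m'. m' ''ans'' 0 \<noteq> 0 \<longleftrightarrow> big u (below m u (m ''th'' 0)) \<noteq> b) m"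
proof -
  define P where "P = (\<lambda>i. i \<in> E u \<and> (i \<in> below m u (m ''th'' 0) \<longleftrightarrow> b))"
  define m0 where "m0 = m(''q'' := (m ''q'')(0 := u), ''len'' := (m ''len'')(0 := 1))"
  let ?J = "\<lambda>i m'. map (m' ''q'') [0..<m' ''len'' 0] = u # filter P [0..<i]"
  let ?c = "if b then near w (var ''u'') (var ''i'') (var ''th'')
                else Times (entry ''arc'' (var ''u'') (var ''i''))
                  (Minus (Lit 1) (near w (var ''u'') (var ''i'') (var ''th'')))"
  have set_P: "set (filter P [0..<n]) = {i \<in> E u. i \<in> below m u (m ''th'' 0) \<longleftrightarrow> b}"
    using E_less[OF u(2)] by (auto simp: P_def)
  have env0: "env m0"
    by (rule env_agree[OF env, of "{''q'', ''len''}"]) (simp_all add: m0_def agree_def)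
  have "wp (For ''i'' (var ''n'') (Branch ?c
         (Then (Set ''q'' (var ''len'') (var ''i'')) (Set ''len'' (Lit 0) (Plus (var ''len'') (Lit 1))))
         Nop)) (\<lambda>m'. ?J n m') m0"
  proof (rule wp_For[where J = ?J])
    show "val (var ''n'') m0 = n" "n \<le> N" using env_simps[OF env0] n_le by simp_all
    show "?J 0 (m0(''i'' := (m0 ''i'')(0 := 0)))" by (simp add: m0_def)
  next
    fix i m' assume i: "i < n" and J: "?J i m'" and mi: "m' ''i'' 0 = i"
      and ag: "agree (insert ''i'' (writes (Branch ?c
         (Then (Set ''q'' (var ''len'') (var ''i'')) (Set ''len'' (Lit 0) (Plus (var ''len'') (Lit 1))))
         Nop))) m0 m'"
    then have ag: "agree {''i'', ''q'', ''len''} m0 m'" by (auto simp: agree_def)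
    have env': "env m'" by (rule env_agree[OF env0 ag]) simp
    have same: "m' ''fin'' = m ''fin''" "m' ''val'' = m ''val''" "m' ''th'' = m ''th''" "m' ''u'' = m ''u''"
      using ag by (simp_all add: agree_def m0_def)
    note nr = val_near[OF env', of "var ''u''" "var ''i''" "var ''th''"]
    have c: "val ?c m' \<noteq> 0 \<longleftrightarrow> P i"
    proof (cases b)
      case True
      then show ?thesis using nr i mi u same below_cong[OF same(1,2)]
        by (auto simp: P_def below_iff)
    next
      case False
      then show ?thesis using nr i mi u same below_cong[OF same(1,2)] env_simps(4)[OF env' u(2) i] env_simps(1)[OF env']
        by (auto simp: P_def)
    qed
    have "length (map (m' ''q'') [0..<m' ''len'' 0]) = length (u # filter P [0..<i])" using J by simp
    then have len: "m' ''len'' 0 = Suc (length (filter P [0..<i]))" by simp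
    also have "\<dots> \<le> n" using i length_filter_le[of P "[0..<i]"] by simp
    finally have lK: "Suc (m' ''len'' 0) < 2 ^ K" by (intro less_K) simp
    show "wp (Branch ?c
         (Then (Set ''q'' (var ''len'') (var ''i'')) (Set ''len'' (Lit 0) (Plus (var ''len'') (Lit 1))))
         Nop) (\<lambda>m''. ?J (Suc i) (m''(''i'' := (m'' ''i'')(0 := Suc i)))) m'"
    proof (cases "P i")
      case True
      then show ?thesis using c J mi lK less_K[of i] i
        by simp
    next
      case False
      then show ?thesis using c J by simp
    qed
  qed assumption
  then have "wp (For ''i'' (var ''n'') (Branch ?c
         (Then (Set ''q'' (var ''len'') (var ''i'')) (Set ''len'' (Lit 0) (Plus (var ''len'') (Lit 1))))
         Nop)) (wp (Ask ''ans'' ''q'' (var ''len''))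
     (\<lambda>m'. m' ''ans'' 0 \<noteq> 0 \<longleftrightarrow> big u (below m u (m ''th'' 0)) \<noteq> b)) m0"
  proof (rule wp_conseq)
    fix m' assume J: "?J n m'"
    let ?js = "filter P [0..<n]"
    have "length (map (m' ''q'') [0..<m' ''len'' 0]) = length (u # ?js)" using J by simp
    then have "m' ''len'' 0 \<le> N + 1" using length_filter_le[of P "[0..<n]"] n_le by simp
    moreover have "distinct ?js" "set ?js \<subseteq> E u" by (auto simp: P_def)
    note answers[OF u(2,3) this]
    moreover have "big u (if b then set ?js else E u - set ?js) \<longleftrightarrow> big u (below m u (m ''th'' 0))"
    proof -
      have "(if b then set ?js else E u - set ?js) = below m u (m ''th'' 0)"
        unfolding set_P by (auto simp: below_iff)
      then show ?thesis by simp
    qed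
    ultimately show "wp (Ask ''ans'' ''q'' (var ''len''))
     (\<lambda>m'. m' ''ans'' 0 \<noteq> 0 \<longleftrightarrow> big u (below m u (m ''th'' 0)) \<noteq> b) m'"
      using J by (auto simp: wp.simps(5))
  qed
  then show ?thesis
    using u less_K[of u] one_less unfolding test_def by (simp add: m0_def)
qed

lemma writes_test: "writes (test b w) = {''q'', ''len'', ''i'', ''ans''}"
  by (auto simp: test_def)

end

section \<open>Finding and settling the next vertex\<close>

context phase
begin

definition candidate :: "memory \<Rightarrow> nat \<Rightarrow> nat \<Rightarrow> bool" where
  "candidate m u j \<longleftrightarrow> u < n \<and> u \<notin> finals m \<and> j \<in> E u \<and> j \<in> finals m"

abbreviation "arc_val m u j \<equiv> W u j + m ''val'' j"

text \<open>Everything refers to the memory \<open>m\<close> before the scan. The first part makes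
  the stored vertex and threshold a legitimate choice; the second becomes minimality over all arcs
  at \<open>k = n * n\<close>.\<close>

definition search_inv :: "memory \<Rightarrow> nat \<Rightarrow> memory \<Rightarrow> bool" where
  "search_inv m k m' \<longleftrightarrow>
     (m' ''best'' 0 \<noteq> 0 \<longrightarrow> (\<exists>j. candidate m (m' ''bu'' 0) j \<and> m' ''bth'' 0 = arc_val m (m' ''bu'' 0) j) \<and>
        big (m' ''bu'' 0) (below m (m' ''bu'' 0) (m' ''bth'' 0))) \<and>
     (\<forall>u j. candidate m u j \<longrightarrow> u * n + j < k \<longrightarrow> big u (below m u (arc_val m u j)) \<longrightarrow>
        m' ''best'' 0 \<noteq> 0 \<and> m' ''bth'' 0 \<le> arc_val m u j)"

lemma search_inv_cong:
  assumes "m'' ''best'' 0 = m' ''best'' 0" "m'' ''bu'' 0 = m' ''bu'' 0" "m'' ''bth'' 0 = m' ''bth'' 0"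
  shows "search_inv m k m'' \<longleftrightarrow> search_inv m k m'"
  using assms by (simp add: search_inv_def)

lemma search_inv_skip:
  assumes "search_inv m k m'"
    and "candidate m (k div n) (k mod n) \<Longrightarrow>
      big (k div n) (below m (k div n) (arc_val m (k div n) (k mod n))) \<Longrightarrow>
      m' ''best'' 0 \<noteq> 0 \<and> m' ''bth'' 0 \<le> arc_val m (k div n) (k mod n)"
  shows "search_inv m (Suc k) m'"
  unfolding search_inv_def
proof (intro conjI allI impI)
  fix u j assume c: "candidate m u j" "u * n + j < Suc k" "big u (below m u (arc_val m u j))"
  have "u < n" "j < n" using c(1) by (auto simp: candidate_def finals_def)
  note uj = div_mod_index[OF this]
  have "m' ''best'' 0 \<noteq> 0 \<and> m' ''bth'' 0 \<le> arc_val m u j"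
  proof (cases "u * n + j = k")
    case True
    with uj have "k div n = u" "k mod n = j" by auto
    with assms(2) c show ?thesis by simp
  next
    case False
    with c assms(1) show ?thesis by (simp add: search_inv_def)
  qed
  then show "m' ''best'' 0 \<noteq> 0" "m' ''bth'' 0 \<le> arc_val m u j" by simp_all
qed (use assms(1) in \<open>auto simp: search_inv_def\<close>)

lemma search_inv_take:
  assumes inv: "search_inv m k m'"
    and c: "candidate m (k div n) (k mod n)"
      "big (k div n) (below m (k div n) (arc_val m (k div n) (k mod n)))"
    and better: "m' ''best'' 0 = 0 \<or> arc_val m (k div n) (k mod n) < m' ''bth'' 0"
    and m'': "m'' ''best'' 0 = 1" "m'' ''bu'' 0 = k div n" "m'' ''bth'' 0 = arc_val m (k div n) (k mod n)"
  shows "search_inv m (Suc k) m''"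
proof (rule search_inv_skip)
  show "search_inv m k m''"
    unfolding search_inv_def m''
  proof (intro conjI allI impI)
    show "\<exists>j. candidate m (k div n) j \<and> arc_val m (k div n) (k mod n) = arc_val m (k div n) j"
      using c(1) by blast
    show "big (k div n) (below m (k div n) (arc_val m (k div n) (k mod n)))" by (rule c(2))
    fix u j assume "candidate m u j" "u * n + j < k" "big u (below m u (arc_val m u j))"
    then have "m' ''best'' 0 \<noteq> 0 \<and> m' ''bth'' 0 \<le> arc_val m u j"
      using inv by (simp add: search_inv_def)
    then show "arc_val m (k div n) (k mod n) \<le> arc_val m u j" using better by auto
  qed simp
qed (simp add: m'')

lemma wp_search:
  assumes env: "env m" and tF: "t \<in> finals m" and bound: "\<And>i. i \<in> finals m \<Longrightarrow> m ''val'' i + Wm < 2 ^ K"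
  shows "wp (search b w) (search_inv m (n * n)) m"
proof -
  define X where "X = {''best'', ''k'', ''u'', ''j'', ''th'', ''q'', ''len'', ''i'', ''ans'', ''bu'', ''bth''}"
  define m0 where "m0 = m(''best'' := (m ''best'')(0 := 0))"
  define take where "take = Then (Set ''best'' (Lit 0) (Lit 1))
     (Then (Set ''bu'' (Lit 0) (var ''u'')) (Set ''bth'' (Lit 0) (var ''th'')))"
  define attempt where "attempt = Then (test b w)
     (Branch (if b then Minus (Lit 1) (var ''ans'') else var ''ans'') take Nop)"
  define cmp where "cmp = Branch (Plus (Minus (Lit 1) (var ''best'')) (Minus (var ''bth'') (var ''th''))) attempt Nop"
  define cond where "cond = Times (Cell ''arc'' (var ''k''))
     (Times (Minus (Lit 1) (Cell ''fin'' (var ''u''))) (Cell ''fin'' (var ''j'')))"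
  define body where "body =
     Then (Set ''u'' (Lit 0) (Div (var ''k'') (var ''n'')))
       (Then (Set ''j'' (Lit 0) (Minus (var ''k'') (Times (var ''u'') (var ''n''))))
       (Branch cond (Then (Set ''th'' (Lit 0) (Plus (Cell w (var ''k'')) (Cell ''val'' (var ''j'')))) cmp) Nop))"
  have writes: "insert ''k'' (writes body) \<subseteq> X"
    by (auto simp: body_def cmp_def attempt_def take_def writes_test X_def)
  have "wp (For ''k'' (Times (var ''n'') (var ''n'')) body) (search_inv m (n * n)) m0"
  proof (rule wp_For[where J = "search_inv m"])
    show "val (Times (var ''n'') (var ''n'')) m0 = n * n"
      using env_simps(1)[OF env] by (simp add: m0_def)
    show "n * n \<le> N" by (rule n_sq)
    show "search_inv m 0 (m0(''k'' := (m0 ''k'')(0 := 0)))" by (simp add: search_inv_def m0_def)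
  next
    fix k m' assume k: "k < n * n" and inv: "search_inv m k m'" and mk: "m' ''k'' 0 = k"
      and "agree (insert ''k'' (writes body)) m0 m'"
    then have "agree X m0 m'" using writes agree_mono by blast
    then have ag: "agree X m m'" by (auto simp: agree_def m0_def X_def)
    let ?u = "k div n" and ?j = "k mod n"
    let ?Q = "\<lambda>m''. search_inv m (Suc k) (m''(''k'' := (m'' ''k'')(0 := Suc k)))"
    have Q: "?Q m'' \<longleftrightarrow> search_inv m (Suc k) m''" for m''
      by (rule search_inv_cong) simp_all
    have u: "?u < n" and j: "?j < n" using k n_pos by (auto simp: less_mult_imp_div_less)
    have uj: "?u * n + ?j = k" by simp
    define m1 where "m1 = m'(''u'' := (m' ''u'')(0 := ?u), ''j'' := (m' ''j'')(0 := ?j))"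
    have same: "m' ''fin'' = m ''fin''" "m' ''val'' = m ''val''"
      using ag by (auto simp: X_def intro: agreeD)
    have env': "env m'" by (rule env_agree[OF env ag]) (simp add: X_def)
    have inv1: "search_inv m k m1" using inv by (subst search_inv_cong) (simp_all add: m1_def)
    have "wp (Branch cond (Then (Set ''th'' (Lit 0) (Plus (Cell w (var ''k'')) (Cell ''val'' (var ''j'')))) cmp) Nop) ?Q m1"
    proof (cases "candidate m ?u ?j")
      case False
      have "val cond m1 = 0"
        using False env_simps(4)[OF env' u j, unfolded uj] u j mk same
        by (auto simp: cond_def m1_def candidate_def finals_def)
      moreover have "search_inv m (Suc k) m1"
        using False by (intro search_inv_skip[OF inv1]) simp
      ultimately show ?thesis using Q by simp
    next
      case True
      then have cand: "?j \<in> E ?u" "?j \<in> finals m" "?u \<notin> finals m" by (auto simp: candidate_def)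
      have "val cond m1 \<noteq> 0"
        using cand env_simps(4)[OF env' u j, unfolded uj] u j mk same
        by (auto simp: cond_def m1_def finals_def)
      let ?f = "arc_val m ?u ?j"
      have f: "?f < 2 ^ K" using W_le[OF u cand(1)] bound[OF cand(2)] by linarith
      have wk: "m' w k = W ?u ?j" using env_simps(5)[OF env' u cand(1)] by (simp add: uj)
      define m2 where "m2 = m1(''th'' := (m1 ''th'')(0 := ?f))"
      have inv2: "search_inv m k m2" using inv1 by (subst search_inv_cong) (simp_all add: m2_def)
      have "wp cmp ?Q m2"
      proof (cases "m2 ''best'' 0 = 0 \<or> ?f < m2 ''bth'' 0")
        case False
        then have "val (Plus (Minus (Lit 1) (var ''best'')) (Minus (var ''bth'') (var ''th''))) m2 = 0"
          by (simp add: m2_def)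
        moreover have "search_inv m (Suc k) m2"
          using False by (intro search_inv_skip[OF inv2]) simp
        ultimately show ?thesis using Q by (simp add: cmp_def)
      next
        case better: True
        then have c2: "val (Plus (Minus (Lit 1) (var ''best'')) (Minus (var ''bth'') (var ''th''))) m2 \<noteq> 0"
          by (auto simp: m2_def)
        have "agree X m m2" using ag by (auto simp: agree_def m2_def m1_def X_def)
        then have env2: "env m2" by (rule env_agree[OF env]) (simp add: X_def)
        \<comment> \<open>Correct answers are guaranteed for vertices other than the target only;
          the target is settled, whereas \<open>?u\<close> is not.\<close>
        have ut: "?u \<noteq> t" using cand(3) tF by auto
        have m2: "m2 ''u'' 0 = ?u" "m2 ''th'' 0 = ?f" "m2 ''fin'' = m ''fin''" "m2 ''val'' = m ''val''"
          using same by (simp_all add: m2_def m1_def)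
        have "wp (test b w) (\<lambda>m3. m3 ''ans'' 0 \<noteq> 0 \<longleftrightarrow> big ?u (below m ?u ?f) \<noteq> b) m2"
          using wp_test[OF env2 m2(1) u ut] m2(2) below_cong[OF m2(3,4)] by simp
        then have "wp (test b w) (wp (Branch (if b then Minus (Lit 1) (var ''ans'') else var ''ans'') take Nop) ?Q) m2"
        proof (rule wp_conseq)
          fix m3 assume ans: "m3 ''ans'' 0 \<noteq> 0 \<longleftrightarrow> big ?u (below m ?u ?f) \<noteq> b"
            and "agree (writes (test b w)) m2 m3"
          then have a3: "m3 ''best'' = m2 ''best''" "m3 ''bu'' = m2 ''bu''" "m3 ''bth'' = m2 ''bth''"
            "m3 ''u'' = m2 ''u''" "m3 ''th'' = m2 ''th''"
            by (simp_all add: writes_test agree_def)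
          have inv3: "search_inv m k m3" using inv2 a3 by (subst search_inv_cong) simp_all
          show "wp (Branch (if b then Minus (Lit 1) (var ''ans'') else var ''ans'') take Nop) ?Q m3"
          proof (cases "big ?u (below m ?u ?f)")
            case big: True
            then have "val (if b then Minus (Lit 1) (var ''ans'') else var ''ans'') m3 \<noteq> 0"
              using ans by (cases b) simp_all
            moreover have "wp take ?Q m3"
            proof -
              define m4 where "m4 = m3(''best'' := (m3 ''best'')(0 := 1), ''bu'' := (m3 ''bu'')(0 := ?u),
                ''bth'' := (m3 ''bth'')(0 := ?f))"
              have "search_inv m (Suc k) m4"
                using better a3 by (intro search_inv_take[OF inv3 True big]) (simp_all add: m4_def)
              then show ?thesis
                unfolding take_def wp.simps Q
                using one_less f less_K[of ?u] u a3 m2 by (simp add: m4_def)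
            qed
            ultimately show ?thesis by (simp del: wp.simps(1-3))
          next
            case False
            then have "val (if b then Minus (Lit 1) (var ''ans'') else var ''ans'') m3 = 0"
              using ans by (cases b) simp_all
            moreover have "search_inv m (Suc k) m3"
              using False by (intro search_inv_skip[OF inv3]) simp
            ultimately show ?thesis using Q by simp
          qed
        qed
        then show ?thesis using c2 unfolding cmp_def attempt_def by (simp del: val.simps)
      qed
      then have "wp (Then (Set ''th'' (Lit 0) (Plus (Cell w (var ''k'')) (Cell ''val'' (var ''j'')))) cmp) ?Q m1"
        unfolding wp.simps using f wk mk same by (simp add: m2_def m1_def)
      then show ?thesis using \<open>val cond m1 \<noteq> 0\<close> by simp
    qed
    then show "wp body ?Q m'"
      unfolding body_def wp.simps(2,3)
      using mk env_simps(1)[OF env'] less_K[of ?u] less_K[of ?j] u j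
      by (simp add: m1_def minus_div_mult_eq_mod del: wp.simps)
  qed assumption
  then show ?thesis
    using one_less unfolding search_def
    by (simp add: m0_def body_def cond_def cmp_def attempt_def take_def)
qed

lemma wp_update:
  assumes env: "env m" and u: "m ''bu'' 0 = u" "u < n" "u \<notin> finals m" and c: "m ''bth'' 0 < 2 ^ K"
    and ne: "below m u (m ''bth'' 0) \<noteq> {}"
    and bound: "\<And>i. i \<in> finals m \<Longrightarrow> m ''dist'' i + Wm < 2 ^ K"
  shows "wp (update w w') (\<lambda>m'. \<exists>x\<in>below m u (m ''bth'' 0).
     (\<forall>i\<in>below m u (m ''bth'' 0). W' u x + m ''dist'' x \<le> W' u i + m ''dist'' i) \<and>
     m' ''fin'' = (m ''fin'')(u := 1) \<and> m' ''val'' = (m ''val'')(u := m ''bth'' 0) \<and>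
     m' ''dist'' = (m ''dist'')(u := W' u x + m ''dist'' x) \<and> m' ''next'' = (m ''next'')(u := x)) m"
    (is "wp _ ?Q m")
proof -
  let ?L = "below m u (m ''bth'' 0)"
  let ?f = "\<lambda>i. W' u i + m ''dist'' i"
  define J where "J = (\<lambda>i (m' :: memory). (m' ''g'' 0 \<noteq> 0 \<longrightarrow> m' ''gi'' 0 \<in> ?L \<and> m' ''gd'' 0 = ?f (m' ''gi'' 0)) \<and>
     (\<forall>i'\<in>?L. i' < i \<longrightarrow> m' ''g'' 0 \<noteq> 0 \<and> m' ''gd'' 0 \<le> ?f i'))"
  define X where "X = {''i'', ''g'', ''gd'', ''gi''}"
  define m0 where "m0 = m(''g'' := (m ''g'')(0 := 0))"
  define fe where "fe = Plus (entry w' (var ''bu'') (var ''i'')) (Cell ''dist'' (var ''i''))"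
  define cond where "cond = Times (near w (var ''bu'') (var ''i'') (var ''bth''))
           (Plus (Minus (Lit 1) (var ''g'')) (Minus (var ''gd'') fe))"
  define body where "body = Branch cond (Then (Set ''gd'' (Lit 0) fe)
         (Then (Set ''gi'' (Lit 0) (var ''i'')) (Set ''g'' (Lit 0) (Lit 1)))) Nop"
  define rest where "rest = Then (Set ''fin'' (var ''bu'') (Lit 1))
    (Then (Set ''val'' (var ''bu'') (var ''bth''))
    (Then (Set ''dist'' (var ''bu'') (var ''gd'')) (Set ''next'' (var ''bu'') (var ''gi''))))"
  have L: "i < n" "i \<in> E u" "i \<in> finals m" if "i \<in> ?L" for i
    using that by (auto simp: below_iff finals_def)
  have f_less: "?f i < 2 ^ K" if "i \<in> ?L" for i
    using W'_le[OF u(2) L(2)[OF that]] bound[OF L(3)[OF that]] by linarith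
  have writes: "insert ''i'' (writes body) = X" by (auto simp: body_def X_def)
  have "wp (For ''i'' (var ''n'') body) (wp rest ?Q) m0"
  proof (rule wp_For[where J = J])
    show "val (var ''n'') m0 = n" using env_simps(1)[OF env] by (simp add: m0_def)
    show "n \<le> N" by (rule n_le)
    show "J 0 (m0(''i'' := (m0 ''i'')(0 := 0)))" by (simp add: J_def m0_def)
  next
    fix i m' assume i: "i < n" and inv: "J i m'" and mi: "m' ''i'' 0 = i"
      and "agree (insert ''i'' (writes body)) m0 m'"
    then have ag: "agree X m m'" unfolding writes by (auto simp: agree_def m0_def X_def)
    have env': "env m'" by (rule env_agree[OF env ag]) (simp add: X_def)
    have same: "m' ''fin'' = m ''fin''" "m' ''val'' = m ''val''" "m' ''dist'' = m ''dist''"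
      "m' ''bu'' = m ''bu''" "m' ''bth'' = m ''bth''"
      using ag by (auto simp: X_def intro: agreeD)
    let ?Q' = "\<lambda>m''. J (Suc i) (m''(''i'' := (m'' ''i'')(0 := Suc i)))"
    have Q: "?Q' m'' \<longleftrightarrow> J (Suc i) m''" for m'' by (simp add: J_def)
    have nr: "val (near w (var ''bu'') (var ''i'') (var ''bth'')) m' = 0 \<longleftrightarrow> i \<notin> ?L"
      using val_near[OF env', of "var ''bu''" "var ''i''" "var ''bth''"] i mi u same below_cong[OF same(1,2)]
      by simp
    have fe: "val fe m' = ?f i" if "i \<in> ?L"
      using env_simps(6)[OF env' u(2) L(2)[OF that]] env_simps(1)[OF env'] mi u(1) same by (simp add: fe_def)
    show "wp body ?Q' m'"
    proof (cases "i \<in> ?L \<and> (m' ''g'' 0 = 0 \<or> ?f i < m' ''gd'' 0)")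
      case True
      define m1 where "m1 = m'(''gd'' := (m' ''gd'')(0 := ?f i), ''gi'' := (m' ''gi'')(0 := i), ''g'' := (m' ''g'')(0 := 1))"
      have "val cond m' \<noteq> 0" using True nr fe by (auto simp: cond_def)
      moreover have "J (Suc i) m1"
        using inv True by (fastforce simp: J_def m1_def less_Suc_eq)
      ultimately show ?thesis
        unfolding body_def wp.simps Q
        using f_less[of i] True fe less_K[of i] i one_less mi by (simp add: m1_def)
    next
      case False
      then have "val cond m' = 0" using nr fe by (auto simp: cond_def)
      moreover have "J (Suc i) m'"
        using inv False by (fastforce simp: J_def less_Suc_eq)
      ultimately show ?thesis unfolding body_def wp.simps Q by simp
    qed
  next
    fix m' assume J: "J n m'" and "agree (insert ''i'' (writes body)) m0 m'"
    then have ag: "agree X m m'" unfolding writes by (auto simp: agree_def m0_def X_def)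
    have same: "m' ''fin'' = m ''fin''" "m' ''val'' = m ''val''" "m' ''dist'' = m ''dist''"
      "m' ''bu'' = m ''bu''" "m' ''bth'' = m ''bth''" "m' ''next'' = m ''next''"
      using ag by (auto simp: X_def intro: agreeD)
    \<comment> \<open>A head within the bound exists, and scanning it has raised the flag.\<close>
    have g: "m' ''g'' 0 \<noteq> 0" and min: "\<forall>i\<in>?L. m' ''gd'' 0 \<le> ?f i"
      using J ne L(1) by (auto simp: J_def)
    then have x: "m' ''gi'' 0 \<in> ?L" "m' ''gd'' 0 = ?f (m' ''gi'' 0)" using J by (auto simp: J_def)
    show "wp rest ?Q m'"
      unfolding rest_def wp.simps
      using one_less c f_less[OF x(1)] less_K[of "m' ''gi'' 0"] L(1)[OF x(1)] x min same u(1)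
      by (auto intro!: bexI[OF _ x(1)])
  qed
  then show ?thesis
    using one_less unfolding update_def
    by (simp add: m0_def body_def cond_def fe_def rest_def del: wp.simps(1))
qed

end

text \<open>Marking the tails stores the whole path, as the arc leaving a marked \<open>u\<close>
  goes to \<open>next u\<close>. Nothing is marked when the source is unsettled, and
  \<open>n\<close> rounds suffice because the path repeats no vertex.\<close>

definition trace :: stm where
  "trace =
     Then (For ''i'' (var ''n'') (Set ''mark'' (var ''i'') (Lit 0)))
    (Then (Set ''x'' (Lit 0) (var ''s''))
      (For ''i'' (var ''n'')
        (Branch (Times (Cell ''fin'' (var ''x''))
            (Plus (Minus (var ''x'') (var ''t'')) (Minus (var ''t'') (var ''x''))))
          (Then (Set ''mark'' (var ''x'') (Lit 1)) (Set ''x'' (Lit 0) (Cell ''next'' (var ''x''))))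
          Nop)))"

definition set_bit :: "string \<Rightarrow> expr \<Rightarrow> expr \<Rightarrow> stm" where
  "set_bit a i e = Branch e (Set a i (Lit 1)) (Set a i (Lit 0))"

definition safe_expr :: "string \<Rightarrow> expr" where
  "safe_expr w = Times (Cell ''arc'' (var ''k''))
     (Plus (Minus (Lit 1) (Cell ''fin'' (var ''u'')))
       (near w (var ''u'') (var ''j'') (Cell ''val'' (var ''u''))))"

text \<open>The first summand negates that the head is settled while the tail is unsettled or
  undercut. In the second, both truncated differences vanish iff \<open>j\<close> is the successor
  of \<open>u\<close>, which for a marked \<open>u\<close> means that the arc is on the
  path.\<close>

definition guard_expr :: "string \<Rightarrow> expr" where
  "guard_expr w = Times (Cell ''arc'' (var ''k''))
     (Plus
       (Minus (Lit 1) (Times (Cell ''fin'' (var ''j''))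
         (Plus (Minus (Lit 1) (Cell ''fin'' (var ''u'')))
           (Minus (Cell ''val'' (var ''u'')) (Plus (Cell w (var ''k'')) (Cell ''val'' (var ''j'')))))))
       (Times (Cell ''mark'' (var ''u''))
         (Minus (Lit 1) (Plus (Minus (var ''j'') (Cell ''next'' (var ''u'')))
           (Minus (Cell ''next'' (var ''u'')) (var ''j''))))))"

definition emit :: "string \<Rightarrow> stm" where
  "emit w =
     For ''k'' (Times (var ''n'') (var ''n''))
       (Then (Set ''u'' (Lit 0) (Div (var ''k'') (var ''n'')))
       (Then (Set ''j'' (Lit 0) (Minus (var ''k'') (Times (var ''u'') (var ''n''))))
       (Then (set_bit ''A'' (var ''k'') (safe_expr w)) (set_bit ''B'' (var ''k'') (guard_expr w)))))"

definition solve :: "bool \<Rightarrow> string \<Rightarrow> string \<Rightarrow> stm" where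
  "solve b w w' = Then (dijkstra b w w') (Then trace (emit w))"

section \<open>Correctness of a complete run\<close>

context phase
begin

lemma below_heads_le: "below m u (arc_val m u j) = heads_le E R (finals m) (vals m) u (R u j + vals m j)"
  by (simp add: below_def)

lemma finals_cong: "m' ''fin'' = m ''fin'' \<Longrightarrow> finals m' = finals m"
  by (simp add: finals_def)

text \<open>Either nothing more can be settled, or every round has settled a vertex; as
  \<open>t\<close> is settled from the start, there are then more than \<open>r\<close> of them
  after \<open>r\<close> rounds. Values and distances grow by at most \<open>Wm\<close> per
  round.\<close>

definition round_inv :: "nat \<Rightarrow> memory \<Rightarrow> bool" where
  "round_inv r m \<longleftrightarrow>
     dijkstra_inv {..<n} E big R R' t (finals m) (vals m) (dists m) (m ''next'') \<and>
     (\<forall>i\<in>finals m. m ''val'' i \<le> r * Wm \<and> m ''dist'' i \<le> r * Wm) \<and>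
     ((\<forall>u\<in>{..<n} - finals m. \<not> big u (E u \<inter> finals m)) \<or> r < card (finals m))"

lemma round_inv_cong:
  assumes "m' ''fin'' = m ''fin''" "m' ''val'' = m ''val''" "m' ''dist'' = m ''dist''" "m' ''next'' = m ''next''"
  shows "round_inv r m' \<longleftrightarrow> round_inv r m"
  unfolding round_inv_def finals_cong[of m' m, OF assms(1)] assms ..

lemma candidate_big:
  assumes "candidate m u j" "t \<in> finals m" "big u (below m u (arc_val m u j))"
  shows "big u (E u \<inter> finals m)"
proof -
  have "below m u (arc_val m u j) \<subseteq> E u \<inter> finals m" by (auto simp: below_iff finals_def)
  moreover have "u \<in> {..<n} - {t}" using assms(1,2) by (auto simp: candidate_def)
  ultimately show ?thesis using M_mono assms(3) by blast
qed

lemma round_inv_update: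
  assumes inv: "round_inv r m" and r: "r < n"
    and best: "search_inv m (n * n) m1" "m1 ''best'' 0 \<noteq> 0"
    and uc: "m1 ''bu'' 0 = u" "m1 ''bth'' 0 = c"
    and x: "x \<in> below m u c" "\<And>i. i \<in> below m u c \<Longrightarrow> W' u x + m ''dist'' x \<le> W' u i + m ''dist'' i"
    and m': "m' ''fin'' = (m ''fin'')(u := 1)" "m' ''val'' = (m ''val'')(u := c)"
      "m' ''dist'' = (m ''dist'')(u := W' u x + m ''dist'' x)" "m' ''next'' = (m ''next'')(u := x)"
  shows "round_inv (Suc r) m'"
proof -
  have dinv: "dijkstra_inv {..<n} E big R R' t (finals m) (vals m) (dists m) (m ''next'')"
    and bound: "\<forall>i\<in>finals m. m ''val'' i \<le> r * Wm \<and> m ''dist'' i \<le> r * Wm"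
    using inv by (simp_all add: round_inv_def)
  have tF: "t \<in> finals m" using dinv by (simp add: dijkstra_inv_def settled_def)
  obtain j where j: "candidate m u j" "c = arc_val m u j" and big: "big u (below m u c)"
    using best uc by (auto simp: search_inv_def)
  have u: "u < n" "u \<notin> finals m" using j(1) by (auto simp: candidate_def)
  have fin': "finals m' = insert u (finals m)"
    using u(1) by (auto simp: finals_def m')
  have vals': "vals m' = (vals m)(u := real c)" by (auto simp: m')
  have dists': "dists m' = (dists m)(u := R' u x + dists m x)" by (auto simp: m')
  \<comment> \<open>A winning strict set would give, by \<open>threshold_less\<close>, an arc that
    the search has scanned and whose winning threshold beats \<open>c\<close>.\<close>
  have least: "\<not> big y (heads_less E R (finals m) (vals m) y (real c))" if y: "y \<in> {..<n} - finals m" for y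
  proof
    assume "big y (heads_less E R (finals m) (vals m) y (real c))"
    moreover have "y \<in> {..<n} - {t}" using y tF by auto
    ultimately obtain z where z: "z \<in> E y" "z \<in> finals m" "R y z + vals m z < real c"
      "big y (heads_le E R (finals m) (vals m) y (R y z + vals m z))"
      by (metis threshold_less)
    then have "big y (below m y (arc_val m y z))" by (simp add: below_heads_le)
    moreover have "candidate m y z" using y z by (simp add: candidate_def)
    moreover have "y * n + z < n * n" using y z(2) div_mod_index(3)[of y n z] by (simp add: finals_def)
    ultimately have "c \<le> arc_val m y z" using best(1) uc(2) by (simp add: search_inv_def)
    with z(3) show False by simp
  qed
  have "dijkstra_inv {..<n} E big R R' t (finals m') (vals m') (dists m') (m' ''next'')"
    unfolding fin' vals' dists' m'(4)
  proof (rule dijkstra_step[OF dinv _ _ least])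
    show "u \<in> {..<n} - finals m" using u by simp
    show "big u (heads_le E R (finals m) (vals m) u (real c))" using big by (simp add: below_def)
    show "x \<in> heads_le E R (finals m) (vals m) u (real c)" using x(1) by (simp add: below_def)
    show "R' u x + dists m x \<le> R' u i + dists m i"
      if "i \<in> heads_le E R (finals m) (vals m) u (real c)" for i
      using x(2)[of i] that by (simp add: below_def flip: of_nat_add)
  qed
  moreover have "m' ''val'' i \<le> Suc r * Wm \<and> m' ''dist'' i \<le> Suc r * Wm" if "i \<in> finals m'" for i
  proof (cases "i = u")
    case False
    then show ?thesis using that bound by (auto simp: fin' m' intro: le_trans)
  next
    case True
    have "j \<in> E u" "j \<in> finals m" "x \<in> E u" "x \<in> finals m"
      using j(1) x(1) by (auto simp: candidate_def below_iff finals_def)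
    then have "W u j \<le> Wm" "W' u x \<le> Wm" "m ''val'' j \<le> r * Wm" "m ''dist'' x \<le> r * Wm"
      using W_le W'_le u(1) bound by auto
    then show ?thesis using True j(2) by (auto simp: m')
  qed
  moreover have "Suc r < card (finals m')"
  proof -
    have "big u (E u \<inter> finals m)" using candidate_big[OF j(1) tF] big j(2) by simp
    then have "r < card (finals m)" using inv u unfolding round_inv_def by auto
    moreover have "finite (finals m)" by (simp add: finals_def)
    ultimately show ?thesis using u(2) by (simp add: fin')
  qed
  ultimately show ?thesis by (simp add: round_inv_def)
qed

lemma round_inv_stop:
  assumes inv: "round_inv r m" and best: "search_inv m (n * n) m1" "m1 ''best'' 0 = 0"
  shows "round_inv (Suc r) m"
proof -
  have tF: "t \<in> finals m" using inv by (simp add: round_inv_def dijkstra_inv_def settled_def)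
  have "\<not> big u (E u \<inter> finals m)" if u: "u \<in> {..<n} - finals m" for u
  proof
    assume "big u (E u \<inter> finals m)"
    moreover have "u \<in> {..<n} - {t}" using u tF by auto
    ultimately obtain z where z: "z \<in> E u" "z \<in> finals m"
      "big u (heads_le E R (finals m) (vals m) u (R u z + vals m z))"
      by (metis threshold_le)
    then have "big u (below m u (arc_val m u z))" by (simp add: below_heads_le)
    moreover have "candidate m u z" using u z by (simp add: candidate_def)
    moreover have "u * n + z < n * n" using u z(2) div_mod_index(3)[of u n z] by (simp add: finals_def)
    ultimately show False using best by (simp add: search_inv_def)
  qed
  moreover have "\<forall>i\<in>finals m. m ''val'' i \<le> Suc r * Wm \<and> m ''dist'' i \<le> Suc r * Wm"
    using inv by (auto simp: round_inv_def intro: le_trans)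
  ultimately show ?thesis using inv by (simp add: round_inv_def)
qed

lemma wp_round:
  assumes env: "env m" and inv: "round_inv r m" and r: "r < n"
  shows "wp (Then (search b w) (Branch (var ''best'') (update w w') Nop)) (round_inv (Suc r)) m"
proof -
  have bound: "\<forall>i\<in>finals m. m ''val'' i \<le> r * Wm \<and> m ''dist'' i \<le> r * Wm"
    and tF: "t \<in> finals m"
    using inv by (simp_all add: round_inv_def dijkstra_inv_def settled_def)
  have less: "a + Wm < 2 ^ K" if "a \<le> r * Wm" for a
  proof -
    have "a + Wm \<le> Suc r * Wm" using that by simp
    also have "\<dots> \<le> (n + 1) * Wm" using r by (intro mult_le_mono1) simp
    finally show ?thesis using Wm by simp
  qed
  have "wp (search b w) (search_inv m (n * n)) m"
    using bound less by (intro wp_search[OF env tF]) simp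
  then have "wp (search b w) (wp (Branch (var ''best'') (update w w') Nop) (round_inv (Suc r))) m"
  proof (rule wp_conseq)
    fix m1 assume s1: "search_inv m (n * n) m1" and ag: "agree (writes (search b w)) m m1"
    have wr: "writes (search b w) \<inter>
      {''n'', ''s'', ''t'', ''arc'', ''w1'', ''w2'', ''fin'', ''val'', ''dist'', ''next''} = {}"
      by (simp add: search_def writes_test)
    have same: "m1 ''fin'' = m ''fin''" "m1 ''val'' = m ''val''" "m1 ''dist'' = m ''dist''" "m1 ''next'' = m ''next''"
      using wr by (auto intro: agreeD[OF ag])
    have env1: "env m1" by (rule env_agree[OF env ag]) (use wr in auto)
    show "wp (Branch (var ''best'') (update w w') Nop) (round_inv (Suc r)) m1"
    proof (cases "m1 ''best'' 0 = 0")
      case True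
      then have "round_inv (Suc r) m1"
        using round_inv_stop[OF inv s1] round_inv_cong[OF same] by simp
      then show ?thesis using True by simp
    next
      case False
      let ?u = "m1 ''bu'' 0" and ?c = "m1 ''bth'' 0"
      obtain j where j: "candidate m ?u j" "?c = arc_val m ?u j" and big: "big ?u (below m ?u ?c)"
        using s1 False by (auto simp: search_inv_def)
      have u: "?u < n" "?u \<notin> finals m" "j \<in> E ?u" "j \<in> finals m" using j(1) by (auto simp: candidate_def)
      have "?c < 2 ^ K" using less[of "m ''val'' j"] bound u(4) W_le[OF u(1,3)] j(2) by fastforce
      moreover have "below m1 ?u ?c \<noteq> {}"
      proof
        assume "below m1 ?u ?c = {}"
        then have "big ?u {}" using big below_cong[of m1 m, OF same(1,2)] by simp
        moreover have "?u \<in> {..<n} - {t}" using u(1,2) tF by auto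
        ultimately show False using M_empty by blast
      qed
      moreover have "m1 ''dist'' i + Wm < 2 ^ K" if "i \<in> finals m1" for i
        using that less bound finals_cong[of m1 m, OF same(1)] same(3) by simp
      moreover have "?u \<notin> finals m1" using u(2) finals_cong[of m1 m, OF same(1)] by simp
      ultimately have "wp (update w w') (\<lambda>m'. \<exists>x\<in>below m1 ?u ?c.
         (\<forall>i\<in>below m1 ?u ?c. W' ?u x + m1 ''dist'' x \<le> W' ?u i + m1 ''dist'' i) \<and>
         m' ''fin'' = (m1 ''fin'')(?u := 1) \<and> m' ''val'' = (m1 ''val'')(?u := ?c) \<and>
         m' ''dist'' = (m1 ''dist'')(?u := W' ?u x + m1 ''dist'' x) \<and> m' ''next'' = (m1 ''next'')(?u := x)) m1"
        by (intro wp_update[OF env1 refl u(1)])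
      then have "wp (update w w') (round_inv (Suc r)) m1"
      proof (rule wp_conseq, elim bexE conjE)
        fix m' x assume "x \<in> below m1 ?u ?c"
          "\<forall>i\<in>below m1 ?u ?c. W' ?u x + m1 ''dist'' x \<le> W' ?u i + m1 ''dist'' i"
          "m' ''fin'' = (m1 ''fin'')(?u := 1)" "m' ''val'' = (m1 ''val'')(?u := ?c)"
          "m' ''dist'' = (m1 ''dist'')(?u := W' ?u x + m1 ''dist'' x)" "m' ''next'' = (m1 ''next'')(?u := x)"
        then show "round_inv (Suc r) m'"
          unfolding same below_cong[OF same(1,2)]
          by (intro round_inv_update[OF inv r s1 False refl refl, of x m']) simp_all
      qed
      then show ?thesis using False by simp
    qed
  qed
  then show ?thesis by simp
qed

lemma writes_dijkstra: "writes (dijkstra b w w') = {''i'', ''fin'', ''val'', ''dist'', ''r'', ''best'', ''k'',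
  ''u'', ''j'', ''th'', ''q'', ''len'', ''ans'', ''bu'', ''bth'', ''g'', ''gd'', ''gi'', ''next''}"
  by (auto simp: dijkstra_def search_def writes_test update_def)

lemma wp_dijkstra:
  assumes env: "env m"
  shows "wp (dijkstra b w w')
    (\<lambda>m'. certificate {..<n} E big R R' t (finals m') (vals m') (dists m') (m' ''next'')) m"
proof -
  let ?C = "\<lambda>m'. certificate {..<n} E big R R' t (finals m') (vals m') (dists m') (m' ''next'')"
  let ?round = "Then (search b w) (Branch (var ''best'') (update w w') Nop)"
  have t: "t < n" using t_in by simp
  have rounds: "wp (For ''r'' (var ''n'') ?round) ?C m0" if env0: "env m0" and init: "round_inv 0 m0" for m0
  proof (rule wp_For[where J = round_inv])
    show "val (var ''n'') m0 = n" using env_simps(1)[OF env0] by simp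
    show "n \<le> N" by (rule n_le)
    show "round_inv 0 (m0(''r'' := (m0 ''r'')(0 := 0)))"
      using init by (subst round_inv_cong) simp_all
  next
    fix r m' assume r: "r < n" and inv: "round_inv r m'" and ag: "agree (insert ''r'' (writes ?round)) m0 m'"
    have env': "env m'"
      by (rule env_agree[OF env0 ag]) (simp add: search_def writes_test update_def)
    show "wp ?round (\<lambda>m''. round_inv (Suc r) (m''(''r'' := (m'' ''r'')(0 := Suc r)))) m'"
      by (rule wp_conseq[OF wp_round[OF env' inv r]]) (subst round_inv_cong; simp)
  next
    fix m' assume inv: "round_inv n m'"
    \<comment> \<open>This excludes more than \<open>n\<close> settled vertices, so after
      \<open>n\<close> rounds nothing more can be settled.\<close>
    have "card (finals m') \<le> card {..<n}" by (intro card_mono) (auto simp: finals_def)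
    then show "?C m'" using inv by (simp add: round_inv_def certificate_def dijkstra_inv_def)
  qed
  define rest where "rest = Then (Set ''fin'' (var ''t'') (Lit 1))
    (Then (Set ''val'' (var ''t'') (Lit 0)) (Then (Set ''dist'' (var ''t'') (Lit 0)) (For ''r'' (var ''n'') ?round)))"
  have "wp (For ''i'' (var ''n'') (Set ''fin'' (var ''i'') (Lit 0))) (wp rest ?C) m"
  proof (rule wp_For[where J = "\<lambda>i m'. \<forall>i'<i. m' ''fin'' i' = 0"])
    show "val (var ''n'') m = n" using env_simps(1)[OF env] by simp
    show "n \<le> N" by (rule n_le)
    fix m' assume fin: "\<forall>i'<n. m' ''fin'' i' = 0"
      and ag: "agree (insert ''i'' (writes (Set ''fin'' (var ''i'') (Lit 0)))) m m'"
    have env': "env m'" by (rule env_agree[OF env ag]) simp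
    define m1 where "m1 = m'(''fin'' := (m' ''fin'')(t := 1), ''val'' := (m' ''val'')(t := 0),
      ''dist'' := (m' ''dist'')(t := 0))"
    have env1: "env m1"
      by (rule env_agree[OF env', of "{''fin'', ''val'', ''dist''}"]) (simp_all add: agree_def m1_def)
    have F1: "finals m1 = {t}" using fin t by (auto simp: finals_def m1_def)
    have "round_inv 0 m1"
      unfolding round_inv_def F1 by (auto intro: dijkstra_init simp: m1_def)
    then have "wp (For ''r'' (var ''n'') ?round) ?C m1" using rounds env1 by blast
    then show "wp rest ?C m'"
      unfolding rest_def wp.simps(2,3)
      using env_simps(3)[OF env'] one_less by (simp add: m1_def del: wp.simps)
  qed (auto simp: less_Suc_eq)
  then show ?thesis
    unfolding dijkstra_def rest_def by (simp del: wp.simps(1,2,4))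
qed

lemma wp_trace:
  assumes env: "env m"
    and c: "certificate {..<n} E big R R' t (finals m) (vals m) (dists m) (m ''next'')"
  shows "wp trace (\<lambda>m'. \<exists>p. follows (finals m) t (m ''next'') p \<and>
    (if s \<in> finals m then walk s p t else p = []) \<and>
    (\<forall>u<n. m' ''mark'' u \<noteq> 0 \<longleftrightarrow> u \<in> fst ` set p)) m" (is "wp _ ?Q m")
proof -
  let ?F = "finals m" and ?nx = "m ''next''"
  have st: "settled E big R R' t ?F (vals m) (dists m) ?nx" using c by (simp add: certificate_def)
  have Fn: "?F \<subseteq> {..<n}" by (auto simp: finals_def)
  then have finF: "finite ?F" and cardF: "card ?F \<le> n"
    using finite_subset card_mono[OF _ Fn] by auto
  have pos: "0 < R u w" if "u \<in> ?F" "w \<in> E u" for u w using R_pos that Fn by blast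
  define body where "body = Branch (Times (Cell ''fin'' (var ''x''))
      (Plus (Minus (var ''x'') (var ''t'')) (Minus (var ''t'') (var ''x''))))
    (Then (Set ''mark'' (var ''x'') (Lit 1)) (Set ''x'' (Lit 0) (Cell ''next'' (var ''x'')))) Nop"
  define J where "J = (\<lambda>i (m' :: memory). \<exists>p. follows ?F t ?nx p \<and> walk s p (m' ''x'' 0) \<and> m' ''x'' 0 < n \<and>
    (m' ''x'' 0 \<in> ?F \<longleftrightarrow> s \<in> ?F) \<and> (s \<notin> ?F \<longrightarrow> p = []) \<and>
    (s \<in> ?F \<longrightarrow> m' ''x'' 0 = t \<or> length p = i) \<and> (\<forall>u<n. m' ''mark'' u \<noteq> 0 \<longleftrightarrow> u \<in> fst ` set p))"
  have J_cong: "J i (m'(''i'' := z)) \<longleftrightarrow> J i m'" for i m' z by (simp add: J_def)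
  have loop: "wp (For ''i'' (var ''n'') body) ?Q m0"
    if ag0: "agree {''i'', ''mark'', ''x''} m m0" and x: "m0 ''x'' 0 = s" and mark: "\<forall>i<n. m0 ''mark'' i = 0" for m0
  proof (rule wp_For[where J = J])
    have env0: "env m0" by (rule env_agree[OF env ag0]) simp
    show "val (var ''n'') m0 = n" using env_simps(1)[OF env0] by simp
    show "n \<le> N" by (rule n_le)
    show "J 0 (m0(''i'' := (m0 ''i'')(0 := 0)))"
      unfolding J_cong J_def using x mark s_less by (intro exI[of _ "[]"]) (simp add: follows_def)
  next
    fix i m' assume i: "i < n" and "J i m'" and "agree (insert ''i'' (writes body)) m0 m'"
    then have ag: "agree {''i'', ''mark'', ''x''} m m'" using ag0 by (auto simp: agree_def body_def)
    have env': "env m'" by (rule env_agree[OF env ag]) simp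
    have same: "m' ''fin'' = m ''fin''" "m' ''next'' = ?nx" using ag by (simp_all add: agree_def)
    let ?x = "m' ''x'' 0"
    obtain p where p: "follows ?F t ?nx p" "walk s p ?x" "?x < n" "?x \<in> ?F \<longleftrightarrow> s \<in> ?F" "s \<notin> ?F \<Longrightarrow> p = []"
      "s \<in> ?F \<Longrightarrow> ?x = t \<or> length p = i" "\<And>u. u < n \<Longrightarrow> m' ''mark'' u \<noteq> 0 \<longleftrightarrow> u \<in> fst ` set p"
      using \<open>J i m'\<close> unfolding J_def by blast
    let ?c = "Times (Cell ''fin'' (var ''x''))
      (Plus (Minus (var ''x'') (var ''t'')) (Minus (var ''t'') (var ''x'')))"
    have cond: "val ?c m' \<noteq> 0 \<longleftrightarrow> ?x \<in> ?F \<and> ?x \<noteq> t"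
      using p(3) env_simps(3)[OF env'] same by (auto simp: finals_def)
    show "wp body (\<lambda>m''. J (Suc i) (m''(''i'' := (m'' ''i'')(0 := Suc i)))) m'"
    proof (cases "?x \<in> ?F \<and> ?x \<noteq> t")
      case True
      have ext: "follows ?F t ?nx (p @ [(?x, ?nx ?x)])" "walk s (p @ [(?x, ?nx ?x)]) (?nx ?x)" "?nx ?x \<in> ?F"
        using follows_extend[OF st pos p(1,2)] True by auto
      have nx: "?nx ?x < n" using ext(3) Fn by auto
      define m1 where "m1 = m'(''mark'' := (m' ''mark'')(?x := 1), ''x'' := (m' ''x'')(0 := ?nx ?x))"
      have "J (Suc i) m1"
        unfolding J_def
      proof (intro exI[of _ "p @ [(?x, ?nx ?x)]"] conjI impI allI)
        show "m1 ''mark'' u \<noteq> 0 \<longleftrightarrow> u \<in> fst ` set (p @ [(?x, ?nx ?x)])" if "u < n" for u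
          using p(7)[OF that] by (auto simp: m1_def)
      qed (use ext nx p(4,5,6) True in \<open>auto simp: m1_def\<close>)
      then show ?thesis
        unfolding body_def wp.simps J_cong
        using cond True one_less less_K[of "?nx ?x"] nx same by (simp add: m1_def del: val.simps(4,5))
    next
      case False
      have "J (Suc i) m'"
        unfolding J_def using p False by (intro exI[of _ p]) auto
      then show ?thesis
        unfolding body_def wp.simps J_cong using cond False by (simp del: val.simps(4,5))
    qed
  next
    fix m' assume "J n m'"
    then obtain p where p: "follows ?F t ?nx p" "walk s p (m' ''x'' 0)" "m' ''x'' 0 \<in> ?F \<longleftrightarrow> s \<in> ?F"
      "s \<notin> ?F \<Longrightarrow> p = []" "s \<in> ?F \<Longrightarrow> m' ''x'' 0 = t \<or> length p = n"
      "\<And>u. u < n \<Longrightarrow> m' ''mark'' u \<noteq> 0 \<longleftrightarrow> u \<in> fst ` set p"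
      unfolding J_def by blast
    \<comment> \<open>A path of length \<open>n\<close> would be too long by
      \<open>follows_length\<close>, so the target has been reached.\<close>
    have "walk s p t" if "s \<in> ?F"
      using follows_length[OF st pos p(1,2) _ finF] p(2,3,5) that cardF by auto
    then show "?Q m'" using p by (intro exI[of _ p]) auto
  qed
  define rest where "rest = Then (Set ''x'' (Lit 0) (var ''s'')) (For ''i'' (var ''n'') body)"
  have "wp (For ''i'' (var ''n'') (Set ''mark'' (var ''i'') (Lit 0))) (wp rest ?Q) m"
  proof (rule wp_For[where J = "\<lambda>i m'. \<forall>i'<i. m' ''mark'' i' = 0"])
    show "val (var ''n'') m = n" using env_simps(1)[OF env] by simp
    show "n \<le> N" by (rule n_le)
    fix m' assume mark: "\<forall>i'<n. m' ''mark'' i' = 0"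
      and "agree (insert ''i'' (writes (Set ''mark'' (var ''i'') (Lit 0)))) m m'"
    then have ag: "agree {''i'', ''mark''} m m'" by simp
    have env': "env m'" by (rule env_agree[OF env ag]) simp
    define m1 where "m1 = m'(''x'' := (m' ''x'')(0 := s))"
    have "wp (For ''i'' (var ''n'') body) ?Q m1"
      by (rule loop) (use ag mark in \<open>auto simp: m1_def agree_def\<close>)
    then show "wp rest ?Q m'"
      unfolding rest_def wp.simps(2,3)
      using env_simps(2)[OF env'] less_K[of s] s_less by (simp add: m1_def del: wp.simps)
  qed (auto simp: less_Suc_eq)
  then show ?thesis
    unfolding trace_def rest_def body_def by (simp del: wp.simps(1,2,4))
qed

lemma wp_emit:
  assumes env: "env m"
    and f: "follows (finals m) t (m ''next'') p" and mark: "\<And>u. u < n \<Longrightarrow> m ''mark'' u \<noteq> 0 \<longleftrightarrow> u \<in> fst ` set p"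
  shows "wp (emit w) (\<lambda>m'. \<forall>u<n. \<forall>j<n.
     (m' ''A'' (u * n + j) \<noteq> 0 \<longleftrightarrow> j \<in> safe_heads E R (finals m) (vals m) u) \<and>
     (m' ''B'' (u * n + j) \<noteq> 0 \<longleftrightarrow> j \<in> guard_heads E R (finals m) (vals m) p u)) m"
proof -
  let ?F = "finals m"
  define J where "J = (\<lambda>k (m' :: memory). \<forall>u<n. \<forall>j<n. u * n + j < k \<longrightarrow>
     (m' ''A'' (u * n + j) \<noteq> 0 \<longleftrightarrow> j \<in> safe_heads E R ?F (vals m) u) \<and>
     (m' ''B'' (u * n + j) \<noteq> 0 \<longleftrightarrow> j \<in> guard_heads E R ?F (vals m) p u))"
  define bits where "bits = Then (set_bit ''A'' (var ''k'') (safe_expr w)) (set_bit ''B'' (var ''k'') (guard_expr w))"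
  define body where "body = Then (Set ''u'' (Lit 0) (Div (var ''k'') (var ''n'')))
       (Then (Set ''j'' (Lit 0) (Minus (var ''k'') (Times (var ''u'') (var ''n'')))) bits)"
  have J_cong: "J k (m'(''k'' := z)) \<longleftrightarrow> J k m'" for k m' z by (simp add: J_def)
  \<comment> \<open>An arc of \<open>p\<close> is determined by its tail, which is why the marks
    decode the path.\<close>
  have on_path: "(u, j) \<in> set p \<longleftrightarrow> u \<in> fst ` set p \<and> j = m ''next'' u" for u j
    using f by (force simp: follows_def)
  have "wp (For ''k'' (Times (var ''n'') (var ''n'')) body) (J (n * n)) m"
  proof (rule wp_For[where J = J])
    show "val (Times (var ''n'') (var ''n'')) m = n * n" using env_simps(1)[OF env] by simp
    show "n * n \<le> N" by (rule n_sq)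
    show "J 0 (m(''k'' := (m ''k'')(0 := 0)))" by (simp add: J_def)
  next
    fix k m' assume k: "k < n * n" and inv: "J k m'" and mk: "m' ''k'' 0 = k"
      and "agree (insert ''k'' (writes body)) m m'"
    then have ag: "agree {''k'', ''u'', ''j'', ''A'', ''B''} m m'"
      by (auto simp: agree_def body_def bits_def set_bit_def)
    have env': "env m'" by (rule env_agree[OF env ag]) simp
    have same: "m' ''fin'' = m ''fin''" "m' ''val'' = m ''val''" "m' ''next'' = m ''next''" "m' ''mark'' = m ''mark''"
      using ag by (simp_all add: agree_def)
    let ?u = "k div n" and ?j = "k mod n"
    have u: "?u < n" and j: "?j < n" using k n_pos by (auto simp: less_mult_imp_div_less)
    have uj: "?u * n + ?j = k" by simp
    have eq: "u * n + j = k \<longleftrightarrow> u = ?u \<and> j = ?j" if "u < n" "j < n" for u j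
      using div_mod_index[OF that] by auto
    define m1 where "m1 = m'(''u'' := (m' ''u'')(0 := ?u), ''j'' := (m' ''j'')(0 := ?j))"
    have ag1: "agree {''u'', ''j''} m' m1" by (simp add: agree_def m1_def)
    have env1: "env m1" by (rule env_agree[OF env' ag1]) simp
    define A where "A = (if ?j \<in> safe_heads E R ?F (vals m) ?u then 1 else 0 :: nat)"
    define m2 where "m2 = m1(''A'' := (m1 ''A'')(k := A))"
    define B where "B = (if ?j \<in> guard_heads E R ?F (vals m) p ?u then 1 else 0 :: nat)"
    define m3 where "m3 = m2(''B'' := (m2 ''B'')(k := B))"
    have arc: "m' ''arc'' k = (if ?j \<in> E ?u then 1 else 0)" using env_simps(4)[OF env' u j] by (simp add: uj)
    have wk: "m' w k = W ?u ?j" if "?j \<in> E ?u" using env_simps(5)[OF env' u that] by (simp add: uj)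
    have "val (near w (var ''u'') (var ''j'') (Cell ''val'' (var ''u''))) m1 = 0 \<longleftrightarrow> ?j \<notin> below m ?u (m ''val'' ?u)"
      using val_near[OF env1, of "var ''u''" "var ''j''" "Cell ''val'' (var ''u'')"] u j same
        below_cong[of m1 m] by (simp add: m1_def)
    then have A: "val (safe_expr w) m1 \<noteq> 0 \<longleftrightarrow> A = 1"
      using arc mk same u j
      by (auto simp: safe_expr_def m1_def A_def safe_heads_def below_iff finals_def simp flip: of_nat_add)
    have B: "val (guard_expr w) m2 \<noteq> 0 \<longleftrightarrow> B = 1"
      using arc wk mk same u j mark[OF u]
      by (auto simp: guard_expr_def m2_def m1_def B_def guard_heads_def on_path finals_def simp flip: of_nat_add)
    have J3: "J (Suc k) m3"
      unfolding J_def
    proof (intro allI impI)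
      fix u j assume "u < n" "j < n" "u * n + j < Suc k"
      then show "(m3 ''A'' (u * n + j) \<noteq> 0 \<longleftrightarrow> j \<in> safe_heads E R ?F (vals m) u) \<and>
        (m3 ''B'' (u * n + j) \<noteq> 0 \<longleftrightarrow> j \<in> guard_heads E R ?F (vals m) p u)"
        using inv eq[of u j] unfolding J_def
        by (cases "u * n + j = k") (auto simp: m3_def m2_def m1_def A_def B_def)
    qed
    have "wp (set_bit ''B'' (var ''k'') (guard_expr w)) (J (Suc k)) m2"
      using B J3 one_less mk by (auto simp: set_bit_def m3_def m2_def m1_def B_def split: if_splits)
    then have "wp bits (J (Suc k)) m1"
      using A one_less mk unfolding bits_def
      by (auto simp: set_bit_def m2_def m1_def A_def split: if_splits)
    then show "wp body (\<lambda>m''. J (Suc k) (m''(''k'' := (m'' ''k'')(0 := Suc k)))) m'"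
      unfolding body_def wp.simps(2,3) J_cong
      using mk env_simps(1)[OF env'] less_K[of ?u] less_K[of ?j] u j
      by (simp add: m1_def minus_div_mult_eq_mod del: wp.simps)
  qed assumption
  then show ?thesis
    unfolding emit_def body_def[symmetric, unfolded bits_def]
    by (rule wp_conseq) (auto simp: J_def div_mod_index(3))
qed

definition solved :: "memory \<Rightarrow> bool" where
  "solved m \<longleftrightarrow> (\<exists>F v d nx p. certificate {..<n} E big R R' t F v d nx \<and> follows F t nx p \<and>
     (if s \<in> F then walk s p t else p = []) \<and> (m ''fin'' s \<noteq> 0 \<longleftrightarrow> s \<in> F) \<and>
     (\<forall>u<n. \<forall>j<n. (m ''A'' (u * n + j) \<noteq> 0 \<longleftrightarrow> j \<in> safe_heads E R F v u) \<and>
        (m ''B'' (u * n + j) \<noteq> 0 \<longleftrightarrow> j \<in> guard_heads E R F v p u)))"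

lemma wp_solve:
  assumes env: "env m"
  shows "wp (solve b w w') solved m"
  unfolding solve_def wp.simps(3)
proof (rule wp_conseq[OF wp_dijkstra[OF env]])
  fix m1 assume c: "certificate {..<n} E big R R' t (finals m1) (vals m1) (dists m1) (m1 ''next'')"
    and ag: "agree (writes (dijkstra b w w')) m m1"
  have env1: "env m1" by (rule env_agree[OF env ag]) (simp add: writes_dijkstra)
  show "wp trace (wp (emit w) solved) m1"
  proof (rule wp_conseq[OF wp_trace[OF env1 c]], elim exE conjE)
    fix m2 p
    assume p: "follows (finals m1) t (m1 ''next'') p" "if s \<in> finals m1 then walk s p t else p = []"
      "\<forall>u<n. m2 ''mark'' u \<noteq> 0 \<longleftrightarrow> u \<in> fst ` set p" and ag2: "agree (writes trace) m1 m2"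
    have env2: "env m2" by (rule env_agree[OF env1 ag2]) (simp add: trace_def)
    have same: "m2 ''fin'' = m1 ''fin''" "m2 ''next'' = m1 ''next''" "m2 ''val'' = m1 ''val''"
      by (auto intro!: agreeD[OF ag2] simp: trace_def)
    have "wp (emit w) (\<lambda>m'. \<forall>u<n. \<forall>j<n.
       (m' ''A'' (u * n + j) \<noteq> 0 \<longleftrightarrow> j \<in> safe_heads E R (finals m2) (vals m2) u) \<and>
       (m' ''B'' (u * n + j) \<noteq> 0 \<longleftrightarrow> j \<in> guard_heads E R (finals m2) (vals m2) p u)) m2"
      using p by (intro wp_emit[OF env2]) (simp_all add: same finals_cong[of m2 m1, OF same(1)])
    then show "wp (emit w) solved m2"
    proof (rule wp_conseq)
      fix m3
      assume AB: "\<forall>u<n. \<forall>j<n.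
         (m3 ''A'' (u * n + j) \<noteq> 0 \<longleftrightarrow> j \<in> safe_heads E R (finals m2) (vals m2) u) \<and>
         (m3 ''B'' (u * n + j) \<noteq> 0 \<longleftrightarrow> j \<in> guard_heads E R (finals m2) (vals m2) p u)"
        and ag3: "agree (writes (emit w)) m2 m3"
      have "m3 ''fin'' = m2 ''fin''"
        by (rule agreeD[OF ag3]) (simp add: emit_def set_bit_def)
      then have "m3 ''fin'' s \<noteq> 0 \<longleftrightarrow> s \<in> finals m1"
        using s_less same by (simp add: finals_def)
      then show "solved m3"
        unfolding solved_def using c p AB finals_cong[of m2 m1, OF same(1)] same
        by (intro exI[of _ "finals m1"] exI[of _ "vals m1"] exI[of _ "dists m1"] exI[of _ "m1 ''next''"] exI[of _ p])
           simp
    qed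
  qed
qed

end

section \<open>Encoded games\<close>

text \<open>The program computes on indices, while the equilibrium lives on vertices. Injectivity of
  \<open>g\<close> on \<open>V\<close>, witnessed by \<open>h\<close>, lets the sets of heads
  commute with images, and with them every part of a certificate.\<close>

lemma certificate_image:
  assumes c: "certificate V E M R R' t F v d nx"
    and t: "t \<in> V" and E_sub: "\<And>u. u \<in> V \<Longrightarrow> E u \<subseteq> V" and g: "\<And>u. u \<in> V \<Longrightarrow> h (g u) = u"
    and Ev: "\<And>u. u \<in> V \<Longrightarrow> Ev (g u) = g ` E u"
    and Mv: "\<And>u X. u \<in> V \<Longrightarrow> Mv (g u) (g ` X) \<longleftrightarrow> M u X"
    and Rv: "\<And>u w. u \<in> V \<Longrightarrow> w \<in> E u \<Longrightarrow> Rv (g u) (g w) = R u w"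
    and Rv': "\<And>u w. u \<in> V \<Longrightarrow> w \<in> E u \<Longrightarrow> Rv' (g u) (g w) = R' u w"
  shows "certificate (g ` V) Ev Mv Rv Rv' (g t) (g ` F) (v \<circ> h) (d \<circ> h) (g \<circ> nx \<circ> h)"
    and "u \<in> V \<Longrightarrow> safe_heads Ev Rv (g ` F) (v \<circ> h) (g u) = g ` safe_heads E R F v u"
    and "u \<in> V \<Longrightarrow> follows F t nx p \<Longrightarrow>
      guard_heads Ev Rv (g ` F) (v \<circ> h) (map (map_prod g g) p) (g u) = g ` guard_heads E R F v p u"
    and "follows F t nx p \<Longrightarrow> follows (g ` F) (g t) (g \<circ> nx \<circ> h) (map (map_prod g g) p)"
proof -
  have FV: "F \<subseteq> V" and st: "settled E M R R' t F v d nx" using c by (auto simp: certificate_def)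
  have mem: "g u \<in> g ` F \<longleftrightarrow> u \<in> F" if "u \<in> V" for u
    using that FV g by (metis image_iff subsetD)
  have gt: "g u = g t \<longleftrightarrow> u = t" if "u \<in> V" for u using g that t by metis
  have EV: "w \<in> V" if "u \<in> V" "w \<in> E u" for u w using E_sub that by blast
  have image_Collect: "{y \<in> g ` S. Q y} = g ` {w \<in> S. Q (g w)}" for S Q by auto
  have E_facts: "g w \<in> g ` F \<longleftrightarrow> w \<in> F" "h (g w) = w" "Rv (g u) (g w) = R u w" if "u \<in> V" "w \<in> E u" for u w
    using mem g Rv that EV by auto
  have le: "heads_le Ev Rv (g ` F) (v \<circ> h) (g u) c = g ` heads_le E R F v u c" if "u \<in> V" for u c
  proof -
    have "heads_le Ev Rv (g ` F) (v \<circ> h) (g u) c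
      = g ` {w \<in> E u. g w \<in> g ` F \<and> Rv (g u) (g w) + v (h (g w)) \<le> c}"
      unfolding heads_le_def Ev[OF that] comp_def by (rule image_Collect)
    also have "{w \<in> E u. g w \<in> g ` F \<and> Rv (g u) (g w) + v (h (g w)) \<le> c} = heads_le E R F v u c"
      unfolding heads_le_def by (rule Collect_cong) (simp add: E_facts[OF that] cong: conj_cong)
    finally show ?thesis .
  qed
  have less: "heads_less Ev Rv (g ` F) (v \<circ> h) (g u) c = g ` heads_less E R F v u c" if "u \<in> V" for u c
  proof -
    have "heads_less Ev Rv (g ` F) (v \<circ> h) (g u) c
      = g ` {w \<in> E u. g w \<in> g ` F \<and> Rv (g u) (g w) + v (h (g w)) < c}"
      unfolding heads_less_def Ev[OF that] comp_def by (rule image_Collect)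
    also have "{w \<in> E u. g w \<in> g ` F \<and> Rv (g u) (g w) + v (h (g w)) < c} = heads_less E R F v u c"
      unfolding heads_less_def by (rule Collect_cong) (simp add: E_facts[OF that] cong: conj_cong)
    finally show ?thesis .
  qed
  have "settled Ev Mv Rv Rv' (g t) (g ` F) (v \<circ> h) (d \<circ> h) (g \<circ> nx \<circ> h)"
    unfolding settled_def
  proof (intro conjI ballI)
    show "g t \<in> g ` F" "(v \<circ> h) (g t) = 0" "(d \<circ> h) (g t) = 0"
      using st g t by (auto simp: settled_def)
  next
    fix x assume "x \<in> g ` F - {g t}"
    then obtain u where u: "x = g u" "u \<in> F - {t}" by auto
    then have uV: "u \<in> V" using FV by auto
    note vals = comp_def g[OF uV] u(1)
    have S: "M u (heads_le E R F v u (v u))" "\<not> M u (heads_less E R F v u (v u))"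
      "nx u \<in> heads_le E R F v u (v u)" "d u = R' u (nx u) + d (nx u)"
      "\<forall>w\<in>heads_le E R F v u (v u). d u \<le> R' u w + d w"
      using st u(2) unfolding settled_def by blast+
    have nx: "nx u \<in> E u" using S(3) by (simp add: heads_le_def)
    show "Mv x (heads_le Ev Rv (g ` F) (v \<circ> h) x ((v \<circ> h) x))"
      unfolding u(1) le[OF uV] Mv[OF uV] using S(1) by (simp add: g[OF uV])
    show "\<not> Mv x (heads_less Ev Rv (g ` F) (v \<circ> h) x ((v \<circ> h) x))"
      unfolding u(1) less[OF uV] Mv[OF uV] using S(2) by (simp add: g[OF uV])
    show "(g \<circ> nx \<circ> h) x \<in> heads_le Ev Rv (g ` F) (v \<circ> h) x ((v \<circ> h) x)"
      unfolding u(1) le[OF uV] using S(3) by (simp add: g[OF uV])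
    show "(d \<circ> h) x = Rv' x ((g \<circ> nx \<circ> h) x) + (d \<circ> h) ((g \<circ> nx \<circ> h) x)"
      using S(4) by (simp add: u(1) g uV Rv' nx EV[OF uV nx])
    fix y assume "y \<in> heads_le Ev Rv (g ` F) (v \<circ> h) x ((v \<circ> h) x)"
    then obtain w where w: "y = g w" "w \<in> heads_le E R F v u (v u)"
      unfolding u(1) le[OF uV] by (auto simp: g[OF uV])
    then have wE: "w \<in> E u" by (simp add: heads_le_def)
    show "(d \<circ> h) x \<le> Rv' x y + (d \<circ> h) y"
      using S(5) w by (simp add: u(1) g uV Rv' wE EV[OF uV wE])
  qed
  moreover have "\<not> Mv x (Ev x \<inter> g ` F)" if x: "x \<in> g ` V - g ` F" for x
  proof -
    obtain u where u: "x = g u" "u \<in> V - F" using x by blast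
    then have "Ev x \<inter> g ` F = g ` {w \<in> E u. g w \<in> g ` F}" using Ev by auto
    also have "{w \<in> E u. g w \<in> g ` F} = E u \<inter> F" using E_facts(1) u(2) by blast
    finally have "Ev x \<inter> g ` F = g ` (E u \<inter> F)" .
    then show ?thesis using u c Mv by (simp add: certificate_def)
  qed
  ultimately show "certificate (g ` V) Ev Mv Rv Rv' (g t) (g ` F) (v \<circ> h) (d \<circ> h) (g \<circ> nx \<circ> h)"
    using FV by (auto simp: certificate_def)
  show "safe_heads Ev Rv (g ` F) (v \<circ> h) (g u) = g ` safe_heads E R F v u" if "u \<in> V" for u
  proof -
    have "safe_heads Ev Rv (g ` F) (v \<circ> h) (g u)
      = g ` {w \<in> E u. g u \<in> g ` F \<longrightarrow> g w \<in> g ` F \<and> Rv (g u) (g w) + v (h (g w)) \<le> v (h (g u))}"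
      unfolding safe_heads_def Ev[OF that] comp_def by (rule image_Collect)
    also have "{w \<in> E u. g u \<in> g ` F \<longrightarrow> g w \<in> g ` F \<and> Rv (g u) (g w) + v (h (g w)) \<le> v (h (g u))}
      = safe_heads E R F v u"
      unfolding safe_heads_def
      by (rule Collect_cong) (simp add: E_facts[OF that] mem[OF that] g[OF that] cong: conj_cong)
    finally show ?thesis .
  qed
  show "guard_heads Ev Rv (g ` F) (v \<circ> h) (map (map_prod g g) p) (g u) = g ` guard_heads E R F v p u"
    if u: "u \<in> V" and p: "follows F t nx p" for u
  proof -
    \<comment> \<open>\<open>g\<close> is known to be injective on \<open>V\<close> only, so both
      ends of an arc of \<open>p\<close> have to be located there; the certificate places them in
      \<open>F\<close>.\<close>
    have path: "(g u, g w) \<in> map_prod g g ` set p \<longleftrightarrow> (u, w) \<in> set p" if "w \<in> E u" for w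
    proof
      have w: "w \<in> V" by (rule EV[OF u that])
      assume "(g u, g w) \<in> map_prod g g ` set p"
      then obtain a b where ab: "(a, b) \<in> set p" "g u = g a" "g w = g b" by auto
      have a: "a \<in> F - {t}" "b = nx a" using ab(1) p by (auto simp: follows_def)
      have "nx a \<in> heads_le E R F v a (v a)" using st a(1) unfolding settled_def by blast
      then have "b \<in> V" "a \<in> V" using a FV by (auto simp: heads_le_def)
      then have "a = u" "b = w" using ab(2,3) g u w by (metis (no_types))+
      then show "(u, w) \<in> set p" using ab(1) by simp
    next
      assume "(u, w) \<in> set p"
      then show "(g u, g w) \<in> map_prod g g ` set p" by (rule rev_image_eqI) simp
    qed
    have "guard_heads Ev Rv (g ` F) (v \<circ> h) (map (map_prod g g) p) (g u)
      = g ` {w \<in> E u. (g w \<in> g ` F \<longrightarrow> g u \<in> g ` F \<and> v (h (g u)) \<le> Rv (g u) (g w) + v (h (g w))) \<or>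
          (g u, g w) \<in> map_prod g g ` set p}"
      unfolding guard_heads_def Ev[OF u] comp_def set_map by (rule image_Collect)
    also have "{w \<in> E u. (g w \<in> g ` F \<longrightarrow> g u \<in> g ` F \<and> v (h (g u)) \<le> Rv (g u) (g w) + v (h (g w))) \<or>
          (g u, g w) \<in> map_prod g g ` set p} = guard_heads E R F v p u"
      unfolding guard_heads_def
      by (rule Collect_cong) (simp add: E_facts[OF u] mem[OF u] g[OF u] path cong: conj_cong)
    finally show ?thesis .
  qed
  show "follows (g ` F) (g t) (g \<circ> nx \<circ> h) (map (map_prod g g) p)" if p: "follows F t nx p"
    unfolding follows_def
  proof
    fix e assume "e \<in> set (map (map_prod g g) p)"
    then obtain a b where ab: "(a, b) \<in> set p" "e = (g a, g b)" by auto
    have a: "a \<in> F - {t}" "b = nx a" using ab(1) p by (auto simp: follows_def)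
    then have "a \<in> V" using FV by auto
    then show "e \<in> {(u, (g \<circ> nx \<circ> h) u) |u. u \<in> g ` F - {g t}}"
      using a ab g gt by auto
  qed
qed

lemma walk_image: "walk u p w \<Longrightarrow> walk (g u) (map (map_prod g g) p) (g w)"
  by (induction p arbitrary: u) auto

text \<open>Despite its name, \<open>lcm\<close> holds the product of all denominators of one
  player. As a common multiple it makes the later division exact, and its length is controlled by
  the sum of their lengths.\<close>

definition prepare :: "string \<Rightarrow> string \<Rightarrow> string \<Rightarrow> stm" where
  "prepare num den w =
     Then (Set ''lcm'' (Lit 0) (Lit 1))
    (Then (For ''k'' (Times (var ''n'') (var ''n''))
        (Branch (Cell ''arc'' (var ''k''))
          (Set ''lcm'' (Lit 0) (Times (var ''lcm'') (Cell den (var ''k'')))) Nop))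
      (For ''k'' (Times (var ''n'') (var ''n''))
        (Branch (Cell ''arc'' (var ''k''))
          (Set w (var ''k'') (Div (Times (Cell num (var ''k'')) (var ''lcm'')) (Cell den (var ''k'')))) Nop)))"

definition mark_all :: "string \<Rightarrow> expr \<Rightarrow> stm" where
  "mark_all a e = For ''k'' (Times (var ''n'') (var ''n'')) (set_bit a (var ''k'') e)"

definition arc_not :: "string \<Rightarrow> expr" where
  "arc_not x = Times (Cell ''arc'' (var ''k'')) (Minus (Lit 1) (Cell x (var ''k'')))"

text \<open>The second run overwrites \<open>fin\<close>, \<open>A\<close> and \<open>B\<close>, so
  both strategies are written before it. If it misses the source, too, \<open>sigma1\<close> keeps
  the guards of the first run, while \<open>sigma2\<close> takes those of the second.\<close>

definition main :: stm where
  "main =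
     Then (prepare ''num1'' ''den1'' ''w1'')
    (Then (prepare ''num2'' ''den2'' ''w2'')
    (Then (solve True ''w2'' ''w1'')
    (Then (mark_all ''sigma2'' (Cell ''A'' (var ''k'')))
    (Then (mark_all ''sigma1'' (arc_not ''B''))
      (Branch (Minus (Lit 1) (Cell ''fin'' (var ''s'')))
        (Then (solve False ''w1'' ''w2'')
        (Then (mark_all ''sigma2'' (Cell ''B'' (var ''k'')))
          (Branch (Cell ''fin'' (var ''s'')) (mark_all ''sigma1'' (arc_not ''A'')) Nop)))
        Nop)))))"

context oracle_machine
begin

lemma wp_mark_all:
  assumes n: "m ''n'' 0 = n" "n * n \<le> N" and a: "a \<noteq> ''k''" "a \<noteq> ''n''"
    and f: "\<And>m' k. k < n * n \<Longrightarrow> agree {a, ''k''} m m' \<Longrightarrow> m' ''k'' 0 = k \<Longrightarrow> val e m' \<noteq> 0 \<longleftrightarrow> f k"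
  shows "wp (mark_all a e) (\<lambda>m'. \<forall>k<n * n. m' a k \<noteq> 0 \<longleftrightarrow> f k) m"
  unfolding mark_all_def
proof (rule wp_For[where J = "\<lambda>k m'. \<forall>k'<k. m' a k' \<noteq> 0 \<longleftrightarrow> f k'"])
  fix k m'
  assume k: "k < n * n" and J: "\<forall>k'<k. m' a k' \<noteq> 0 \<longleftrightarrow> f k'" and mk: "m' ''k'' 0 = k"
    and "agree (insert ''k'' (writes (set_bit a (var ''k'') e))) m m'"
  then have "agree {a, ''k''} m m'" by (auto simp: agree_def set_bit_def)
  from f[OF k this mk] show "wp (set_bit a (var ''k'') e)
      (\<lambda>m''. \<forall>k'<Suc k. (m''(''k'' := (m'' ''k'')(0 := Suc k))) a k' \<noteq> 0 \<longleftrightarrow> f k') m'"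
    using J mk a one_less by (auto simp: set_bit_def less_Suc_eq)
qed (use n in auto)

lemma wp_prepare:
  assumes n: "m ''n'' 0 = n" "n * n \<le> N"
    and names: "{num, den, w} \<inter> {''lcm'', ''k'', ''n'', ''arc''} = {}" "w \<noteq> num" "w \<noteq> den"
    and D: "D = (\<Prod>k | k < n * n \<and> m ''arc'' k \<noteq> 0. m den k)"
    and den: "\<And>k. k < n * n \<Longrightarrow> m ''arc'' k \<noteq> 0 \<Longrightarrow> 0 < m den k"
    and D_less: "D < 2 ^ K" and num: "\<And>k. k < n * n \<Longrightarrow> m ''arc'' k \<noteq> 0 \<Longrightarrow> m num k * D < 2 ^ K"
  shows "wp (prepare num den w)
    (\<lambda>m'. \<forall>k<n * n. m ''arc'' k \<noteq> 0 \<longrightarrow> m' w k = m num k * D div m den k) m"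
proof -
  let ?I = "\<lambda>k. {k'. k' < k \<and> m ''arc'' k' \<noteq> 0}"
  define Q where "Q = (\<lambda>m' :: memory. \<forall>k<n * n. m ''arc'' k \<noteq> 0 \<longrightarrow> m' w k = m num k * D div m den k)"
  have neq: "num \<noteq> ''lcm''" "num \<noteq> ''k''" "den \<noteq> ''lcm''" "den \<noteq> ''k''" "w \<noteq> ''lcm''" "w \<noteq> ''k''"
    "w \<noteq> ''n''" "w \<noteq> ''arc''" using names by auto
  define mul where "mul = Branch (Cell ''arc'' (var ''k''))
    (Set ''lcm'' (Lit 0) (Times (var ''lcm'') (Cell den (var ''k'')))) Nop"
  define scale where "scale = Branch (Cell ''arc'' (var ''k''))
    (Set w (var ''k'') (Div (Times (Cell num (var ''k'')) (var ''lcm'')) (Cell den (var ''k'')))) Nop"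
  define nn where "nn = Times (var ''n'') (var ''n'')"
  define m0 where "m0 = m(''lcm'' := (m ''lcm'')(0 := 1))"
  \<comment> \<open>Partial products divide the positive number \<open>D\<close>, so every
    intermediate value of \<open>lcm\<close> fits into a cell.\<close>
  have partial_le: "(\<Prod>k'\<in>?I k. m den k') \<le> D" if "k \<le> n * n" for k
  proof -
    have "(\<Prod>k'\<in>?I k. m den k') dvd D"
      unfolding D using that by (intro prod_dvd_prod_subset) auto
    moreover have "0 < D" unfolding D using den by (intro prod_pos) auto
    ultimately show ?thesis by (rule dvd_imp_le)
  qed
  have "wp (For ''k'' nn mul) (wp (For ''k'' nn scale) Q) m0"
  proof (rule wp_For[where J = "\<lambda>k m'. m' ''lcm'' 0 = (\<Prod>k'\<in>?I k. m den k')"])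
    show "val nn m0 = n * n" using n by (simp add: nn_def m0_def)
    show "n * n \<le> N" by (rule n(2))
    show "(m0(''k'' := (m0 ''k'')(0 := 0))) ''lcm'' 0 = (\<Prod>k'\<in>?I 0. m den k')" by (simp add: m0_def)
  next
    fix k m' assume k: "k < n * n" and J: "m' ''lcm'' 0 = (\<Prod>k'\<in>?I k. m den k')" and mk: "m' ''k'' 0 = k"
      and "agree (insert ''k'' (writes mul)) m0 m'"
    then have ag: "agree {''k'', ''lcm''} m m'" by (auto simp: agree_def mul_def m0_def)
    have same: "m' ''arc'' = m ''arc''" "m' den = m den"
      using neq by (auto intro!: agreeD[OF ag])
    show "wp mul (\<lambda>m''. (m''(''k'' := (m'' ''k'')(0 := Suc k))) ''lcm'' 0 = (\<Prod>k'\<in>?I (Suc k). m den k')) m'"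
    proof (cases "m ''arc'' k \<noteq> 0")
      case True
      then have "?I (Suc k) = insert k (?I k)" by (auto simp: less_Suc_eq)
      then have eq: "(\<Prod>k'\<in>?I (Suc k). m den k') = (\<Prod>k'\<in>?I k. m den k') * m den k" by simp
      moreover have "(\<Prod>k'\<in>?I (Suc k). m den k') < 2 ^ K"
        using partial_le[of "Suc k"] k D_less by simp
      ultimately show ?thesis using True mk J same by (simp add: mul_def)
    next
      case False
      then have "?I (Suc k) = ?I k" by (auto simp: less_Suc_eq)
      then show ?thesis using False mk J same by (simp add: mul_def)
    qed
  next
    fix m1 assume J1: "m1 ''lcm'' 0 = (\<Prod>k'\<in>?I (n * n). m den k')" and "agree (insert ''k'' (writes mul)) m0 m1"
    then have ag1: "agree {''k'', ''lcm''} m m1" by (auto simp: agree_def mul_def m0_def)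
    have lcm: "m1 ''lcm'' 0 = D" using J1 D by simp
    show "wp (For ''k'' nn scale) Q m1"
    proof (rule wp_For[where J = "\<lambda>k m'. \<forall>k'<k. m ''arc'' k' \<noteq> 0 \<longrightarrow> m' w k' = m num k' * D div m den k'"])
      have "m1 ''n'' = m ''n''" by (rule agreeD[OF ag1]) simp
      then show "val nn m1 = n * n" using n by (simp add: nn_def)
      show "n * n \<le> N" by (rule n(2))
    next
      fix k m' assume k: "k < n * n" and J: "\<forall>k'<k. m ''arc'' k' \<noteq> 0 \<longrightarrow> m' w k' = m num k' * D div m den k'"
        and mk: "m' ''k'' 0 = k" and ag2: "agree (insert ''k'' (writes scale)) m1 m'"
      have same: "m' ''arc'' = m ''arc''" "m' den = m den" "m' num = m num" "m' ''lcm'' = m1 ''lcm''"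
        using neq names ag1 ag2 by (auto simp: agree_def scale_def)
      have "m num k * D div m den k < 2 ^ K" if "m ''arc'' k \<noteq> 0"
        using num[OF k that] by (meson div_le_dividend le_less_trans)
      then show "wp scale (\<lambda>m''. \<forall>k'<Suc k. m ''arc'' k' \<noteq> 0 \<longrightarrow>
          (m''(''k'' := (m'' ''k'')(0 := Suc k))) w k' = m num k' * D div m den k') m'"
        using J mk same lcm neq by (auto simp: scale_def less_Suc_eq)
    next
      fix m' assume "\<forall>k'<n * n. m ''arc'' k' \<noteq> 0 \<longrightarrow> m' w k' = m num k' * D div m den k'"
      then show "Q m'" by (simp add: Q_def)
    qed simp
  qed
  then show ?thesis
    using one_less unfolding prepare_def Q_def nn_def mul_def scale_def by (simp add: m0_def del: wp.simps(4-6))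
qed

end

lemma index_of_nth: "distinct xs \<Longrightarrow> i < length xs \<Longrightarrow> index_of xs (xs ! i) = i"
  unfolding index_of_def by (rule the_equality) (auto simp: nth_eq_iff_index_eq)

lemma prod_bits_less:
  assumes "finite A"
  shows "(\<Prod>a\<in>A. f a) \<le> 2 ^ (\<Sum>a\<in>A. bits (f a))"
proof -
  have "(\<Prod>a\<in>A. f a) \<le> (\<Prod>a\<in>A. 2 ^ bits (f a))"
    using less_power_bits by (intro prod_mono) (simp add: less_imp_le)
  also have "\<dots> = 2 ^ (\<Sum>a\<in>A. bits (f a))" by (simp add: power_sum)
  finally show ?thesis .
qed

section \<open>Indices, integer costs and size bounds\<close>

locale encoded_game =
  fixes \<Gamma> :: "'v sp_game" and P :: "'v presentation" and ora :: "nat list \<Rightarrow> bool" and tim :: "nat list \<Rightarrow> nat"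
    and B :: nat
  assumes game: "sp_interdiction_game \<Gamma>" and presents: "presents P \<Gamma>"
    and independence_oracle: "independence_oracle \<Gamma> P B ora tim"
begin

abbreviation "n \<equiv> length (listing P)"
abbreviation vertex :: "nat \<Rightarrow> 'v" where "vertex i \<equiv> listing P ! i"
abbreviation "index \<equiv> index_of (listing P)"

definition num :: "bool \<Rightarrow> 'v \<times> 'v \<Rightarrow> nat" where "num b = (if b then num2 P else num1 P)"
definition den :: "bool \<Rightarrow> 'v \<times> 'v \<Rightarrow> nat" where "den b = (if b then den2 P else den1 P)"
definition common_den :: "bool \<Rightarrow> nat" where "common_den b = (\<Prod>a\<in>parcs (graph \<Gamma>). den b a)"
definition arc_heads :: "nat \<Rightarrow> nat set" where "arc_heads i = {j. j < n \<and> (vertex i, vertex j) \<in> parcs (graph \<Gamma>)}"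
definition int_cost :: "bool \<Rightarrow> nat \<Rightarrow> nat \<Rightarrow> nat" where
  "int_cost b i j = num b (vertex i, vertex j) * common_den b div den b (vertex i, vertex j)"
definition index_winning :: "bool \<Rightarrow> nat \<Rightarrow> nat set \<Rightarrow> bool" where
  "index_winning b i X = winning \<Gamma> b (vertex i) (vertex ` X)"
definition scaled_cost :: "bool \<Rightarrow> 'v \<Rightarrow> 'v \<Rightarrow> real" where
  "scaled_cost b u w = real (common_den b) * own_cost \<Gamma> b u w"

abbreviation "S \<equiv> input_size \<Gamma> P"
text \<open>A numerator and the common denominator are each at most \<open>2 ^ S\<close>, so integer
  costs are at most \<open>2 ^ (2 * S)\<close>; a sum of \<open>n + 1 \<le> 2 ^ S\<close> of them is
  at most \<open>2 ^ (3 * S)\<close>, and one more bit makes this strict.\<close>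

abbreviation "K \<equiv> 3 * S + 1"
abbreviation "N \<equiv> S * S"

lemma distinct_listing: "distinct (listing P)" and set_listing: "set (listing P) = pverts (graph \<Gamma>)"
  using presents by (simp_all add: presents_def)

lemma den_pos: "a \<in> parcs (graph \<Gamma>) \<Longrightarrow> 0 < den b a"
  using presents by (auto simp: presents_def den_def)

lemma own_cost_eq: "(u, w) \<in> parcs (graph \<Gamma>) \<Longrightarrow> own_cost \<Gamma> b u w = real (num b (u, w)) / real (den b (u, w))"
  using presents by (auto simp: presents_def own_cost_def[OF game] num_def den_def)

lemma fin_digraph: "pair_fin_digraph (graph \<Gamma>)"
  using game unfolding sp_interdiction_game_def by (rule conjunct1)

lemma finite_arcs: "finite (parcs (graph \<Gamma>))"
  using fin_digraph by (rule pair_fin_digraph.pair_finite_arcs)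

lemma arc_ends: "(u, w) \<in> parcs (graph \<Gamma>) \<Longrightarrow> u \<in> pverts (graph \<Gamma>) \<and> w \<in> pverts (graph \<Gamma>)"
  using pair_wf_digraph.in_arcsD1[of "graph \<Gamma>" u w] pair_wf_digraph.in_arcsD2[of "graph \<Gamma>" u w]
    pair_fin_digraph.axioms(1)[OF fin_digraph] by simp

lemma vertex_image: "vertex ` {..<n} = pverts (graph \<Gamma>)"
  unfolding set_listing[symmetric] by (auto simp: in_set_conv_nth)

lemma index_vertex: "i < n \<Longrightarrow> index (vertex i) = i"
  by (rule index_of_nth[OF distinct_listing])

lemma vertex_index: "u \<in> pverts (graph \<Gamma>) \<Longrightarrow> index u < n \<and> vertex (index u) = u"
  using index_vertex unfolding set_listing[symmetric] by (auto simp: in_set_conv_nth)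

lemma vertex_eq_iff: "i < n \<Longrightarrow> j < n \<Longrightarrow> vertex i = vertex j \<longleftrightarrow> i = j"
  using distinct_listing by (simp add: nth_eq_iff_index_eq)

lemma succs_vertex: "i < n \<Longrightarrow> succs \<Gamma> (vertex i) = vertex ` arc_heads i"
proof -
  have "succs \<Gamma> (vertex i) \<subseteq> vertex ` {..<n}"
    unfolding vertex_image succs_def[OF game] using arc_ends by blast
  then show ?thesis unfolding arc_heads_def succs_def[OF game] by blast
qed

lemma source_target: "source \<Gamma> \<in> pverts (graph \<Gamma>)" "target \<Gamma> \<in> pverts (graph \<Gamma>)"
  using game by (simp_all add: sp_interdiction_game_def)

abbreviation "s \<equiv> index (source \<Gamma>)"
abbreviation "t \<equiv> index (target \<Gamma>)"

lemma st: "s < n" "vertex s = source \<Gamma>" "t < n" "vertex t = target \<Gamma>"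
  using vertex_index source_target by blast+

lemma choice_vertex: "i < n \<Longrightarrow> vertex i \<in> choice_verts \<Gamma> \<longleftrightarrow> i \<noteq> t"
  using vertex_image st vertex_eq_iff[of i t] by (auto simp: choice_verts_def)

lemma common_den_pos: "0 < common_den b"
  unfolding common_den_def using den_pos by (intro prod_pos) auto

lemma n_le_S: "n \<le> S"
  by (simp add: input_size_def)

lemma S_pos: "1 \<le> S"
  using n_le_S st(1) by linarith

lemma bits_le_S:
  assumes "a \<in> parcs (graph \<Gamma>)"
  shows "bits (num1 P a) + bits (den1 P a) + bits (num2 P a) + bits (den2 P a) \<le> S"
  using member_le_sum[OF assms, of "\<lambda>e. bits (num1 P e) + bits (den1 P e) + bits (num2 P e) + bits (den2 P e)"]
    finite_arcs by (simp add: input_size_def)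

lemma num_den_less:
  assumes "a \<in> parcs (graph \<Gamma>)"
  shows "num1 P a < 2 ^ S" "den1 P a < 2 ^ S" "num2 P a < 2 ^ S" "den2 P a < 2 ^ S"
  using bits_le_S[OF assms] S_pos by (simp_all flip: bits_le_iff)

text \<open>The length of a product is controlled by the sum of the lengths of its factors, and the
  denominators of one player are part of the input.\<close>

lemma common_den_le: "common_den b \<le> 2 ^ S"
proof -
  have "common_den b \<le> 2 ^ (\<Sum>a\<in>parcs (graph \<Gamma>). bits (den b a))"
    unfolding common_den_def by (rule prod_bits_less[OF finite_arcs])
  also have "(\<Sum>a\<in>parcs (graph \<Gamma>). bits (den b a)) \<le>
    (\<Sum>e\<in>parcs (graph \<Gamma>). bits (num1 P e) + bits (den1 P e) + bits (num2 P e) + bits (den2 P e))"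
    by (intro sum_mono) (simp add: den_def)
  also have "\<dots> \<le> S" by (simp add: input_size_def)
  then have "(2::nat) ^ (\<Sum>e\<in>parcs (graph \<Gamma>). bits (num1 P e) + bits (den1 P e) + bits (num2 P e) + bits (den2 P e)) \<le> 2 ^ S"
    by (intro power_increasing) simp_all
  finally show ?thesis by (simp add: power_increasing)
qed

lemma num_common_den: "a \<in> parcs (graph \<Gamma>) \<Longrightarrow> num b a * common_den b \<le> 2 ^ (2 * S)"
proof -
  assume a: "a \<in> parcs (graph \<Gamma>)"
  have "num b a \<le> 2 ^ S" using num_den_less[OF a] by (simp add: num_def)
  then have "num b a * common_den b \<le> 2 ^ S * 2 ^ S" using common_den_le by (intro mult_mono) auto
  then show ?thesis by (simp add: power_add[symmetric] mult_2)
qed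

lemma int_cost_le: "i < n \<Longrightarrow> j \<in> arc_heads i \<Longrightarrow> int_cost b i j \<le> 2 ^ (2 * S)"
  unfolding int_cost_def
  by (rule le_trans[OF div_le_dividend num_common_den]) (simp add: arc_heads_def)

text \<open>The division in \<open>int_cost\<close> is exact, since every denominator divides the
  product of all of them.\<close>

lemma int_cost_scaled:
  assumes "i < n" "j \<in> arc_heads i"
  shows "scaled_cost b (vertex i) (vertex j) = real (int_cost b i j)"
proof -
  have a: "(vertex i, vertex j) \<in> parcs (graph \<Gamma>)" using assms by (simp add: arc_heads_def)
  have "den b (vertex i, vertex j) dvd common_den b"
    unfolding common_den_def by (rule dvd_prodI[OF finite_arcs a])
  then have "den b (vertex i, vertex j) dvd num b (vertex i, vertex j) * common_den b" by simp
  then show ?thesis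
    unfolding scaled_cost_def own_cost_eq[OF a] int_cost_def by (simp add: real_of_nat_div)
qed

lemma rescaled_scaled: "rescaled \<Gamma> scaled_cost"
  unfolding rescaled_def[OF game] scaled_cost_def
proof
  fix b
  show "\<exists>c>0. \<forall>u. \<forall>w\<in>succs \<Gamma> u. real (common_den b) * own_cost \<Gamma> b u w = c * own_cost \<Gamma> b u w"
    using common_den_pos[of b] by (intro exI[of _ "real (common_den b)"]) simp
qed

lemma power_bound: "N + 1 < 2 ^ K" "(n + 1) * 2 ^ (2 * S) < 2 ^ K"
proof -
  have S2: "S < 2 ^ S" by (rule less_exp)
  have "S * S < 2 ^ S * 2 ^ S" using S2 by (intro mult_strict_mono) auto
  also have "\<dots> = 2 ^ (2 * S)" by (simp add: power_add[symmetric] mult_2)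
  also have "\<dots> < 2 ^ K" using S_pos by (intro power_strict_increasing) auto
  finally have "S * S + 1 \<le> 2 ^ (2 * S)" using \<open>2 ^ S * 2 ^ S = 2 ^ (2 * S)\<close> \<open>S * S < 2 ^ S * 2 ^ S\<close> by simp
  also have "\<dots> < 2 ^ K" using S_pos by (intro power_strict_increasing) auto
  finally show "N + 1 < 2 ^ K" .
  have "n + 1 \<le> 2 ^ S" using n_le_S S2 by linarith
  then have "(n + 1) * 2 ^ (2 * S) \<le> 2 ^ S * 2 ^ (2 * S)" by (intro mult_le_mono1)
  also have "\<dots> = 2 ^ (3 * S)" by (simp add: power_add[symmetric])
  also have "\<dots> < 2 ^ K" by (intro power_strict_increasing) auto
  finally show "(n + 1) * 2 ^ (2 * S) < 2 ^ K" .
qed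

lemma oracle_machine: "oracle_machine K N"
  using power_bound by unfold_locales auto

lemma answers:
  assumes u: "u < n" "u \<noteq> t" and js: "distinct js" "set js \<subseteq> arc_heads u"
  shows "tim (u # js) \<le> B" "ora (u # js) \<longleftrightarrow>
    (if b then \<not> index_winning b u (set js) else index_winning b u (arc_heads u - set js))"
proof -
  have "vertex u \<in> choice_verts \<Gamma>" using choice_vertex u by simp
  moreover have "\<forall>j\<in>set js. j < n \<and> (vertex u, vertex j) \<in> parcs (graph \<Gamma>)"
    using js(2) by (auto simp: arc_heads_def)
  ultimately have q: "(ora (u # js) \<longleftrightarrow> (\<lambda>j. (vertex u, vertex j)) ` set js \<in> indep \<Gamma> (vertex u)) \<and> tim (u # js) \<le> B"
    using independence_oracle u(1) js(1) unfolding independence_oracle_def Let_def by blast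
  then show "tim (u # js) \<le> B" by simp
  have img: "(\<lambda>j. (vertex u, vertex j)) ` set js = Pair (vertex u) ` vertex ` set js" by (simp add: image_image)
  have sub: "vertex ` set js \<inter> succs \<Gamma> (vertex u) = vertex ` set js"
    using js(2) succs_vertex[OF u(1)] by blast
  have inj: "inj_on vertex (arc_heads u)"
    by (rule inj_on_subset[OF inj_on_nth[OF distinct_listing, of "{..<n}"]]) (auto simp: arc_heads_def)
  \<comment> \<open>For player 1 a set wins if its complement is independent; complementing twice
    returns the submitted set, by injectivity of \<open>vertex\<close>.\<close>
  have "succs \<Gamma> (vertex u) - vertex ` (arc_heads u - set js) = vertex ` (arc_heads u - (arc_heads u - set js))"
    unfolding succs_vertex[OF u(1)] by (rule inj_on_image_set_diff[OF inj, symmetric]) auto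
  also have "arc_heads u - (arc_heads u - set js) = set js" using js(2) by blast
  finally have diff: "succs \<Gamma> (vertex u) - vertex ` (arc_heads u - set js) = vertex ` set js" .
  show "ora (u # js) \<longleftrightarrow>
    (if b then \<not> index_winning b u (set js) else index_winning b u (arc_heads u - set js))"
    using q unfolding index_winning_def winning_def[OF game] sub diff img by simp
qed

lemma arena_index: "arena {..<n} arc_heads (index_winning b) (\<lambda>u j. real (int_cost b' u j)) t"
  (is "arena _ _ _ ?R _") if "b' = b"
proof -
  interpret G: arena "pverts (graph \<Gamma>)" "succs \<Gamma>" "winning \<Gamma> b" "scaled_cost b" "scaled_cost b" "target \<Gamma>"
    by (rule arena[OF game rescaled_scaled])
  have V: "vertex u \<in> pverts (graph \<Gamma>) - {target \<Gamma>}" if "u \<in> {..<n} - {t}" for u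
    using that choice_vertex[of u] by (simp add: choice_verts_def)
  show ?thesis
  proof
    show "arc_heads u \<subseteq> {..<n}" for u by (auto simp: arc_heads_def)
    show "t \<in> {..<n}" using st by simp
    show "index_winning b u Y" if "u \<in> {..<n} - {t}" "index_winning b u X" "X \<subseteq> Y" for u X Y
      using G.M_mono[OF V[OF that(1)]] that(2,3) unfolding index_winning_def by (meson image_mono)
    show "\<not> index_winning b u {}" if "u \<in> {..<n} - {t}" for u
      using G.M_empty[OF V[OF that]] by (simp add: index_winning_def)
    show "0 < ?R u w" if u: "u \<in> {..<n}" and w: "w \<in> arc_heads u" for u w
    proof -
      have "vertex u \<in> pverts (graph \<Gamma>)" "vertex w \<in> succs \<Gamma> (vertex u)"
        using u w succs_vertex[of u] vertex_image by auto
      then have "0 < scaled_cost b (vertex u) (vertex w)" by (rule G.R_pos)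
      then show ?thesis using int_cost_scaled[of u w b] u w \<open>b' = b\<close> by simp
    qed
  qed simp
qed

text \<open>Large enough for every expression of \<open>main\<close>, including the slack of loops;
  \<open>well_formed_main\<close> verifies this by evaluation.\<close>

definition Z :: nat where "Z = 200"

definition weights :: "bool \<Rightarrow> string" where "weights b = (if b then ''w2'' else ''w1'')"

lemma phase: "phase ora tim K N B n arc_heads (index_winning b) (int_cost b) (int_cost (\<not> b)) t s b
    (weights b) (weights (\<not> b)) (2 ^ (2 * S))"
proof -
  interpret arena "{..<n}" arc_heads "index_winning b" "\<lambda>u j. real (int_cost b u j)" "\<lambda>u j. real (int_cost (\<not> b) u j)" t
    by (rule arena_index) simp
  interpret oracle_machine ora tim K N B Z by (rule oracle_machine)
  show ?thesis
  proof
    show "s < n" by (rule st)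
    show "n * n \<le> N" using n_le_S by (intro mult_mono) auto
    show "(n + 1) * 2 ^ (2 * S) < 2 ^ K" by (rule power_bound)
    show "tim (u # js) \<le> B \<and> (ora (u # js) \<longleftrightarrow>
        (if b then \<not> index_winning b u (set js) else index_winning b u (arc_heads u - set js)))"
      if "u < n" "u \<noteq> t" "distinct js" "set js \<subseteq> arc_heads u" for u js
      using answers[OF that] by blast
  qed (auto simp: weights_def int_cost_le)
qed

end

lemma writes_solve: "writes (solve b w w') = {''i'', ''fin'', ''val'', ''dist'', ''r'', ''best'', ''k'', ''u'', ''j'',
  ''th'', ''q'', ''len'', ''ans'', ''bu'', ''bth'', ''g'', ''gd'', ''gi'', ''next'', ''mark'', ''x'', ''A'', ''B''}"
  by (auto simp: solve_def dijkstra_def search_def test_def update_def trace_def emit_def set_bit_def)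

context oracle_machine
begin

lemma wp_Branch_True: "val e m \<noteq> 0 \<Longrightarrow> wp c Q m \<Longrightarrow> wp (Branch e c d) Q m"
  and wp_Branch_False: "val e m = 0 \<Longrightarrow> wp d Q m \<Longrightarrow> wp (Branch e c d) Q m"
  by simp_all

lemma wp_Then: "wp (Then c d) Q = wp c (wp d Q)"
  by (rule ext) simp

end

section \<open>From final memories to equilibria\<close>

context encoded_game
begin

sublocale oracle_machine ora tim K N B Z
  by (rule oracle_machine)

text \<open>This is \<open>solved\<close> with the parameters of \<open>phase\<close> instantiated,
  so that runs for both players can be discussed side by side.\<close>

definition solution :: "bool \<Rightarrow> memory \<Rightarrow> bool" where
  "solution b m \<longleftrightarrow> (\<exists>F v d nx p.
     certificate {..<n} arc_heads (index_winning b) (\<lambda>u j. real (int_cost b u j))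
       (\<lambda>u j. real (int_cost (\<not> b) u j)) t F v d nx \<and>
     follows F t nx p \<and> (if s \<in> F then walk s p t else p = []) \<and> (m ''fin'' s \<noteq> 0 \<longleftrightarrow> s \<in> F) \<and>
     (\<forall>u<n. \<forall>j<n.
        (m ''A'' (u * n + j) \<noteq> 0 \<longleftrightarrow> j \<in> safe_heads arc_heads (\<lambda>u j. real (int_cost b u j)) F v u) \<and>
        (m ''B'' (u * n + j) \<noteq> 0 \<longleftrightarrow> j \<in> guard_heads arc_heads (\<lambda>u j. real (int_cost b u j)) F v p u)))"

definition encoded :: "memory \<Rightarrow> bool" where
  "encoded m \<longleftrightarrow> m ''n'' 0 = n \<and> m ''s'' 0 = s \<and> m ''t'' 0 = t \<and>
     (\<forall>u<n. \<forall>j<n. m ''arc'' (u * n + j) = (if j \<in> arc_heads u then 1 else 0)) \<and>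
     (\<forall>b. \<forall>u<n. \<forall>j\<in>arc_heads u. m (weights b) (u * n + j) = int_cost b u j)"

lemma encoded_agree:
  assumes "encoded m" "agree X m m'" "X \<inter> {''n'', ''s'', ''t'', ''arc'', ''w1'', ''w2''} = {}"
  shows "encoded m'"
proof -
  have "m' ''n'' = m ''n''" "m' ''s'' = m ''s''" "m' ''t'' = m ''t''" "m' ''arc'' = m ''arc''"
    "m' (weights b) = m (weights b)" for b
    using assms(3) by (auto intro!: agreeD[OF assms(2)] simp: weights_def)
  with assms(1) show ?thesis by (simp add: encoded_def)
qed

lemma wp_solution:
  assumes "encoded m"
  shows "wp (solve b (weights b) (weights (\<not> b))) (solution b) m"
proof -
  interpret phase ora tim K N B Z n arc_heads "index_winning b" "int_cost b" "int_cost (\<not> b)" t s b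
    "weights b" "weights (\<not> b)" "2 ^ (2 * S)"
    by (rule phase)
  have "env m" using assms by (simp add: env_def encoded_def)
  from wp_solve[OF this] have "wp (solve b (weights b) (weights (\<not> b))) solved m" .
  then show ?thesis by (rule wp_conseq) (simp add: solved_def solution_def)
qed

text \<open>Transport along \<open>vertex\<close> with inverse \<open>index\<close>.
  \<open>F\<close>, \<open>v\<close> and \<open>p\<close> remain existential; what follows reads off
  only the two matrices and whether the source is settled.\<close>

lemma solution_certified:
  assumes "solution b m"
  shows "\<exists>F v p A B'. certified \<Gamma> scaled_cost b F v p A B' \<and> (source \<Gamma> \<in> F \<longleftrightarrow> m ''fin'' s \<noteq> 0) \<and>
    (\<forall>i<n. A (vertex i) = vertex ` {j. j < n \<and> m ''A'' (i * n + j) \<noteq> 0} \<and>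
      B' (vertex i) = vertex ` {j. j < n \<and> m ''B'' (i * n + j) \<noteq> 0})"
proof -
  let ?R = "\<lambda>u j. real (int_cost b u j)" and ?R' = "\<lambda>u j. real (int_cost (\<not> b) u j)"
  obtain F v d nx p where
    c: "certificate {..<n} arc_heads (index_winning b) ?R ?R' t F v d nx"
    and f: "follows F t nx p" and w: "if s \<in> F then walk s p t else p = []"
    and fin: "m ''fin'' s \<noteq> 0 \<longleftrightarrow> s \<in> F"
    and AB: "\<And>u j. u < n \<Longrightarrow> j < n \<Longrightarrow> m ''A'' (u * n + j) \<noteq> 0 \<longleftrightarrow> j \<in> safe_heads arc_heads ?R F v u"
      "\<And>u j. u < n \<Longrightarrow> j < n \<Longrightarrow> m ''B'' (u * n + j) \<noteq> 0 \<longleftrightarrow> j \<in> guard_heads arc_heads ?R F v p u"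
    using assms unfolding solution_def by blast
  let ?F = "vertex ` F" and ?v = "v \<circ> index" and ?p = "map (map_prod vertex vertex) p"
  have FV: "F \<subseteq> {..<n}" using c by (simp add: certificate_def)
  have tn: "t \<in> {..<n}" using st by simp
  have En: "arc_heads u \<subseteq> {..<n}" for u by (auto simp: arc_heads_def)
  have Mv: "winning \<Gamma> b (vertex u) (vertex ` X) \<longleftrightarrow> index_winning b u X" for u X
    by (simp add: index_winning_def)
  have pre: "\<And>u. u \<in> {..<n} \<Longrightarrow> index (vertex u) = u"
    "\<And>u. u \<in> {..<n} \<Longrightarrow> succs \<Gamma> (vertex u) = vertex ` arc_heads u"
    "\<And>u w. u \<in> {..<n} \<Longrightarrow> w \<in> arc_heads u \<Longrightarrow> scaled_cost b' (vertex u) (vertex w) = real (int_cost b' u w)" for b'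
    using index_vertex succs_vertex int_cost_scaled by simp_all
  note image = certificate_image[where g = vertex and h = index and Ev = "succs \<Gamma>" and Mv = "winning \<Gamma> b"
      and Rv = "scaled_cost b" and Rv' = "scaled_cost (\<not> b)", OF c tn En]
  have cert: "certificate (vertex ` {..<n}) (succs \<Gamma>) (winning \<Gamma> b) (scaled_cost b) (scaled_cost (\<not> b))
      (vertex t) ?F ?v (d \<circ> index) (vertex \<circ> nx \<circ> index)"
    by (rule image(1)) (simp_all only: pre Mv)
  have safe: "safe_heads (succs \<Gamma>) (scaled_cost b) ?F ?v (vertex u) = vertex ` safe_heads arc_heads ?R F v u"
    if "u < n" for u
    by (rule image(2)) (simp_all only: pre Mv that lessThan_iff)
  have guard: "guard_heads (succs \<Gamma>) (scaled_cost b) ?F ?v ?p (vertex u) = vertex ` guard_heads arc_heads ?R F v p u"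
    if "u < n" for u
    by (rule image(3)) (simp_all only: pre Mv that lessThan_iff f)
  have fol: "follows ?F (vertex t) (vertex \<circ> nx \<circ> index) ?p"
    by (rule image(4)) (simp_all only: pre Mv f)
  have sF: "source \<Gamma> \<in> ?F \<longleftrightarrow> s \<in> F"
  proof
    assume "source \<Gamma> \<in> ?F"
    then obtain i where i: "i \<in> F" "vertex s = vertex i" using st(2) by auto
    then have "i < n" using FV by auto
    then have "s = i" using i(2) vertex_eq_iff[OF st(1)] by simp
    then show "s \<in> F" using i(1) by simp
  next
    assume "s \<in> F"
    then show "source \<Gamma> \<in> ?F" using st(2) by (metis image_eqI)
  qed
  have walk: "if source \<Gamma> \<in> ?F then walk (source \<Gamma>) ?p (target \<Gamma>) else ?p = []"
    using w walk_image[of s p t vertex] sF st by simp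
  let ?A = "safe_heads (succs \<Gamma>) (scaled_cost b) ?F ?v" and ?B = "guard_heads (succs \<Gamma>) (scaled_cost b) ?F ?v ?p"
  show ?thesis
  proof (intro exI conjI allI impI)
    show "certified \<Gamma> scaled_cost b ?F ?v ?p ?A ?B"
      unfolding certified_def[OF game]
    proof (intro exI conjI ballI)
      show "certificate (pverts (graph \<Gamma>)) (succs \<Gamma>) (winning \<Gamma> b) (scaled_cost b) (scaled_cost (\<not> b))
        (target \<Gamma>) ?F ?v (d \<circ> index) (vertex \<circ> nx \<circ> index)"
        using cert unfolding vertex_image st .
      show "follows ?F (target \<Gamma>) (vertex \<circ> nx \<circ> index) ?p" using fol unfolding st .
    qed (rule walk refl)+
    show "source \<Gamma> \<in> ?F \<longleftrightarrow> m ''fin'' s \<noteq> 0" using sF fin by simp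
    show "?A (vertex i) = vertex ` {j. j < n \<and> m ''A'' (i * n + j) \<noteq> 0}" if i: "i < n" for i
    proof -
      have "{j. j < n \<and> m ''A'' (i * n + j) \<noteq> 0} = safe_heads arc_heads ?R F v i"
        using AB(1)[OF i] En by (auto simp: safe_heads_def)
      then show ?thesis using safe[OF i] by simp
    qed
    show "?B (vertex i) = vertex ` {j. j < n \<and> m ''B'' (i * n + j) \<noteq> 0}" if i: "i < n" for i
    proof -
      have "{j. j < n \<and> m ''B'' (i * n + j) \<noteq> 0} = guard_heads arc_heads ?R F v p i"
        using AB(2)[OF i] En by (auto simp: guard_heads_def)
      then show ?thesis using guard[OF i] by simp
    qed
  qed
qed

lemma strategy_of_vertex:
  assumes "i < n"
  shows "strategy_of P a (vertex i) = Pair (vertex i) ` vertex ` {j. j < n \<and> a (i * n + j) \<noteq> 0}"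
proof -
  have "vertex i' = vertex i \<longleftrightarrow> i' = i" if "i' < n" for i' using vertex_eq_iff[OF that assms] .
  then show ?thesis
    unfolding strategy_of_def Let_def using assms by (auto simp: image_image)
qed

text \<open>\<open>m\<close> and \<open>m'\<close> are the memories after the two runs. The
  hypothesis on \<open>m'\<close> is conditional because the second run takes place only if the
  first one misses the source.\<close>

lemma equilibrium_solution:
  assumes sT: "solution True m" and sF: "m ''fin'' s = 0 \<Longrightarrow> solution False m'"
    and \<sigma>2: "\<And>u j. u < n \<Longrightarrow> j < n \<Longrightarrow> a2 (u * n + j) \<noteq> 0 \<longleftrightarrow>
      (if m ''fin'' s \<noteq> 0 then m ''A'' (u * n + j) else m' ''B'' (u * n + j)) \<noteq> 0"
    and \<sigma>1: "\<And>u j. u < n \<Longrightarrow> j < n \<Longrightarrow> a1 (u * n + j) \<noteq> 0 \<longleftrightarrow> j \<in> arc_heads u \<and>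
      (if m ''fin'' s \<noteq> 0 then m ''B'' (u * n + j)
       else if m' ''fin'' s \<noteq> 0 then m' ''A'' (u * n + j) else m ''B'' (u * n + j)) = 0"
  shows "nash_equilibrium \<Gamma> (strategy_of P a1) (strategy_of P a2)"
proof -
  from solution_certified[OF sT] obtain F v p A B' where
    "certified \<Gamma> scaled_cost True F v p A B' \<and> (source \<Gamma> \<in> F \<longleftrightarrow> m ''fin'' s \<noteq> 0) \<and>
    (\<forall>i<n. A (vertex i) = vertex ` {j. j < n \<and> m ''A'' (i * n + j) \<noteq> 0} \<and>
      B' (vertex i) = vertex ` {j. j < n \<and> m ''B'' (i * n + j) \<noteq> 0})"
    by (elim exE)
  then have T: "certified \<Gamma> scaled_cost True F v p A B'"
    "source \<Gamma> \<in> F \<longleftrightarrow> m ''fin'' s \<noteq> 0"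
    "\<And>i. i < n \<Longrightarrow> A (vertex i) = vertex ` {j. j < n \<and> m ''A'' (i * n + j) \<noteq> 0}"
    "\<And>i. i < n \<Longrightarrow> B' (vertex i) = vertex ` {j. j < n \<and> m ''B'' (i * n + j) \<noteq> 0}"
    by blast+
  \<comment> \<open>The implication inside the existential provides witnesses in either case,
    arbitrary ones if there was no second run.\<close>
  have "\<exists>F v p A B'. m ''fin'' s = 0 \<longrightarrow> certified \<Gamma> scaled_cost False F v p A B' \<and>
    (source \<Gamma> \<in> F \<longleftrightarrow> m' ''fin'' s \<noteq> 0) \<and>
    (\<forall>i<n. A (vertex i) = vertex ` {j. j < n \<and> m' ''A'' (i * n + j) \<noteq> 0} \<and>
      B' (vertex i) = vertex ` {j. j < n \<and> m' ''B'' (i * n + j) \<noteq> 0})"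
  proof (cases "m ''fin'' s = 0")
    case True
    show ?thesis
      using solution_certified[OF sF[OF True]] unfolding eqTrueI[OF True] by (simp only: simp_thms)
  qed simp
  then obtain F' v' p' A' B'' where
    "m ''fin'' s = 0 \<longrightarrow> certified \<Gamma> scaled_cost False F' v' p' A' B'' \<and>
    (source \<Gamma> \<in> F' \<longleftrightarrow> m' ''fin'' s \<noteq> 0) \<and>
    (\<forall>i<n. A' (vertex i) = vertex ` {j. j < n \<and> m' ''A'' (i * n + j) \<noteq> 0} \<and>
      B'' (vertex i) = vertex ` {j. j < n \<and> m' ''B'' (i * n + j) \<noteq> 0})"
    by (elim exE)
  then have U: "m ''fin'' s = 0 \<Longrightarrow> certified \<Gamma> scaled_cost False F' v' p' A' B''"
    "m ''fin'' s = 0 \<Longrightarrow> source \<Gamma> \<in> F' \<longleftrightarrow> m' ''fin'' s \<noteq> 0"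
    "\<And>i. m ''fin'' s = 0 \<Longrightarrow> i < n \<Longrightarrow> A' (vertex i) = vertex ` {j. j < n \<and> m' ''A'' (i * n + j) \<noteq> 0}"
    "\<And>i. m ''fin'' s = 0 \<Longrightarrow> i < n \<Longrightarrow> B'' (vertex i) = vertex ` {j. j < n \<and> m' ''B'' (i * n + j) \<noteq> 0}"
    by blast+
  have vert: "\<exists>i<n. u = vertex i" if "u \<in> choice_verts \<Gamma>" for u
    using that vertex_index[of u] unfolding choice_verts_def by (metis DiffD1)
  have diff: "vertex ` {j. j < n \<and> j \<in> arc_heads i \<and> x j = (0::nat)}
    = succs \<Gamma> (vertex i) - vertex ` {j. j < n \<and> x j \<noteq> 0}" if "i < n" for i x
  proof -
    have "inj_on vertex {..<n}" by (rule inj_on_nth[OF distinct_listing]) simp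
    then have "vertex ` (arc_heads i - {j. j < n \<and> x j \<noteq> 0})
      = vertex ` arc_heads i - vertex ` {j. j < n \<and> x j \<noteq> 0}"
      by (rule inj_on_image_set_diff) (auto simp: arc_heads_def)
    moreover have "arc_heads i - {j. j < n \<and> x j \<noteq> 0} = {j. j < n \<and> j \<in> arc_heads i \<and> x j = 0}"
      by (auto simp: arc_heads_def)
    ultimately show ?thesis using succs_vertex[OF that] by simp
  qed
  show ?thesis
  proof (rule nash_equilibrium_certified[OF game rescaled_scaled T(1)])
    show "certified \<Gamma> scaled_cost False F' v' p' A' B''" if "source \<Gamma> \<notin> F"
      using that T(2) U(1) by simp
    fix u assume "u \<in> choice_verts \<Gamma>"
    then obtain i where i: "i < n" "u = vertex i" using vert by blast
    let ?x = "\<lambda>j. if m ''fin'' s \<noteq> 0 then m ''B'' (i * n + j)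
       else if m' ''fin'' s \<noteq> 0 then m' ''A'' (i * n + j) else m ''B'' (i * n + j)"
    let ?y = "\<lambda>j. if m ''fin'' s \<noteq> 0 then m ''A'' (i * n + j) else m' ''B'' (i * n + j)"
    have x: "(if source \<Gamma> \<in> F then B' u else if source \<Gamma> \<in> F' then A' u else B' u)
      = vertex ` {j. j < n \<and> ?x j \<noteq> 0}"
      using T(2,4) U(2,3) i by (cases "m ''fin'' s = 0") simp_all
    have "{j. j < n \<and> a1 (i * n + j) \<noteq> 0} = {j. j < n \<and> j \<in> arc_heads i \<and> ?x j = 0}"
      using \<sigma>1[OF i(1)] by (intro Collect_cong conj_cong refl) blast
    then show "strategy_of P a1 u = Pair u ` (succs \<Gamma> u -
        (if source \<Gamma> \<in> F then B' u else if source \<Gamma> \<in> F' then A' u else B' u))"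
      unfolding x unfolding i(2) strategy_of_vertex[OF i(1)] by (simp only: diff[OF i(1)])
    have y: "(if source \<Gamma> \<in> F then A u else B'' u) = vertex ` {j. j < n \<and> ?y j \<noteq> 0}"
      using T(2,3) U(4) i by (cases "m ''fin'' s = 0") simp_all
    have "{j. j < n \<and> a2 (i * n + j) \<noteq> 0} = {j. j < n \<and> ?y j \<noteq> 0}"
      using \<sigma>2[OF i(1)] by (intro Collect_cong conj_cong refl) blast
    then show "strategy_of P a2 u = Pair u ` (if source \<Gamma> \<in> F then A u else B'' u)"
      unfolding y unfolding i(2) strategy_of_vertex[OF i(1)] by (simp only:)
  qed
qed

lemma arc_matrix_entry:
  assumes "u < n" "j < n"
  shows "arc_matrix \<Gamma> P f (u * n + j) = (if j \<in> arc_heads u then f (vertex u, vertex j) else 0)"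
  using div_mod_index[OF assms] assms by (simp add: arc_matrix_def arc_heads_def Let_def)

definition num_array :: "bool \<Rightarrow> string" where "num_array b = (if b then ''num2'' else ''num1'')"
definition den_array :: "bool \<Rightarrow> string" where "den_array b = (if b then ''den2'' else ''den1'')"

definition input :: "memory \<Rightarrow> bool" where
  "input m \<longleftrightarrow> m ''n'' 0 = n \<and> m ''s'' 0 = s \<and> m ''t'' 0 = t \<and> m ''arc'' = arc_matrix \<Gamma> P (\<lambda>_. 1) \<and>
     (\<forall>b. m (num_array b) = arc_matrix \<Gamma> P (num b) \<and> m (den_array b) = arc_matrix \<Gamma> P (den b))"

lemma input_input_memory: "input (input_memory \<Gamma> P)"
  by (simp add: input_def input_memory_def scalar_def num_array_def den_array_def num_def den_def)

lemma input_agree: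
  assumes "input m" "agree {''lcm'', ''k'', weights b} m m'"
  shows "input m'"
proof -
  have "m' ''n'' = m ''n''" "m' ''s'' = m ''s''" "m' ''t'' = m ''t''" "m' ''arc'' = m ''arc''"
    "m' (num_array b') = m (num_array b')" "m' (den_array b') = m (den_array b')" for b'
    by (auto intro!: agreeD[OF assms(2)] simp: weights_def num_array_def den_array_def split: if_splits)
  with assms(1) show ?thesis by (simp add: input_def)
qed

lemma nn_le: "n * n \<le> N"
  using n_le_S by (intro mult_mono) auto

text \<open>Nonzero positions of the arc matrix correspond bijectively to arcs, so the program's
  product over positions is the product over all arcs.\<close>

lemma common_den_index: "(\<Prod>k | k < n * n \<and> arc_matrix \<Gamma> P (\<lambda>_. 1) k \<noteq> 0. arc_matrix \<Gamma> P (den b) k) = common_den b"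
proof -
  let ?I = "{k. k < n * n \<and> arc_matrix \<Gamma> P (\<lambda>_. 1) k \<noteq> 0}"
  let ?e = "\<lambda>k. (vertex (k div n), vertex (k mod n))"
  have range: "k div n < n" "k mod n < n" if "k < n * n" for k
    using that st(1) by (cases "n = 0"; simp add: less_mult_imp_div_less)+
  have arc: "arc_matrix \<Gamma> P f k = (if ?e k \<in> parcs (graph \<Gamma>) then f (?e k) else 0)" if "k < n * n" for f k
    using that by (simp add: arc_matrix_def Let_def)
  have I: "?I = {k. k < n * n \<and> ?e k \<in> parcs (graph \<Gamma>)}"
    using arc[of _ "\<lambda>_. 1"] by (intro Collect_cong conj_cong refl) simp
  have inj: "inj_on ?e ?I"
  proof (rule inj_onI)
    fix k k' assume k: "k \<in> ?I" "k' \<in> ?I" "?e k = ?e k'"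
    then have "k div n = k' div n" "k mod n = k' mod n"
      using range vertex_eq_iff by auto
    then show "k = k'" by (metis div_mult_mod_eq)
  qed
  have "?e ` ?I = parcs (graph \<Gamma>)"
  proof
    show "?e ` ?I \<subseteq> parcs (graph \<Gamma>)" unfolding I by auto
    show "parcs (graph \<Gamma>) \<subseteq> ?e ` ?I"
    proof
      fix a assume a: "a \<in> parcs (graph \<Gamma>)"
      obtain u w where uw: "a = (u, w)" by (cases a)
      have i: "index u < n" "vertex (index u) = u" "index w < n" "vertex (index w) = w"
        using vertex_index arc_ends a uw by blast+
      have "?e (index u * n + index w) = a" "index u * n + index w < n * n"
        using div_mod_index[OF i(1,3)] i uw by simp_all
      with a show "a \<in> ?e ` ?I" unfolding I by (intro rev_image_eqI[of "index u * n + index w"]) auto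
    qed
  qed
  moreover have "(\<Prod>k\<in>?I. arc_matrix \<Gamma> P (den b) k) = (\<Prod>k\<in>?I. den b (?e k))"
    using arc by (intro prod.cong) (auto simp: I)
  ultimately show ?thesis using prod.reindex[OF inj, of "den b"] by (simp add: common_den_def)
qed

lemma wp_prepare_input:
  assumes "input m"
  shows "wp (prepare (num_array b) (den_array b) (weights b))
    (\<lambda>m'. \<forall>u<n. \<forall>j\<in>arc_heads u. m' (weights b) (u * n + j) = int_cost b u j) m"
proof -
  have m: "m ''n'' 0 = n" "m ''arc'' = arc_matrix \<Gamma> P (\<lambda>_. 1)" "m (num_array b) = arc_matrix \<Gamma> P (num b)"
    "m (den_array b) = arc_matrix \<Gamma> P (den b)" using assms by (simp_all add: input_def)
  let ?e = "\<lambda>k. (vertex (k div n), vertex (k mod n))"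
  have arc: "arc_matrix \<Gamma> P f k = (if ?e k \<in> parcs (graph \<Gamma>) then f (?e k) else 0)" if "k < n * n" for f k
    using that by (simp add: arc_matrix_def Let_def)
  have "wp (prepare (num_array b) (den_array b) (weights b)) (\<lambda>m'. \<forall>k<n * n. m ''arc'' k \<noteq> 0 \<longrightarrow>
    m' (weights b) k = m (num_array b) k * common_den b div m (den_array b) k) m"
  proof (rule wp_prepare[where m = m and n = n, OF m(1) nn_le])
    show "{num_array b, den_array b, weights b} \<inter> {''lcm'', ''k'', ''n'', ''arc''} = {}"
      "weights b \<noteq> num_array b" "weights b \<noteq> den_array b"
      by (auto simp: num_array_def den_array_def weights_def)
    show "common_den b = (\<Prod>k | k < n * n \<and> m ''arc'' k \<noteq> 0. m (den_array b) k)"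
      unfolding m(2,4) common_den_index ..
    have "(2::nat) ^ S < 2 ^ K" "(2::nat) ^ (2 * S) < 2 ^ K" using S_pos by (intro power_strict_increasing; simp)+
    then show "common_den b < 2 ^ K" using common_den_le[of b] by linarith
    fix k assume k: "k < n * n" "m ''arc'' k \<noteq> 0"
    then have a: "?e k \<in> parcs (graph \<Gamma>)" by (simp add: m(2) arc split: if_splits)
    then show "0 < m (den_array b) k" using den_pos by (simp add: m(4) arc[OF k(1)])
    show "m (num_array b) k * common_den b < 2 ^ K"
      using num_common_den[OF a, of b] \<open>(2::nat) ^ (2 * S) < 2 ^ K\<close> a by (simp add: m(3) arc[OF k(1)])
  qed
  then show ?thesis
  proof (rule wp_conseq, intro allI impI ballI)
    fix m' u j
    assume w: "\<forall>k<n * n. m ''arc'' k \<noteq> 0 \<longrightarrow>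
      m' (weights b) k = m (num_array b) k * common_den b div m (den_array b) k"
      and u: "u < n" and j: "j \<in> arc_heads u"
    have jn: "j < n" using j by (simp add: arc_heads_def)
    show "m' (weights b) (u * n + j) = int_cost b u j"
      using w div_mod_index(3)[OF u jn] arc_matrix_entry[OF u jn] j by (simp add: m int_cost_def)
  qed
qed

lemma main_eq: "main = Then (prepare (num_array False) (den_array False) (weights False))
    (Then (prepare (num_array True) (den_array True) (weights True))
    (Then (solve True (weights True) (weights (\<not> True)))
    (Then (mark_all ''sigma2'' (Cell ''A'' (var ''k'')))
    (Then (mark_all ''sigma1'' (arc_not ''B''))
      (Branch (Minus (Lit 1) (Cell ''fin'' (var ''s'')))
        (Then (solve False (weights False) (weights (\<not> False)))
        (Then (mark_all ''sigma2'' (Cell ''B'' (var ''k'')))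
          (Branch (Cell ''fin'' (var ''s'')) (mark_all ''sigma1'' (arc_not ''A'')) Nop)))
        Nop)))))"
  by (simp add: main_def num_array_def den_array_def weights_def)

lemma wp_copy:
  assumes "encoded m" "a \<in> {''sigma1'', ''sigma2''}" "x \<in> {''A'', ''B''}"
  shows "wp (mark_all a (Cell x (var ''k''))) (\<lambda>m'. \<forall>k<n * n. m' a k \<noteq> 0 \<longleftrightarrow> m x k \<noteq> 0) m"
    and "wp (mark_all a (arc_not x)) (\<lambda>m'. \<forall>k<n * n. m' a k \<noteq> 0 \<longleftrightarrow> m ''arc'' k \<noteq> 0 \<and> m x k = 0) m"
proof -
  have n: "m ''n'' 0 = n" using assms(1) by (simp add: encoded_def)
  have ne: "a \<noteq> ''k''" "a \<noteq> ''n''" using assms(2) by auto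
  have same: "m' x = m x" "m' ''arc'' = m ''arc''" if "agree {a, ''k''} m m'" for m'
    using assms(2,3) by (auto intro!: agreeD[OF that])
  show "wp (mark_all a (Cell x (var ''k''))) (\<lambda>m'. \<forall>k<n * n. m' a k \<noteq> 0 \<longleftrightarrow> m x k \<noteq> 0) m"
    using same by (intro wp_mark_all[where m = m and n = n, OF n nn_le ne]) simp
  show "wp (mark_all a (arc_not x)) (\<lambda>m'. \<forall>k<n * n. m' a k \<noteq> 0 \<longleftrightarrow> m ''arc'' k \<noteq> 0 \<and> m x k = 0) m"
  proof (rule wp_mark_all[where m = m and n = n, OF n nn_le ne])
    fix m' k assume ag: "agree {a, ''k''} m m'" and k: "m' ''k'' 0 = k"
    show "val (arc_not x) m' \<noteq> 0 \<longleftrightarrow> m ''arc'' k \<noteq> 0 \<and> m x k = 0"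
      unfolding arc_not_def using same[OF ag] k by auto
  qed
qed

lemma writes_mark_all: "writes (mark_all a e) = {a, ''k''}"
  by (auto simp: mark_all_def set_bit_def)

lemma wp_second_run:
  assumes enc5: "encoded m5" and sol3: "solution True m3"
    and same5: "m5 ''fin'' = m3 ''fin''" and arc5: "m5 ''arc'' = m3 ''arc''"
    and c4: "\<forall>k<n * n. m5 ''sigma2'' k \<noteq> 0 \<longleftrightarrow> m3 ''A'' k \<noteq> 0"
    and c5: "\<forall>k<n * n. m5 ''sigma1'' k \<noteq> 0 \<longleftrightarrow> m3 ''arc'' k \<noteq> 0 \<and> m3 ''B'' k = 0"
  shows "wp (Branch (Minus (Lit 1) (Cell ''fin'' (var ''s'')))
    (Then (solve False (weights False) (weights (\<not> False))) (Then (mark_all ''sigma2'' (Cell ''B'' (var ''k'')))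
      (Branch (Cell ''fin'' (var ''s'')) (mark_all ''sigma1'' (arc_not ''A'')) Nop))) Nop)
    (\<lambda>m. nash_equilibrium \<Gamma> (strategy_of P (m ''sigma1'')) (strategy_of P (m ''sigma2''))) m5"
    (is "wp _ ?Q _")
proof -
  let ?c2 = "Branch (Cell ''fin'' (var ''s'')) (mark_all ''sigma1'' (arc_not ''A'')) Nop"
  let ?mB2 = "mark_all ''sigma2'' (Cell ''B'' (var ''k''))"
  have s5: "m5 ''s'' 0 = s" using enc5 by (simp add: encoded_def)
  have arc3: "m3 ''arc'' (u * n + j) \<noteq> 0 \<longleftrightarrow> j \<in> arc_heads u" if "u < n" "j < n" for u j
    using that enc5 by (simp add: encoded_def flip: arc5)
  show ?thesis
  proof (cases "m3 ''fin'' s = 0")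
    case False
    have "?Q m5"
    \<comment> \<open>Without a second run, \<open>m3\<close> itself fills the place of the second
      memory.\<close>
    proof (rule equilibrium_solution[OF sol3])
      show "solution False m3" if "m3 ''fin'' s = 0" using False that by simp
      fix u j assume uj: "u < n" "j < n"
      note k = div_mod_index(3)[OF uj]
      show "m5 ''sigma2'' (u * n + j) \<noteq> 0 \<longleftrightarrow>
        (if m3 ''fin'' s \<noteq> 0 then m3 ''A'' (u * n + j) else m3 ''B'' (u * n + j)) \<noteq> 0"
        using c4[rule_format, OF k] False by simp
      show "m5 ''sigma1'' (u * n + j) \<noteq> 0 \<longleftrightarrow> j \<in> arc_heads u \<and>
        (if m3 ''fin'' s \<noteq> 0 then m3 ''B'' (u * n + j)
         else if m3 ''fin'' s \<noteq> 0 then m3 ''A'' (u * n + j) else m3 ''B'' (u * n + j)) = 0"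
        using c5[rule_format, OF k] False arc3[OF uj] by simp
    qed
    moreover have "val (Minus (Lit 1) (Cell ''fin'' (var ''s''))) m5 = 0"
      using False by (simp add: s5 same5)
    ultimately show ?thesis by (intro wp_Branch_False) (simp_all only: wp.simps(1))
  next
    case True
    have "wp (solve False (weights False) (weights (\<not> False))) (wp ?mB2 (wp ?c2 ?Q)) m5"
    proof (rule wp_conseq[OF wp_solution[OF enc5]])
      fix m6 assume sol6: "solution False m6" and ag6: "agree (writes (solve False (weights False) (weights (\<not> False)))) m5 m6"
      have enc6: "encoded m6" by (rule encoded_agree[OF enc5 ag6]) (simp add: writes_solve)
      have same6: "m6 ''sigma1'' = m5 ''sigma1''" "m6 ''arc'' = m3 ''arc''"
        using arc5 ag6 by (simp_all add: agree_def writes_solve)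
      show "wp ?mB2 (wp ?c2 ?Q) m6"
      proof (rule wp_conseq[OF wp_copy(1)[OF enc6]], simp, simp, unfold writes_mark_all)
        fix m7 assume c7: "\<forall>k<n * n. m7 ''sigma2'' k \<noteq> 0 \<longleftrightarrow> m6 ''B'' k \<noteq> 0"
          and ag7: "agree {''sigma2'', ''k''} m6 m7"
        have enc7: "encoded m7" by (rule encoded_agree[OF enc6 ag7]) simp
        then have s7: "m7 ''s'' 0 = s" by (simp add: encoded_def)
        have same7: "m7 ''fin'' = m6 ''fin''" "m7 ''sigma1'' = m5 ''sigma1''" "m7 ''arc'' = m3 ''arc''"
          "m7 ''A'' = m6 ''A''"
          using ag7 same6 by (simp_all add: agree_def)
        \<comment> \<open>Both outcomes of the second run end here: \<open>sigma1\<close> either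
          becomes the complement of the new \<open>A\<close> or keeps the complement of the old
          \<open>B\<close>.\<close>
        have eq: "?Q m8" if sig2: "m8 ''sigma2'' = m7 ''sigma2''"
          and sig1: "\<And>k. k < n * n \<Longrightarrow> m8 ''sigma1'' k \<noteq> 0 \<longleftrightarrow> m3 ''arc'' k \<noteq> 0 \<and>
            (if m6 ''fin'' s \<noteq> 0 then m6 ''A'' k else m3 ''B'' k) = 0" for m8 :: memory
        proof (rule equilibrium_solution[OF sol3 sol6])
          fix u j assume uj: "u < n" "j < n"
          note k = div_mod_index(3)[OF uj]
          show "m8 ''sigma2'' (u * n + j) \<noteq> 0 \<longleftrightarrow>
            (if m3 ''fin'' s \<noteq> 0 then m3 ''A'' (u * n + j) else m6 ''B'' (u * n + j)) \<noteq> 0"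
            using c7[rule_format, OF k] True by (simp add: sig2)
          show "m8 ''sigma1'' (u * n + j) \<noteq> 0 \<longleftrightarrow> j \<in> arc_heads u \<and>
            (if m3 ''fin'' s \<noteq> 0 then m3 ''B'' (u * n + j)
             else if m6 ''fin'' s \<noteq> 0 then m6 ''A'' (u * n + j) else m3 ''B'' (u * n + j)) = 0"
            using sig1[OF k] True arc3[OF uj] by simp
        qed
        show "wp ?c2 ?Q m7"
        proof (cases "m6 ''fin'' s = 0")
          case fin6: True
          have "?Q m7"
            using c5 fin6 same7 by (intro eq) simp_all
          moreover have "val (Cell ''fin'' (var ''s'')) m7 = 0" using fin6 by (simp add: s7 same7)
          ultimately show ?thesis by (intro wp_Branch_False) (simp_all only: wp.simps(1))
        next
          case fin6: False
          have "wp (mark_all ''sigma1'' (arc_not ''A'')) ?Q m7"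
          proof (rule wp_conseq[OF wp_copy(2)[OF enc7]], simp, simp, unfold writes_mark_all)
            fix m8 assume c8: "\<forall>k<n * n. m8 ''sigma1'' k \<noteq> 0 \<longleftrightarrow> m7 ''arc'' k \<noteq> 0 \<and> m7 ''A'' k = 0"
              and ag8: "agree {''sigma1'', ''k''} m7 m8"
            have "m8 ''sigma2'' = m7 ''sigma2''" using ag8 by (simp add: agree_def)
            then show "?Q m8" using c8 fin6 same7 by (intro eq) simp_all
          qed
          moreover have "val (Cell ''fin'' (var ''s'')) m7 \<noteq> 0" using fin6 by (simp add: s7 same7)
          ultimately show ?thesis by (rule wp_Branch_True[rotated])
        qed
      qed
    qed
    note W = this
    have c: "val (Minus (Lit 1) (Cell ''fin'' (var ''s''))) m5 \<noteq> 0"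
      using True by (simp add: s5 same5)
    show ?thesis by (rule wp_Branch_True[OF c], unfold wp_Then, rule W)
  qed
qed

lemma wp_main:
  "wp main (\<lambda>m. nash_equilibrium \<Gamma> (strategy_of P (m ''sigma1'')) (strategy_of P (m ''sigma2'')))
     (input_memory \<Gamma> P)" (is "wp main ?Q ?m0")
proof -
  note in0 = input_input_memory
  have wr: "writes (prepare (num_array b) (den_array b) (weights b)) = {''lcm'', ''k'', weights b}" for b
    by (auto simp: prepare_def)
  let ?c2 = "Branch (Cell ''fin'' (var ''s'')) (mark_all ''sigma1'' (arc_not ''A'')) Nop"
  let ?mA = "mark_all ''sigma2'' (Cell ''A'' (var ''k''))" and ?mB = "mark_all ''sigma1'' (arc_not ''B'')"
  let ?mB2 = "mark_all ''sigma2'' (Cell ''B'' (var ''k''))"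
  let ?c1 = "Branch (Minus (Lit 1) (Cell ''fin'' (var ''s'')))
    (Then (solve False (weights False) (weights (\<not> False))) (Then ?mB2 ?c2)) Nop"
  show ?thesis
    unfolding main_eq wp.simps(3)
  proof (rule wp_conseq[OF wp_prepare_input[OF in0]], unfold wr)
    fix m1 assume w1: "\<forall>u<n. \<forall>j\<in>arc_heads u. m1 (weights False) (u * n + j) = int_cost False u j"
      and ag1: "agree {''lcm'', ''k'', weights False} ?m0 m1"
    note in1 = input_agree[OF in0 ag1]
    show "wp (prepare (num_array True) (den_array True) (weights True)) (wp (solve True (weights True) (weights (\<not> True))) (wp ?mA (wp ?mB (wp ?c1 ?Q)))) m1"
    proof (rule wp_conseq[OF wp_prepare_input[OF in1]], unfold wr)
      fix m2 assume w2: "\<forall>u<n. \<forall>j\<in>arc_heads u. m2 (weights True) (u * n + j) = int_cost True u j"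
        and ag2: "agree {''lcm'', ''k'', weights True} m1 m2"
      note in2 = input_agree[OF in1 ag2]
      have "m2 (weights False) = m1 (weights False)" by (rule agreeD[OF ag2]) (simp add: weights_def)
      then have "\<forall>u<n. \<forall>j\<in>arc_heads u. m2 (weights b) (u * n + j) = int_cost b u j" for b
        using w1 w2 by (cases b) simp_all
      then have enc2: "encoded m2"
        using in2 arc_matrix_entry by (simp add: encoded_def input_def)
      show "wp (solve True (weights True) (weights (\<not> True))) (wp ?mA (wp ?mB (wp ?c1 ?Q))) m2"
      proof (rule wp_conseq[OF wp_solution[OF enc2]])
        fix m3 assume sol3: "solution True m3" and ag3: "agree (writes (solve True (weights True) (weights (\<not> True)))) m2 m3"
        have enc3: "encoded m3" by (rule encoded_agree[OF enc2 ag3]) (simp add: writes_solve)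
        show "wp ?mA (wp ?mB (wp ?c1 ?Q)) m3"
        proof (rule wp_conseq[OF wp_copy(1)[OF enc3]], simp, simp, unfold writes_mark_all)
          fix m4 assume c4: "\<forall>k<n * n. m4 ''sigma2'' k \<noteq> 0 \<longleftrightarrow> m3 ''A'' k \<noteq> 0"
            and ag4: "agree {''sigma2'', ''k''} m3 m4"
          have enc4: "encoded m4" by (rule encoded_agree[OF enc3 ag4]) simp
          show "wp ?mB (wp ?c1 ?Q) m4"
          proof (rule wp_conseq[OF wp_copy(2)[OF enc4]], simp, simp, unfold writes_mark_all)
            fix m5 assume c5: "\<forall>k<n * n. m5 ''sigma1'' k \<noteq> 0 \<longleftrightarrow> m4 ''arc'' k \<noteq> 0 \<and> m4 ''B'' k = 0"
              and ag5: "agree {''sigma1'', ''k''} m4 m5"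
            have enc5: "encoded m5" by (rule encoded_agree[OF enc4 ag5]) simp
            then show "wp ?c1 ?Q m5"
              by (rule wp_second_run[OF _ sol3]) (use c4 c5 ag4 ag5 in \<open>simp_all add: agree_def\<close>)
          qed
        qed
      qed
    qed
  qed
qed

lemma well_formed_main: "well_formed Z main"
  by (simp add: main_def Z_def prepare_def solve_def dijkstra_def search_def test_def update_def trace_def emit_def
      mark_all_def set_bit_def safe_expr_def guard_expr_def near_def arc_not_def bits_def floorlog_def)

lemma bounded_input: "bounded K (input_memory \<Gamma> P)"
proof -
  have small: "x < 2 ^ K" if "x < 2 ^ S" for x :: nat
    using less_le_trans[OF that power_increasing[of S K]] by simp
  have S2: "S < 2 ^ S" by (rule less_exp)
  have sc: "scalar x i < 2 ^ S" if "x \<le> S" for x i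
    using le_less_trans[OF that S2] by (simp add: scalar_def)
  have mat: "arc_matrix \<Gamma> P f k < 2 ^ S" if "\<And>a. a \<in> parcs (graph \<Gamma>) \<Longrightarrow> f a < 2 ^ S" for f k
    using that by (simp add: arc_matrix_def Let_def)
  have le: "n \<le> S" "s \<le> S" "t \<le> S" using st n_le_S by simp_all
  have one: "(1::nat) < 2 ^ S" using S2 S_pos by linarith
  have "input_memory \<Gamma> P a i < 2 ^ S" for a i
    unfolding input_memory_def fun_upd_apply
    by (simp add: sc[OF le(1)] sc[OF le(2)] sc[OF le(3)] mat[OF num_den_less(1)] mat[OF num_den_less(2)]
        mat[OF num_den_less(3)] mat[OF num_den_less(4)] mat[OF one, unfolded One_nat_def])
  then show ?thesis unfolding bounded_def using small by blast
qed

lemma main_correct: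
  "\<exists>k m. exec ora tim (compile main) (input_memory \<Gamma> P) k m \<and> k \<le> steps N main * unit_time Z K N B \<and>
     nash_equilibrium \<Gamma> (strategy_of P (m ''sigma1'')) (strategy_of P (m ''sigma2''))"
  using wp_sound[OF wp_main well_formed_main bounded_input] unfolding runs_def by blast

end

theorem theorem4:
  shows "(\<forall>\<Gamma> :: 'v sp_game. sp_interdiction_game \<Gamma> \<longrightarrow> (\<exists>\<sigma>1 \<sigma>2. nash_equilibrium \<Gamma> \<sigma>1 \<sigma>2)) \<and>
    (\<exists>c :: program. \<forall>q :: nat poly. \<exists>p :: nat poly.
       \<forall>(\<Gamma> :: 'v sp_game) P ora tim.
         sp_interdiction_game \<Gamma> \<longrightarrow> presents P \<Gamma> \<longrightarrow>
         independence_oracle \<Gamma> P (poly q (input_size \<Gamma> P)) ora tim \<longrightarrow>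
         (\<exists>k m. exec ora tim c (input_memory \<Gamma> P) k m \<and>
                k \<le> poly p (input_size \<Gamma> P) \<and>
                nash_equilibrium \<Gamma> (strategy_of P (m ''sigma1'')) (strategy_of P (m ''sigma2''))))"
proof (intro conjI exI[of _ "compile main"] allI impI)
  show "\<exists>\<sigma>1 \<sigma>2. nash_equilibrium \<Gamma> \<sigma>1 \<sigma>2" if "sp_interdiction_game \<Gamma>" for \<Gamma> :: "'v sp_game"
    using nash_equilibrium_exists[OF that] .
next
  fix q :: "nat poly"
  obtain r :: "nat poly" where r: "\<forall>N. steps N main = poly r N" using steps_poly by blast
  \<comment> \<open>The loop bound \<open>S * S\<close> and the cell length \<open>3 * S + 1\<close>
    as polynomials in the input size \<open>S\<close>. In \<open>?u\<close>, 200 is the weight bound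
    \<open>Z\<close>, and \<open>q\<close> takes the place of the oracle time
    \<open>B\<close>.\<close>
  let ?N = "[:0, 0, 1:] :: nat poly" and ?K = "[:1, 3:] :: nat poly"
  let ?u = "smult 10 ((smult 200 ?K)\<^sup>2) + (?N + 1) * ?K + q + 1"
  let ?p = "pcompose r ?N * ?u"
  have p: "poly ?p x = steps (x * x) main * unit_time 200 (3 * x + 1) (x * x) (poly q x)" for x
    by (simp add: r poly_pcompose unit_time_def algebra_simps)
  show "\<exists>p :: nat poly. \<forall>(\<Gamma> :: 'v sp_game) P ora tim.
         sp_interdiction_game \<Gamma> \<longrightarrow> presents P \<Gamma> \<longrightarrow>
         independence_oracle \<Gamma> P (poly q (input_size \<Gamma> P)) ora tim \<longrightarrow>
         (\<exists>k m. exec ora tim (compile main) (input_memory \<Gamma> P) k m \<and>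
                k \<le> poly p (input_size \<Gamma> P) \<and>
                nash_equilibrium \<Gamma> (strategy_of P (m ''sigma1'')) (strategy_of P (m ''sigma2'')))"
  proof (intro exI[of _ ?p] allI impI)
    fix \<Gamma> :: "'v sp_game" and P ora tim
    assume "sp_interdiction_game \<Gamma>" "presents P \<Gamma>" "independence_oracle \<Gamma> P (poly q (input_size \<Gamma> P)) ora tim"
    then interpret encoded_game \<Gamma> P ora tim "poly q (input_size \<Gamma> P)" by unfold_locales
    show "\<exists>k m. exec ora tim (compile main) (input_memory \<Gamma> P) k m \<and> k \<le> poly ?p (input_size \<Gamma> P) \<and>
        nash_equilibrium \<Gamma> (strategy_of P (m ''sigma1'')) (strategy_of P (m ''sigma2''))"
      unfolding p using main_correct unfolding Z_def .
  qed
qed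

end
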